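(* Let $n\in\mathbb{N}$ and let $p:=p(n)\in[0,1/2]$. Then with high probability the random graph $G(n,p)$ satisfies the following: (i) $f\big(G(n,p)\big)=\Theta\left(\sqrt[3]{pn^2}\right)$ for $p\in[n^{-1/2},1/2]$; (ii) $f\big(G(n,p)\big)=\Theta\big(\Delta(G(n,p))\big)$ for $p\leq n^{-1/2}$.
   Context: $G(n,p)$ is the Erdős–Rényi random graph: the $n$-vertex graph in which each edge is included with probability $p$ independently of every other edge. An event depending on $n$ occurs with high probability if its probability tends to $1$ as $n\to\infty$. $\Delta(G)$ is the maximum degree of a graph $G$. For a graph $G$, $f(G)$ is the maximum $k\in\mathbb{N}$ such that, for some $S\subset V(G)$, the induced subgraph $G[S]$ has $k$ distinct vertex degrees. $\Theta(\cdot)$ is the usual asymptotic notation (upper and lower bounds up to absolute positive constant factors).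
   Formalization: In (ii) the upper bound is f(G) ≤ C·max(1, Δ(G)) instead of f(G) ≤ C·Δ(G), because an edgeless graph (e.g. p = 0) has f = 1 but Δ = 0, so the literal bound fails there; for graphs with at least one edge it is unchanged. *)

theory Defs
  imports "HOL-Probability.Probability"
begin

text \<open>A finite simple graph is given by its vertex set \<open>V\<close> and its edge set \<open>E\<close>, the edges
  being two-element subsets of \<open>V\<close>.\<close>

definition all_edges :: "'a set \<Rightarrow> 'a set set" where
  "all_edges V = {e. e \<subseteq> V \<and> card e = 2}"

definition degree :: "'a set set \<Rightarrow> 'a \<Rightarrow> nat" where
  "degree E v = card {e \<in> E. v \<in> e}"

text \<open>For the empty vertex set this is \<open>Max {}\<close>, which is unspecified.\<close>

definition max_degree :: "'a set \<Rightarrow> 'a set set \<Rightarrow> nat" where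
  "max_degree V E = Max (degree E ` V)"

definition induced_edges :: "'a set set \<Rightarrow> 'a set \<Rightarrow> 'a set set" where
  "induced_edges E S = {e \<in> E. e \<subseteq> S}"

text \<open>The parameter \<open>f\<close>: the largest number of distinct vertex degrees in an induced subgraph.\<close>

definition distinct_degrees :: "'a set \<Rightarrow> 'a set set \<Rightarrow> nat" where
  "distinct_degrees V E =
     Max {k. \<exists>S. S \<subseteq> V \<and> card (degree (induced_edges E S) ` S) = k}"

text \<open>The random graph \<open>G(n,p)\<close> on the vertex set \<open>{..<n}\<close>, as a distribution on edge sets.
  Note that \<^const>\<open>bernoulli_pmf\<close> clamps its argument to the unit interval.\<close>

definition gnp :: "nat \<Rightarrow> real \<Rightarrow> nat set set pmf" where
  "gnp n p = map_pmf (\<lambda>b. {e \<in> all_edges {..<n}. b e})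
     (Pi_pmf (all_edges {..<n}) False (\<lambda>_. bernoulli_pmf p))"

end

theory Submission
  imports Defs "HOL-Real_Asymp.Real_Asymp"
begin

text \<open>Write \<open>f(G)\<close> for the number of distinct degrees, \<open>\<Delta>\<close> for the maximum degree and
  \<open>\<kappa> = (p n\<^sup>2)\<^bsup>1/3\<^esup>\<close>. The degrees in an induced subgraph lie in \<open>{0..\<Delta>}\<close>, which is the
  whole upper bound when \<open>p \<le> n\<^bsup>-1/2\<^esup>\<close>. The other three bounds need an idea each.

  \<^bold>\<open>Upper bound for large \<open>p\<close>.\<close> If \<open>G[S]\<close> has \<open>4m\<close> distinct degrees, then \<open>m\<close> vertices \<open>U\<close> of
  high degree and \<open>m\<close> vertices \<open>D\<close> of low degree have degree sums that differ by at least
  \<open>2m\<^sup>2\<close>. For fixed \<open>(S, U, D)\<close> that difference is a linear form in the edge indicators, of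
  mean \<open>0\<close> and variance at most \<open>4pmn\<close>; for \<open>m \<ge> 3\<kappa>\<close> the exponential Markov inequality makes
  it improbable enough to beat the at most \<open>8\<^sup>n\<close> choices of the triple (\<open>prob_many_degrees\<close>).

  \<^bold>\<open>Lower bound for small \<open>p\<close>.\<close> Suppose that each of \<open>k\<close> vertices has \<open>2k\<close> private
  neighbours: neighbours outside the set that are adjacent to no other vertex of it. Keeping
  suitably many of them tunes the \<open>k\<close> degrees independently of each other, so \<open>f(G) \<ge> k\<close>
  (\<open>distinct_degrees_private_neighbours\<close>). If \<open>np \<ge> (ln n)/10\<close>, then \<open>\<Delta> = O(np)\<close> and any
  \<open>np/16\<close> vertices will do, because \<open>p k\<close> is small. If \<open>np < (ln n)/10\<close>, let \<open>D\<close> be least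
  such that \<open>(e n p / D)\<^sup>D \<le> n\<^sup>-\<^sup>2\<close>; then \<open>\<Delta> < D\<close>, and taking a tenth root of the
  inequality that fails at \<open>D - 1\<close> shows that a single vertex has degree about \<open>D/10\<close> with
  probability at least \<open>n\<^bsup>-2/5\<^esup>\<close>. So there are many such vertices, no two of which have three
  common neighbours (\<open>prob_few_degrees_sparse\<close>).

  \<^bold>\<open>Lower bound for large \<open>p\<close>.\<close> Private neighbours die out once \<open>p k\<close> is large, so the
  tuning has to be collective. Take \<open>A = {0..<k}\<close> with \<open>k = c\<kappa>\<close> and weights \<open>w\<^sub>i = i/k\<close>.
  Of the vertices outside \<open>A\<close>, keep each \<open>u\<close> in the first half with probability
  \<open>1/2 + \<gamma> \<Sum>\<^sub>i w\<^sub>i (1\<^bsub>ui\<^esub> - p)\<close>, truncated to \<open>[0, 1]\<close>, where \<open>\<gamma>\<close> is of order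
  \<open>1 / \<surd>(p\<kappa>)\<close>, and each of the others with probability \<open>1/2\<close>. The expected degree of \<open>i\<close>
  into the kept set then increases in \<open>i\<close> with slope at least \<open>K\<close> of order \<open>1/c\<close>
  (\<open>displacement_drift\<close>), while the actual degrees deviate from this line only by \<open>O(\<surd>(np/c))\<close>
  on average, since an average deviation is a maximum over \<open>2\<^sup>k\<close> sign vectors
  (\<open>prob_displacement_l1\<close>). Hence a typical vertex competes only with the
  \<open>O(\<surd>(np/c) / K) = O(\<surd>(c n p))\<close> vertices nearest to it in \<open>A\<close>. Two given vertices end
  up with equal degree with probability \<open>O(1 / \<surd>(np))\<close>, because at least a quarter of all
  vertices are kept by fair coins, so that a vertex collides with \<open>O(\<surd>c)\<close> others on average.
  For small \<open>c\<close> at least half of the \<open>k\<close> degrees are therefore distinct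
  (\<open>random_rounding_separates\<close>).

  All error probabilities are bounded in terms of \<open>n\<close> alone, by \<open>failure_bound\<close>, so that the
  sequence \<open>p(n)\<close> may move between the regimes in any way.\<close>

section \<open>Independent coin flips\<close>

definition coins :: "'e set \<Rightarrow> ('e \<Rightarrow> real) \<Rightarrow> ('e \<Rightarrow> bool) pmf" where
  "coins E p = Pi_pmf E False (\<lambda>e. bernoulli_pmf (p e))"

text \<open>A function of all flips that only looks at those in \<open>J\<close>. Events about disjoint sets of
  edges are independent, and this predicate is how the disjointness is tracked.\<close>
definition depends_on :: "'e set \<Rightarrow> (('e \<Rightarrow> bool) \<Rightarrow> 'b) \<Rightarrow> bool" where
  "depends_on J F \<longleftrightarrow> (\<forall>y y'. (\<forall>e\<in>J. y e = y' e) \<longrightarrow> F y = F y')"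

abbreviation coins_exp :: "'e set \<Rightarrow> ('e \<Rightarrow> real) \<Rightarrow> (('e \<Rightarrow> bool) \<Rightarrow> real) \<Rightarrow> real" where
  "coins_exp E p \<equiv> measure_pmf.expectation (coins E p)"

lemma depends_onI: "(\<And>y y'. (\<And>e. e \<in> J \<Longrightarrow> y e = y' e) \<Longrightarrow> F y = F y') \<Longrightarrow> depends_on J F"
  unfolding depends_on_def by blast

lemma finite_set_coins: "finite E \<Longrightarrow> finite (set_pmf (coins E p))"
  unfolding coins_def by (subst set_Pi_pmf) (auto intro!: finite_PiE_dflt)

lemma integrable_coins [simp]:
  fixes F :: "_ \<Rightarrow> real"
  shows "finite E \<Longrightarrow> integrable (measure_pmf (coins E p)) F"
  by (rule integrable_measure_pmf_finite[OF finite_set_coins])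

lemma expectation_pair_finite:
  fixes F :: "'a \<times> 'b \<Rightarrow> real"
  assumes "finite (set_pmf P)" "finite (set_pmf Q)"
  shows "measure_pmf.expectation (pair_pmf P Q) F =
    measure_pmf.expectation Q (\<lambda>b. measure_pmf.expectation P (\<lambda>a. F (a, b)))"
proof -
  have "measure_pmf.expectation (pair_pmf P Q) F
      = (\<Sum>x\<in>set_pmf P \<times> set_pmf Q. F x * pmf (pair_pmf P Q) x)"
    using assms by (subst integral_measure_pmf_real[where A="set_pmf P \<times> set_pmf Q"]) auto
  also have "\<dots> = (\<Sum>a\<in>set_pmf P. \<Sum>b\<in>set_pmf Q. F (a, b) * (pmf P a * pmf Q b))"
    by (subst sum.cartesian_product) (auto simp: pmf_pair intro!: sum.cong)
  also have "\<dots> = (\<Sum>b\<in>set_pmf Q. (\<Sum>a\<in>set_pmf P. F (a, b) * pmf P a) * pmf Q b)"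
    by (subst sum.swap) (simp add: sum_distrib_right mult.assoc)
  also have "\<dots> = measure_pmf.expectation Q (\<lambda>b. measure_pmf.expectation P (\<lambda>a. F (a, b)))"
    using assms
    by (simp add: integral_measure_pmf_real[where A="set_pmf P"] integral_measure_pmf_real[where A="set_pmf Q"])
  finally show ?thesis .
qed

text \<open>Conditioning on the flips outside \<open>J\<close>: the basis both of independence and of the collision
  bound, in which all randomness except a set of fair coins is frozen.\<close>
lemma coins_split:
  fixes F :: "('e \<Rightarrow> bool) \<Rightarrow> real"
  assumes "finite E" "J \<subseteq> E"
  shows "coins_exp E p F =
    measure_pmf.expectation (coins (E - J) p) (\<lambda>g.
      measure_pmf.expectation (coins J p) (\<lambda>f. F (\<lambda>e. if e \<in> J then f e else g e)))"
proof -
  have fin: "finite J" "finite (E - J)" using assms finite_subset by auto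
  have "coins E p = coins (J \<union> (E - J)) p" using assms by (simp add: Un_absorb1)
  also have "\<dots> = map_pmf (\<lambda>(f, g) e. if e \<in> J then f e else g e) (pair_pmf (coins J p) (coins (E - J) p))"
    unfolding coins_def using fin by (intro Pi_pmf_union) auto
  finally show ?thesis
    using fin by (simp add: expectation_pair_finite finite_set_coins case_prod_unfold)
qed

lemma coins_indep2:
  fixes F G :: "('e \<Rightarrow> bool) \<Rightarrow> real"
  assumes "finite E" "J \<subseteq> E" "depends_on J F" "depends_on (E - J) G"
  shows "coins_exp E p (\<lambda>y. F y * G y) =
    coins_exp E p F * coins_exp E p G"
proof -
  have F: "F (\<lambda>e. if e \<in> J then f e else g e) = F f" for f g
    using assms(3) by (auto simp: depends_on_def)
  have G: "G (\<lambda>e. if e \<in> J then f e else g e) = G g" for f g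
    using assms(4) by (auto simp: depends_on_def)
  show ?thesis
    by (simp add: coins_split[OF assms(1,2)] F G)
qed

text \<open>Induction over the blocks: each block is split off by \<open>coins_indep2\<close>.\<close>
lemma coins_indep_prod:
  fixes F :: "'u \<Rightarrow> ('e \<Rightarrow> bool) \<Rightarrow> real"
  assumes "finite E" "finite B" "\<And>u. u \<in> B \<Longrightarrow> J u \<subseteq> E" "\<And>u. u \<in> B \<Longrightarrow> depends_on (J u) (F u)"
    "disjoint_family_on J B"
  shows "coins_exp E p (\<lambda>y. \<Prod>u\<in>B. F u y) =
    (\<Prod>u\<in>B. coins_exp E p (F u))"
  using assms(2-)
proof (induction B rule: finite_induct)
  case (insert u B)
  have "depends_on (E - J u) (\<lambda>y. \<Prod>v\<in>B. F v y)"
  proof (rule depends_onI)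
    fix y y' :: "'e \<Rightarrow> bool" assume y: "\<And>e. e \<in> E - J u \<Longrightarrow> y e = y' e"
    have "F v y = F v y'" if "v \<in> B" for v
    proof -
      have "J v \<inter> J u = {}" "J v \<subseteq> E"
        using insert that by (auto simp: disjoint_family_on_def)
      hence "\<forall>e\<in>J v. y e = y' e" using y by auto
      thus ?thesis using insert.prems(2)[of v] that by (auto simp: depends_on_def)
    qed
    thus "(\<Prod>v\<in>B. F v y) = (\<Prod>v\<in>B. F v y')" by simp
  qed
  hence "coins_exp E p (\<lambda>y. F u y * (\<Prod>v\<in>B. F v y)) =
     coins_exp E p (F u) * coins_exp E p (\<lambda>y. \<Prod>v\<in>B. F v y)"
    using insert assms(1) by (intro coins_indep2[where J="J u"]) auto
  thus ?case using insert by (simp add: disjoint_family_on_def)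
qed simp

lemma expectation_mono_coins:
  fixes F G :: "('e \<Rightarrow> bool) \<Rightarrow> real"
  assumes "finite E" "\<And>y. F y \<le> G y"
  shows "coins_exp E p F \<le> coins_exp E p G"
  using assms by (intro integral_mono) auto

lemma prob_eq_expectation:
  "measure_pmf.prob P {y. Q y} = measure_pmf.expectation P (\<lambda>y. of_bool (Q y) :: real)"
proof -
  have "(\<lambda>y. of_bool (Q y) :: real) = indicator {y. Q y}" by (auto simp: indicator_def)
  thus ?thesis by simp
qed

lemma coins_component:
  assumes "finite E" "e \<in> E"
  shows "map_pmf (\<lambda>y. y e) (coins E p) = bernoulli_pmf (p e)"
  using assms by (simp add: coins_def Pi_pmf_component)

lemma expectation_component:
  fixes h :: "bool \<Rightarrow> real"
  assumes "finite E" "e \<in> E" "0 \<le> p e" "p e \<le> 1"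
  shows "coins_exp E p (\<lambda>y. h (y e)) = p e * h True + (1 - p e) * h False"
proof -
  have "coins_exp E p (\<lambda>y. h (y e))
      = measure_pmf.expectation (map_pmf (\<lambda>y. y e) (coins E p)) h" by simp
  also have "\<dots> = p e * h True + (1 - p e) * h False"
    using assms by (simp add: coins_component)
  finally show ?thesis .
qed

lemma prob_markov_exp:
  assumes "finite E"
  shows "measure_pmf.prob (coins E p) {y. t \<le> X y} \<le>
    exp (- t) * coins_exp E p (\<lambda>y. exp (X y))"
proof -
  have "measure_pmf.prob (coins E p) {y. t \<le> X y} \<le>
     coins_exp E p (\<lambda>y. exp (- t) * exp (X y))"
    unfolding prob_eq_expectation
    by (rule expectation_mono_coins[OF assms]) (auto simp flip: exp_add)
  thus ?thesis by simp
qed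

lemma prob_union_bound:
  assumes "finite I"
  shows "measure_pmf.prob P {y. \<exists>i\<in>I. Q i y} \<le> (\<Sum>i\<in>I. measure_pmf.prob P {y. Q i y})"
proof -
  have "{y. \<exists>i\<in>I. Q i y} = (\<Union>i\<in>I. {y. Q i y})" by auto
  thus ?thesis using measure_pmf.finite_measure_subadditive_finite[OF assms, of "\<lambda>i. {y. Q i y}" P] by simp
qed

lemma prob_union_bound_card:
  assumes "finite I" "\<And>i. i \<in> I \<Longrightarrow> measure_pmf.prob P {y. Q i y} \<le> (c::real)"
  shows "measure_pmf.prob P {y. \<exists>i\<in>I. Q i y} \<le> real (card I) * c"
proof -
  have "(\<Sum>i\<in>I. measure_pmf.prob P {y. Q i y}) \<le> (\<Sum>i\<in>I. c)"
    by (intro sum_mono assms(2))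
  thus ?thesis using prob_union_bound[OF assms(1), of P Q] by simp
qed

lemma two_power_le_exp: "2 ^ k \<le> exp (real k)"
proof -
  have "(2::real) ^ k \<le> exp 1 ^ k" using exp_ge_add_one_self[of "1::real"] by (intro power_mono) auto
  thus ?thesis using exp_of_nat_mult[of k "1::real"] by simp
qed

text \<open>The coefficient \<open>1\<close> of the square is what makes \<open>p w\<^sup>2\<close> the variance proxy of a coin of
  weight \<open>w\<close> below.\<close>
lemma exp_le_quadratic:
  fixes x :: real
  assumes "\<bar>x\<bar> \<le> 1"
  shows "exp x \<le> 1 + x + x\<^sup>2"
proof (cases "x \<ge> 0")
  case True
  thus ?thesis using exp_bound[of x] assms by auto
next
  case False
  define z where "z = - x"
  have z: "0 \<le> z" "z \<le> 1" using False assms by (auto simp: z_def)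
  have "(1 + z + z\<^sup>2 / 2) * (1 - z + z\<^sup>2) = 1 + z^2/2 + z^3/2 + z^4/2"
    by (simp add: power2_eq_square power3_eq_cube power4_eq_xxxx field_simps)
  hence "1 \<le> (1 + z + z\<^sup>2 / 2) * (1 - z + z\<^sup>2)" using z by simp
  also have "\<dots> \<le> exp z * (1 - z + z\<^sup>2)"
    using z exp_lower_Taylor_quadratic[of z] by (intro mult_right_mono) auto
  finally have "exp (- z) * 1 \<le> exp (- z) * (exp z * (1 - z + z\<^sup>2))" by (intro mult_left_mono) auto
  also have "\<dots> = 1 - z + z\<^sup>2" by (simp add: mult.assoc[symmetric] flip: exp_add)
  finally show ?thesis by (simp add: z_def)
qed

text \<open>The one concentration estimate behind every linear form in the edges: each factor of the
  product is at most \<open>exp (- w p) (1 + p (w + w\<^sup>2)) \<le> exp (p w\<^sup>2)\<close>.\<close>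
lemma mgf_linear:
  assumes E: "finite E" and p: "\<And>e. e \<in> E \<Longrightarrow> 0 \<le> p e \<and> p e \<le> 1"
    and w: "\<And>e. e \<in> E \<Longrightarrow> \<bar>w e\<bar> \<le> 1" "F \<subseteq> E"
  shows "coins_exp E p (\<lambda>y. exp (\<Sum>e\<in>F. w e * (of_bool (y e) - p e)))
    \<le> exp (\<Sum>e\<in>F. p e * (w e)\<^sup>2)"
proof -
  have F: "finite F" using E w finite_subset by auto
  have "coins_exp E p (\<lambda>y. exp (\<Sum>e\<in>F. w e * (of_bool (y e) - p e)))
     = coins_exp E p (\<lambda>y. \<Prod>e\<in>F. exp (w e * (of_bool (y e) - p e)))"
    using F by (simp add: exp_sum)
  also have "\<dots> = (\<Prod>e\<in>F. coins_exp E p (\<lambda>y. exp (w e * (of_bool (y e) - p e))))"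
    using w by (intro coins_indep_prod[OF E F, where J="\<lambda>e. {e}"])
       (auto simp: depends_on_def disjoint_family_on_def)
  also have "\<dots> \<le> (\<Prod>e\<in>F. exp (p e * (w e)\<^sup>2))"
  proof (intro prod_mono conjI)
    fix e assume e: "e \<in> F"
    hence e': "e \<in> E" using w by auto
    show "0 \<le> coins_exp E p (\<lambda>y. exp (w e * (of_bool (y e) - p e)))" by simp
    have "coins_exp E p (\<lambda>y. exp (w e * (of_bool (y e) - p e)))
      = p e * exp (w e * (1 - p e)) + (1 - p e) * exp (w e * (0 - p e))"
      using expectation_component[OF E e', of p "\<lambda>b. exp (w e * (of_bool b - p e))"] p[OF e'] by simp
    also have "\<dots> = exp (- w e * p e) * (1 + p e * (exp (w e) - 1))"
      by (simp add: algebra_simps flip: exp_add)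
    also have "\<dots> \<le> exp (- w e * p e) * (1 + p e * (w e + (w e)\<^sup>2))"
      using exp_le_quadratic[OF w(1)[OF e']] p[OF e'] by (intro mult_left_mono add_left_mono) auto
    also have "\<dots> \<le> exp (- w e * p e) * exp (p e * (w e + (w e)\<^sup>2))"
      by (intro mult_left_mono exp_ge_add_one_self) auto
    also have "\<dots> = exp (p e * (w e)\<^sup>2)" by (simp add: algebra_simps flip: exp_add)
    finally show "coins_exp E p (\<lambda>y. exp (w e * (of_bool (y e) - p e)))
      \<le> exp (p e * (w e)\<^sup>2)" .
  qed
  also have "\<dots> = exp (\<Sum>e\<in>F. p e * (w e)\<^sup>2)" using F by (simp add: exp_sum)
  finally show ?thesis .
qed

lemma tail_linear:
  assumes E: "finite E" and p: "\<And>e. e \<in> E \<Longrightarrow> 0 \<le> p e \<and> p e \<le> 1"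
    and w: "\<And>e. e \<in> F \<Longrightarrow> \<theta> * \<bar>w e\<bar> \<le> 1" "F \<subseteq> E" and \<theta>: "0 \<le> \<theta>"
    and V: "(\<Sum>e\<in>F. p e * (w e)\<^sup>2) \<le> V"
  shows "measure_pmf.prob (coins E p) {y. t \<le> (\<Sum>e\<in>F. w e * (of_bool (y e) - p e))}
    \<le> exp (\<theta>\<^sup>2 * V - \<theta> * t)"
proof -
  define w' where "w' = (\<lambda>e. if e \<in> F then \<theta> * w e else 0)"
  have *: "(\<Sum>e\<in>F. w' e * (of_bool (y e) - p e)) = \<theta> * (\<Sum>e\<in>F. w e * (of_bool (y e) - p e))" for y
    unfolding sum_distrib_left by (intro sum.cong) (auto simp: w'_def)
  have "measure_pmf.prob (coins E p) {y. t \<le> (\<Sum>e\<in>F. w e * (of_bool (y e) - p e))}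
    \<le> measure_pmf.prob (coins E p) {y. \<theta> * t \<le> (\<Sum>e\<in>F. w' e * (of_bool (y e) - p e))}"
    unfolding * using \<theta> by (intro measure_pmf.finite_measure_mono) (auto intro: mult_left_mono)
  also have "\<dots> \<le> exp (- (\<theta> * t)) * coins_exp E p (\<lambda>y. exp (\<Sum>e\<in>F. w' e * (of_bool (y e) - p e)))"
    by (rule prob_markov_exp[OF E])
  also have "\<dots> \<le> exp (- (\<theta> * t)) * exp (\<Sum>e\<in>F. p e * (w' e)\<^sup>2)"
    using w \<theta> by (intro mult_left_mono mgf_linear[OF E p]) (auto simp: w'_def abs_mult)
  also have "(\<Sum>e\<in>F. p e * (w' e)\<^sup>2) = \<theta>\<^sup>2 * (\<Sum>e\<in>F. p e * (w e)\<^sup>2)"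
    unfolding sum_distrib_left by (intro sum.cong) (auto simp: w'_def power_mult_distrib)
  also have "exp (- (\<theta> * t)) * exp (\<theta>\<^sup>2 * (\<Sum>e\<in>F. p e * (w e)\<^sup>2)) \<le> exp (- (\<theta> * t)) * exp (\<theta>\<^sup>2 * V)"
    using V by (auto intro: mult_left_mono)
  also have "\<dots> = exp (\<theta>\<^sup>2 * V - \<theta> * t)" by (simp flip: exp_add)
  finally show ?thesis .
qed

lemma tail_linear_abs:
  assumes E: "finite E" and p: "\<And>e. e \<in> E \<Longrightarrow> 0 \<le> p e \<and> p e \<le> 1"
    and w: "\<And>e. e \<in> F \<Longrightarrow> \<theta> * \<bar>w e\<bar> \<le> 1" "F \<subseteq> E" and \<theta>: "0 \<le> \<theta>"
    and V: "(\<Sum>e\<in>F. p e * (w e)\<^sup>2) \<le> V"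
  shows "measure_pmf.prob (coins E p) {y. t \<le> \<bar>\<Sum>e\<in>F. w e * (of_bool (y e) - p e)\<bar>}
    \<le> 2 * exp (\<theta>\<^sup>2 * V - \<theta> * t)"
proof -
  have *: "{y. t \<le> \<bar>\<Sum>e\<in>F. w e * (of_bool (y e) - p e)\<bar>}
    = {y. t \<le> (\<Sum>e\<in>F. w e * (of_bool (y e) - p e))} \<union> {y. t \<le> (\<Sum>e\<in>F. (- w e) * (of_bool (y e) - p e))}"
    by (auto simp: sum_negf abs_if)
  have "measure_pmf.prob (coins E p) {y. t \<le> \<bar>\<Sum>e\<in>F. w e * (of_bool (y e) - p e)\<bar>}
    \<le> measure_pmf.prob (coins E p) {y. t \<le> (\<Sum>e\<in>F. w e * (of_bool (y e) - p e))}
    + measure_pmf.prob (coins E p) {y. t \<le> (\<Sum>e\<in>F. (- w e) * (of_bool (y e) - p e))}"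
    unfolding * by (intro measure_Un_le) auto
  also have "\<dots> \<le> exp (\<theta>\<^sup>2 * V - \<theta> * t) + exp (\<theta>\<^sup>2 * V - \<theta> * t)"
    using assms by (intro add_mono tail_linear) auto
  finally show ?thesis by simp
qed

lemma prob_pattern:
  assumes E: "finite E" and p: "\<And>e. e \<in> E \<Longrightarrow> 0 \<le> p e \<and> p e \<le> 1" and F: "F \<subseteq> E"
  shows "measure_pmf.prob (coins E p) {y. \<forall>e\<in>F. y e = s e} = (\<Prod>e\<in>F. if s e then p e else 1 - p e)"
proof -
  have F': "finite F" using E F finite_subset by auto
  have "measure_pmf.prob (coins E p) {y. \<forall>e\<in>F. y e = s e}
     = coins_exp E p (\<lambda>y. \<Prod>e\<in>F. of_bool (y e = s e))"
    unfolding prob_eq_expectation using F' by (intro arg_cong[where f="measure_pmf.expectation _"] ext) auto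
  also have "\<dots> = (\<Prod>e\<in>F. coins_exp E p (\<lambda>y. of_bool (y e = s e)))"
    using F by (intro coins_indep_prod[OF E F', where J="\<lambda>e. {e}"])
       (auto simp: depends_on_def disjoint_family_on_def)
  also have "\<dots> = (\<Prod>e\<in>F. if s e then p e else 1 - p e)"
  proof (intro prod.cong refl)
    fix e assume "e \<in> F"
    thus "coins_exp E p (\<lambda>y. of_bool (y e = s e)) = (if s e then p e else 1 - p e)"
      using expectation_component[OF E, of e p "\<lambda>b. of_bool (b = s e)"] p[of e] F by auto
  qed
  finally show ?thesis .
qed

lemma prob_all_true:
  assumes E: "finite E" and p: "\<And>e. e \<in> E \<Longrightarrow> 0 \<le> p e \<and> p e \<le> 1" and F: "F \<subseteq> E"
  shows "measure_pmf.prob (coins E p) {y. \<forall>e\<in>F. y e} = (\<Prod>e\<in>F. p e)"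
  using prob_pattern[OF E p F, where s = "\<lambda>_. True"] by simp

text \<open>Chernoff's lower tail for events that live on disjoint blocks of coins. The exponential
  Markov inequality is applied with parameter \<open>-1\<close>; since \<open>1 - 1/e \<ge> 3/5\<close>, the exponent
  left over is \<open>3/5 - 1/2 = 1/10\<close>.\<close>
lemma lower_tail_blocks:
  fixes Q :: "'u \<Rightarrow> ('e \<Rightarrow> bool) \<Rightarrow> bool" and q :: real
  assumes E: "finite E" and B: "finite B" and J: "\<And>u. u \<in> B \<Longrightarrow> J u \<subseteq> E"
    "\<And>u. u \<in> B \<Longrightarrow> depends_on (J u) (Q u)" "disjoint_family_on J B"
    and q: "\<And>u. u \<in> B \<Longrightarrow> q \<le> measure_pmf.prob (coins E p) {y. Q u y}"
  shows "measure_pmf.prob (coins E p) {y. real (card {u\<in>B. Q u y}) \<le> card B * q / 2}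
    \<le> exp (- (card B * q) / 10)"
proof -
  define N where "N = card B * q"
  have c: "exp (-1::real) \<le> 2/5"
    using exp_lower_Taylor_quadratic[of 1] by (simp add: exp_minus field_simps)
  have "measure_pmf.prob (coins E p) {y. real (card {u\<in>B. Q u y}) \<le> card B * q / 2}
     = measure_pmf.prob (coins E p) {y. - N / 2 \<le> - real (card {u\<in>B. Q u y})}"
    by (simp add: N_def)
  also have "\<dots> \<le> exp (- (- N / 2)) * coins_exp E p (\<lambda>y. exp (- real (card {u\<in>B. Q u y})))"
    by (rule prob_markov_exp[OF E])
  also have "coins_exp E p (\<lambda>y. exp (- real (card {u\<in>B. Q u y})))
     = coins_exp E p (\<lambda>y. \<Prod>u\<in>B. exp (- of_bool (Q u y)))"
  proof (intro arg_cong[where f="measure_pmf.expectation _"] ext)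
    fix y
    have "- real (card {u\<in>B. Q u y}) = (\<Sum>u\<in>B. - of_bool (Q u y))"
      using B by (simp add: Int_def sum_negf)
    thus "exp (- real (card {u\<in>B. Q u y})) = (\<Prod>u\<in>B. exp (- of_bool (Q u y)))"
      using B by (simp only: exp_sum)
  qed
  also have "\<dots> = (\<Prod>u\<in>B. coins_exp E p (\<lambda>y. exp (- of_bool (Q u y))))"
  proof (intro coins_indep_prod[OF E B, where J=J] J)
    fix u assume u: "u \<in> B"
    show "depends_on (J u) (\<lambda>y. exp (- of_bool (Q u y)) :: real)"
    proof (rule depends_onI)
      fix y y' :: "'e \<Rightarrow> bool" assume "\<And>e. e \<in> J u \<Longrightarrow> y e = y' e"
      hence "Q u y = Q u y'" using J(2)[OF u] unfolding depends_on_def by blast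
      thus "exp (- of_bool (Q u y)) = (exp (- of_bool (Q u y')) :: real)" by simp
    qed
  qed
  also have "\<dots> \<le> (\<Prod>u\<in>B. exp (- (3/5) * q))"
  proof (intro prod_mono conjI)
    fix u assume u: "u \<in> B"
    show "0 \<le> coins_exp E p (\<lambda>y. exp (- of_bool (Q u y)) :: real)" by simp
    have "coins_exp E p (\<lambda>y. exp (- of_bool (Q u y)) :: real)
      \<le> coins_exp E p (\<lambda>y. 1 - (3/5) * of_bool (Q u y))"
      using c by (intro expectation_mono_coins[OF E]) auto
    also have "\<dots> = 1 - (3/5) * measure_pmf.prob (coins E p) {y. Q u y}"
      using E by (simp add: prob_eq_expectation)
    also have "\<dots> \<le> 1 - (3/5) * q" using q[OF u] by simp
    also have "\<dots> \<le> exp (- (3/5) * q)" using exp_ge_add_one_self[of "- (3/5) * q"] by simp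
    finally show "coins_exp E p (\<lambda>y. exp (- of_bool (Q u y)) :: real) \<le> exp (- (3/5) * q)" .
  qed
  also have "(\<Prod>u\<in>B. exp (- (3/5) * q)) = exp (- (3/5) * N)"
    unfolding prod_constant exp_of_nat_mult[symmetric] N_def by (simp add: algebra_simps)
  finally have "measure_pmf.prob (coins E p) {y. real (card {u\<in>B. Q u y}) \<le> card B * q / 2}
    \<le> exp (- (- N / 2)) * exp (- (3/5) * N)" by simp
  also have "\<dots> = exp (- N / 10)" unfolding exp_add[symmetric] by (rule arg_cong[where f=exp]) linarith
  finally show ?thesis unfolding N_def .
qed

section \<open>Degrees in induced subgraphs\<close>

lemma finite_all_edges [simp]: "finite V \<Longrightarrow> finite (all_edges V)"
  unfolding all_edges_def by (rule finite_subset[of _ "Pow V"]) auto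

lemma all_edges_iff: "{u, v} \<in> all_edges V \<longleftrightarrow> u \<in> V \<and> v \<in> V \<and> u \<noteq> v"
  by (auto simp: all_edges_def card_insert_if)

lemma induced_all_edges: "S \<subseteq> V \<Longrightarrow> induced_edges (all_edges V) S = all_edges S"
  by (auto simp: induced_edges_def all_edges_def)

lemma degree_induced:
  assumes "E \<subseteq> all_edges V" "v \<in> S"
  shows "degree (induced_edges E S) v = card {u\<in>S. {u, v} \<in> E}"
proof -
  have "bij_betw (\<lambda>u. {u, v}) {u\<in>S. {u, v} \<in> E} {e \<in> induced_edges E S. v \<in> e}"
  proof (rule bij_betw_imageI)
    show "inj_on (\<lambda>u. {u, v}) {u\<in>S. {u, v} \<in> E}" unfolding inj_on_def doubleton_eq_iff by blast
    show "(\<lambda>u. {u, v}) ` {u\<in>S. {u, v} \<in> E} = {e \<in> induced_edges E S. v \<in> e}"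
    proof (intro equalityI subsetI)
      fix e assume e: "e \<in> {e \<in> induced_edges E S. v \<in> e}"
      hence eE: "e \<in> E" "e \<subseteq> S" "v \<in> e" by (auto simp: induced_edges_def)
      hence "card e = 2" using assms(1) unfolding all_edges_def by blast
      then obtain a b where ab: "e = {a, b}" unfolding card_2_iff by blast
      have "\<exists>u. e = {u, v}"
      proof (cases "v = a")
        case True
        hence "e = {b, v}" using ab by auto
        thus ?thesis by blast
      next
        case False
        hence "v = b" using ab eE by simp
        thus ?thesis using ab by blast
      qed
      then obtain u where "e = {u, v}" by blast
      thus "e \<in> (\<lambda>u. {u, v}) ` {u\<in>S. {u, v} \<in> E}" using eE by blast
    next
      fix e assume "e \<in> (\<lambda>u. {u, v}) ` {u\<in>S. {u, v} \<in> E}"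
      then obtain u where "e = {u, v}" "u \<in> S" "{u, v} \<in> E" by blast
      thus "e \<in> {e \<in> induced_edges E S. v \<in> e}"
        using assms(2) unfolding induced_edges_def by blast
    qed
  qed
  from bij_betw_same_card[OF this] show ?thesis unfolding degree_def by simp
qed

lemma degree_all_edges: "finite S \<Longrightarrow> v \<in> S \<Longrightarrow> degree (all_edges S) v = card S - 1"
proof -
  assume "finite S" "v \<in> S"
  moreover have "induced_edges (all_edges S) S = all_edges S" by (simp add: induced_all_edges)
  moreover have "{u\<in>S. {u, v} \<in> all_edges S} = S - {v}" if "v \<in> S" using that by (auto simp: all_edges_iff)
  ultimately show ?thesis using degree_induced[of "all_edges S" S v S] by simp
qed

lemma distinct_degrees_set:
  assumes "finite V"
  shows "finite {k. \<exists>S. S \<subseteq> V \<and> card (degree (induced_edges E S) ` S) = k}"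
    and "{k. \<exists>S. S \<subseteq> V \<and> card (degree (induced_edges E S) ` S) = k} \<noteq> {}"
proof -
  have "{k. \<exists>S. S \<subseteq> V \<and> card (degree (induced_edges E S) ` S) = k}
      = (\<lambda>S. card (degree (induced_edges E S) ` S)) ` Pow V" by auto
  thus "finite {k. \<exists>S. S \<subseteq> V \<and> card (degree (induced_edges E S) ` S) = k}" using assms by simp
qed auto

lemma distinct_degrees_ge:
  assumes "finite V" "S \<subseteq> V"
  shows "card (degree (induced_edges E S) ` S) \<le> distinct_degrees V E"
  unfolding distinct_degrees_def using distinct_degrees_set[OF assms(1), of E] assms
  by (intro Max_ge) auto

lemma distinct_degrees_attained:
  assumes "finite V"
  obtains S where "S \<subseteq> V" "card (degree (induced_edges E S) ` S) = distinct_degrees V E"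
  using Max_in[OF distinct_degrees_set[OF assms, of E]] that unfolding distinct_degrees_def by blast

lemma distinct_degrees_pos:
  assumes "finite V" "v \<in> V"
  shows "1 \<le> distinct_degrees V E"
  using distinct_degrees_ge[of V "{v}" E] assms by simp

lemma degree_le_max_degree: "finite V \<Longrightarrow> v \<in> V \<Longrightarrow> degree E v \<le> max_degree V E"
  unfolding max_degree_def by (intro Max_ge) auto

lemma max_degree_less:
  assumes "finite V" "V \<noteq> {}" "\<And>v. v \<in> V \<Longrightarrow> degree E v < d"
  shows "max_degree V E < d"
  unfolding max_degree_def using assms by (subst Max_less_iff) auto

lemma distinct_degrees_le_max_degree:
  assumes "finite V" "finite E"
  shows "distinct_degrees V E \<le> Suc (max_degree V E)"
proof -
  obtain S where S: "S \<subseteq> V" "card (degree (induced_edges E S) ` S) = distinct_degrees V E"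
    using distinct_degrees_attained[OF assms(1)] .
  have "degree (induced_edges E S) v \<le> max_degree V E" if "v \<in> S" for v
  proof -
    have "degree (induced_edges E S) v \<le> degree E v"
      unfolding degree_def using assms(2) by (intro card_mono) (auto simp: induced_edges_def)
    thus ?thesis using degree_le_max_degree[OF assms(1), of v E] that S by fastforce
  qed
  hence "card (degree (induced_edges E S) ` S) \<le> card {..max_degree V E}"
    by (intro card_mono) auto
  thus ?thesis using S by simp
qed

text \<open>Enumerate \<open>W\<close> by \<open>h\<close> and let \<open>v\<close> have \<open>d v\<close> neighbours inside \<open>W\<close>. Keeping
  \<open>card W + h v - d v\<close> of its private neighbours raises its degree to exactly
  \<open>card W + h v\<close> and changes no other degree in \<open>W\<close>. That number lies between \<open>0\<close> and
  \<open>2 * card W\<close>, which is where the factor \<open>2\<close> comes from.\<close>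
lemma distinct_degrees_private_neighbours:
  assumes V: "finite V" and E: "E \<subseteq> all_edges V" and W: "W \<subseteq> V"
    and priv: "\<And>v. v \<in> W \<Longrightarrow>
      2 * card W \<le> card {u\<in>V - W. {u, v} \<in> E \<and> (\<forall>w\<in>W - {v}. {u, w} \<notin> E)}"
  shows "card W \<le> distinct_degrees V E"
proof -
  define N where "N = (\<lambda>v. {u\<in>V - W. {u, v} \<in> E \<and> (\<forall>w\<in>W - {v}. {u, w} \<notin> E)})"
  define d where "d = (\<lambda>v. card {u\<in>W. {u, v} \<in> E})"
  have fW: "finite W" using V W finite_subset by auto
  then obtain h where h: "bij_betw h W {0..<card W}" using ex_bij_betw_finite_nat by blast
  have d: "d v \<le> card W" for v unfolding d_def by (rule card_mono[OF fW]) auto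
  have hless: "h v < card W" if "v \<in> W" for v using h that by (auto simp: bij_betw_def)
  have "\<exists>M. M \<subseteq> N v \<and> card M = card W + h v - d v" if "v \<in> W" for v
  proof -
    have "card W + h v - d v \<le> card (N v)" using priv[OF that] hless[OF that] unfolding N_def by linarith
    thus ?thesis by (meson obtain_subset_with_card_n)
  qed
  then obtain M where M: "\<And>v. v \<in> W \<Longrightarrow> M v \<subseteq> N v \<and> card (M v) = card W + h v - d v" by metis
  define S where "S = W \<union> (\<Union>v\<in>W. M v)"
  have SV: "S \<subseteq> V" using W M unfolding S_def N_def by blast
  have deg: "degree (induced_edges E S) v = card W + h v" if v: "v \<in> W" for v
  proof -
    have "M v \<subseteq> N v" using M v by auto
    hence fM: "finite (M v)" using V unfolding N_def by (auto elim!: finite_subset)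
    have "M w \<subseteq> N w" if "w \<in> W" for w using M that by auto
    hence "{u\<in>S. {u, v} \<in> E} = {u\<in>W. {u, v} \<in> E} \<union> M v"
      using v unfolding S_def N_def by blast
    moreover have "{u\<in>W. {u, v} \<in> E} \<inter> M v = {}" using M v unfolding N_def by blast
    ultimately have "card {u\<in>S. {u, v} \<in> E} = d v + card (M v)"
      using fM fW by (simp add: d_def card_Un_disjoint)
    also have "\<dots> = card W + h v" using M[OF v] d[of v] by simp
    finally show ?thesis using degree_induced[OF E, of v S] v by (simp add: S_def)
  qed
  have "inj_on (degree (induced_edges E S)) W"
    using h deg by (auto simp: inj_on_def bij_betw_def)
  hence "card W = card (degree (induced_edges E S) ` W)" by (simp add: card_image)
  also have "\<dots> \<le> card (degree (induced_edges E S) ` S)"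
    using V SV by (intro card_mono finite_imageI) (auto simp: S_def intro: finite_subset)
  also have "\<dots> \<le> distinct_degrees V E" by (rule distinct_degrees_ge[OF V SV])
  finally show ?thesis .
qed

lemma sorted_list_gap:
  fixes X :: "nat set"
  assumes "finite X" "i + j < card X"
  shows "sorted_list_of_set X ! i + j \<le> sorted_list_of_set X ! (i + j)"
  using assms(2)
proof (induction j)
  case (Suc j)
  have "sorted_list_of_set X ! (i + j) < sorted_list_of_set X ! (i + Suc j)"
    using Suc.prems strict_sorted_list_of_set[of X] by (auto simp: sorted_wrt_iff_nth_less assms(1))
  thus ?case using Suc by simp
qed simp

text \<open>In the sorted list of values, position \<open>i + 3m\<close> exceeds position \<open>i\<close> by at least \<open>3m\<close>. So
  matching the \<open>m\<close> lowest values with the \<open>m\<close> highest ones gains at least \<open>3m\<^sup>2\<close> altogether.\<close>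
lemma top_bottom_gap:
  fixes f :: "'a \<Rightarrow> nat"
  assumes "finite S" "4 * m \<le> card (f ` S)"
  obtains U D where "U \<subseteq> S" "D \<subseteq> S" "card U = m" "card D = m"
    "(\<Sum>v\<in>D. f v) + 2 * m\<^sup>2 \<le> (\<Sum>v\<in>U. f v)"
proof -
  define X where "X = f ` S"
  define x where "x = (\<lambda>i. sorted_list_of_set X ! i)"
  have fX: "finite X" using assms by (simp add: X_def)
  have x_in: "x i \<in> X" if "i < 4 * m" for i
    unfolding x_def using that assms fX
    by (metis X_def less_le_trans nth_mem set_sorted_list_of_set length_sorted_list_of_set)
  have x_inj: "x i = x j \<longleftrightarrow> i = j" if "i < 4 * m" "j < 4 * m" for i j
    unfolding x_def using that assms fX
    by (metis X_def distinct_sorted_list_of_set less_le_trans nth_eq_iff_index_eq length_sorted_list_of_set)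
  have x_gap: "x i + 3 * m \<le> x (i + 3 * m)" if "i < m" for i
    unfolding x_def using that assms fX by (intro sorted_list_gap) (auto simp: X_def)
  define g where "g = (\<lambda>i. inv_into S f (x i))"
  have fg: "f (g i) = x i" "g i \<in> S" if "i < 4 * m" for i
    using x_in[OF that] unfolding g_def X_def by (auto intro: f_inv_into_f inv_into_into)
  have inj: "inj_on g {..<4 * m}"
    by (rule inj_onI) (metis fg(1) x_inj lessThan_iff)
  have inj1: "inj_on g {..<m}" by (rule inj_on_subset[OF inj]) auto
  have inj2: "inj_on (\<lambda>i. g (i + 3 * m)) {..<m}"
    by (rule inj_onI) (use inj_onD[OF inj] in fastforce)
  show ?thesis
  proof (rule that[of "(\<lambda>i. g (i + 3 * m)) ` {..<m}" "g ` {..<m}"])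
    have "(\<Sum>i<m. x i) + 2 * m\<^sup>2 \<le> (\<Sum>i<m. x i + 3 * m)"
      by (simp add: sum.distrib power2_eq_square)
    also have "\<dots> \<le> (\<Sum>i<m. x (i + 3 * m))" by (intro sum_mono x_gap) simp
    finally show "(\<Sum>v\<in>g ` {..<m}. f v) + 2 * m\<^sup>2 \<le> (\<Sum>v\<in>(\<lambda>i. g (i + 3 * m)) ` {..<m}. f v)"
      using inj1 inj2 fg by (simp add: sum.reindex)
  qed (use inj1 inj2 fg in \<open>auto simp: card_image\<close>)
qed

text \<open>Double counting, with an arbitrary weight \<open>z\<close> on the edges: \<open>z\<close> will be the edge indicator,
  its mean, or \<open>1\<close>.\<close>
lemma sum_degree_weights:
  fixes z :: "'a set \<Rightarrow> real"
  assumes "finite S" "U \<subseteq> S"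
  shows "(\<Sum>v\<in>U. \<Sum>e\<in>{e\<in>all_edges S. v \<in> e}. z e) = (\<Sum>e\<in>all_edges S. real (card (e \<inter> U)) * z e)"
proof -
  have fU: "finite U" using assms finite_subset by auto
  have "(\<Sum>v\<in>U. \<Sum>e\<in>{e\<in>all_edges S. v \<in> e}. z e) = (\<Sum>v\<in>U. \<Sum>e\<in>all_edges S. of_bool (v \<in> e) * z e)"
  proof (rule sum.cong[OF refl])
    fix v
    have "finite (all_edges S)" using assms by simp
    thus "(\<Sum>e\<in>{e\<in>all_edges S. v \<in> e}. z e) = (\<Sum>e\<in>all_edges S. of_bool (v \<in> e) * z e)"
      by (simp only: sum.inter_filter) (intro sum.cong, auto)
  qed
  also have "\<dots> = (\<Sum>e\<in>all_edges S. (\<Sum>v\<in>U. of_bool (v \<in> e)) * z e)"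
    by (subst sum.swap) (simp add: sum_distrib_right)
  also have "\<dots> = (\<Sum>e\<in>all_edges S. real (card (e \<inter> U)) * z e)"
    using fU by (simp add: Int_commute)
  finally show ?thesis .
qed

section \<open>The random graph as a family of coins\<close>

definition graph :: "nat \<Rightarrow> (nat set \<Rightarrow> bool) \<Rightarrow> nat set set" where
  "graph n y = {e\<in>all_edges {..<n}. y e}"

lemma graph_subset: "graph n y \<subseteq> all_edges {..<n}"
  by (auto simp: graph_def)

lemma finite_graph [simp]: "finite (graph n y)"
  by (rule finite_subset[OF graph_subset]) simp

lemma graph_iff: "{u, v} \<in> graph n y \<longleftrightarrow> u < n \<and> v < n \<and> u \<noteq> v \<and> y {u, v}"
  by (auto simp: graph_def all_edges_iff)

abbreviation edge_coins :: "nat \<Rightarrow> real \<Rightarrow> (nat set \<Rightarrow> bool) pmf" where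
  "edge_coins n p \<equiv> coins (all_edges {..<n}) (\<lambda>_. p)"

abbreviation graph_prob :: "nat \<Rightarrow> real \<Rightarrow> (nat set \<Rightarrow> bool) set \<Rightarrow> real" where
  "graph_prob n p \<equiv> measure_pmf.prob (edge_coins n p)"

abbreviation graph_degrees :: "nat \<Rightarrow> (nat set \<Rightarrow> bool) \<Rightarrow> nat" where
  "graph_degrees n y \<equiv> distinct_degrees {..<n} (graph n y)"

lemma prob_gnp:
  "measure_pmf.prob (gnp n p) {E. Q E} = graph_prob n p {y. Q (graph n y)}"
  by (simp add: gnp_def coins_def graph_def)

section \<open>Upper bound: few degrees when the edge probability is large\<close>

lemma degree_induced_graph:
  assumes "S \<subseteq> {..<n}"
  shows "real (degree (induced_edges (graph n y) S) v) = (\<Sum>e\<in>{e\<in>all_edges S. v \<in> e}. of_bool (y e))"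
proof -
  have fS: "finite S" using assms finite_subset by blast
  have "{e \<in> induced_edges (graph n y) S. v \<in> e} = {e\<in>all_edges S. v \<in> e} \<inter> {e. y e}"
    using assms unfolding induced_edges_def graph_def all_edges_def by blast
  thus ?thesis using fS by (simp add: degree_def)
qed

text \<open>The centring by \<open>p\<close> is free: \<open>U\<close> and \<open>D\<close> have equally many vertices, each of which lies in
  \<open>card S - 1\<close> pairs, so the weights sum to \<open>0\<close>.\<close>
lemma many_degrees_witness:
  assumes "4 * m \<le> graph_degrees n y"
  obtains S U D where "S \<subseteq> {..<n}" "U \<subseteq> S" "D \<subseteq> S" "card U = m" "card D = m"
    "real (2 * m\<^sup>2) \<le> (\<Sum>e\<in>all_edges S. (real (card (e \<inter> U)) - real (card (e \<inter> D))) * (of_bool (y e) - p))"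
proof -
  let ?E = "graph n y"
  obtain S where S: "S \<subseteq> {..<n}" "card (degree (induced_edges ?E S) ` S) = distinct_degrees {..<n} ?E"
    by (rule distinct_degrees_attained[of "{..<n}" ?E]) auto
  let ?f = "degree (induced_edges ?E S)"
  have fS: "finite S" using S finite_subset by blast
  obtain U D where UD: "U \<subseteq> S" "D \<subseteq> S" "card U = m" "card D = m"
    "(\<Sum>v\<in>D. ?f v) + 2 * m\<^sup>2 \<le> (\<Sum>v\<in>U. ?f v)"
    using top_bottom_gap[OF fS, of m ?f] assms S by auto
  have sum_y: "(\<Sum>v\<in>W. real (?f v)) = (\<Sum>e\<in>all_edges S. real (card (e \<inter> W)) * of_bool (y e))" if "W \<subseteq> S" for W
    using sum_degree_weights[OF fS that, of "\<lambda>e. of_bool (y e)"]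
    by (simp add: degree_induced_graph[OF S(1)])
  have sum_p: "(\<Sum>e\<in>all_edges S. real (card (e \<inter> W)) * p) = m * (card S - 1) * p"
    if "W \<subseteq> S" "card W = m" for W
  proof -
    have "(\<Sum>e\<in>all_edges S. real (card (e \<inter> W)) * p) = (\<Sum>v\<in>W. \<Sum>e\<in>{e\<in>all_edges S. v \<in> e}. p)"
      using sum_degree_weights[OF fS that(1), of "\<lambda>_. p"] by simp
    also have "\<dots> = (\<Sum>v\<in>W. (card S - 1) * p)"
      using degree_all_edges[OF fS] that by (intro sum.cong) (auto simp: degree_def)
    finally show ?thesis using that by simp
  qed
  have "real (2 * m\<^sup>2) \<le> (\<Sum>v\<in>U. real (?f v)) - (\<Sum>v\<in>D. real (?f v))"
  proof -
    have "real ((\<Sum>v\<in>D. ?f v) + 2 * m\<^sup>2) \<le> real (\<Sum>v\<in>U. ?f v)" using UD(5) by (rule of_nat_mono)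
    thus ?thesis by simp
  qed
  also have "\<dots> = (\<Sum>e\<in>all_edges S. real (card (e \<inter> U)) * (of_bool (y e) - p))
      - (\<Sum>e\<in>all_edges S. real (card (e \<inter> D)) * (of_bool (y e) - p))"
    using sum_p[OF UD(1,3)] sum_p[OF UD(2,4)] sum_y[OF UD(1)] sum_y[OF UD(2)]
    by (simp add: right_diff_distrib sum_subtractf)
  also have "\<dots> = (\<Sum>e\<in>all_edges S. (real (card (e \<inter> U)) - real (card (e \<inter> D))) * (of_bool (y e) - p))"
    by (simp add: left_diff_distrib sum_subtractf)
  finally show ?thesis using that S(1) UD by blast
qed

lemma weight_square_sum:
  assumes "S \<subseteq> {..<n}" "U \<subseteq> S" "D \<subseteq> S" "card U = m" "card D = m"
  shows "(\<Sum>e\<in>all_edges S. (real (card (e \<inter> U)) - real (card (e \<inter> D)))\<^sup>2) \<le> 4 * real m * real n"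
    and "e \<in> all_edges S \<Longrightarrow> \<bar>real (card (e \<inter> U)) - real (card (e \<inter> D))\<bar> \<le> 2"
proof -
  have fS: "finite S" using assms finite_subset by blast
  have le2: "card (e \<inter> W) \<le> 2" if "e \<in> all_edges S" for e W
  proof -
    have "card e = 2" using that by (simp add: all_edges_def)
    moreover from this have "finite e" by (intro card_ge_0_finite) simp
    ultimately show ?thesis using card_mono[of e "e \<inter> W"] by simp
  qed
  show abs: "\<bar>real (card (e \<inter> U)) - real (card (e \<inter> D))\<bar> \<le> 2" if "e \<in> all_edges S" for e
    using le2[OF that, of U] le2[OF that, of D] by linarith
  have sq: "(real (card (e \<inter> U)) - real (card (e \<inter> D)))\<^sup>2 \<le> 2 * (real (card (e \<inter> U)) + real (card (e \<inter> D)))"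
    if "e \<in> all_edges S" for e
  proof -
    let ?x = "real (card (e \<inter> U)) - real (card (e \<inter> D))"
    have "?x\<^sup>2 = \<bar>?x\<bar> * \<bar>?x\<bar>" by (simp add: power2_eq_square flip: abs_mult)
    also have "\<dots> \<le> 2 * \<bar>?x\<bar>" by (intro mult_right_mono abs[OF that]) auto
    also have "\<dots> \<le> 2 * (real (card (e \<inter> U)) + real (card (e \<inter> D)))"
      using abs_triangle_ineq4[of "real (card (e \<inter> U))" "real (card (e \<inter> D))"] by simp
    finally show ?thesis .
  qed
  have cnt: "(\<Sum>e\<in>all_edges S. real (card (e \<inter> W))) \<le> real m * real n"
    if "W \<subseteq> S" "card W = m" for W
  proof -
    have "(\<Sum>e\<in>all_edges S. real (card (e \<inter> W))) = (\<Sum>v\<in>W. \<Sum>e\<in>{e\<in>all_edges S. v \<in> e}. 1)"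
      using sum_degree_weights[OF fS that(1), of "\<lambda>_. 1"] by simp
    also have "\<dots> \<le> (\<Sum>v\<in>W. real n)"
    proof (intro sum_mono)
      fix v assume "v \<in> W"
      hence "(\<Sum>e\<in>{e\<in>all_edges S. v \<in> e}. 1) = real (card S - 1)"
        using degree_all_edges[OF fS, of v] that by (auto simp: degree_def)
      also have "\<dots> \<le> real n" using card_mono[OF _ assms(1)] by simp
      finally show "(\<Sum>e\<in>{e\<in>all_edges S. v \<in> e}. 1) \<le> real n" .
    qed
    finally show ?thesis using that by simp
  qed
  have "(\<Sum>e\<in>all_edges S. (real (card (e \<inter> U)) - real (card (e \<inter> D)))\<^sup>2)
     \<le> (\<Sum>e\<in>all_edges S. 2 * (real (card (e \<inter> U)) + real (card (e \<inter> D))))"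
    by (intro sum_mono sq)
  also have "\<dots> = 2 * ((\<Sum>e\<in>all_edges S. real (card (e \<inter> U))) + (\<Sum>e\<in>all_edges S. real (card (e \<inter> D))))"
    by (simp add: sum_distrib_left sum.distrib)
  also have "\<dots> \<le> 2 * (real m * real n + real m * real n)"
    by (intro mult_left_mono add_mono cnt assms) auto
  finally show "(\<Sum>e\<in>all_edges S. (real (card (e \<inter> U)) - real (card (e \<inter> D)))\<^sup>2) \<le> 4 * real m * real n"
    by simp
qed

text \<open>Union bound over the triples \<open>(S, U, D)\<close> of \<open>many_degrees_witness\<close>. With \<open>r = m / \<kappa>\<close>
  the exponent is \<open>n (r - r\<^sup>2)\<close>, at most \<open>-6n\<close> for \<open>r \<ge> 3\<close>, against a factor
  \<open>8\<^sup>n \<le> exp (3n)\<close>. The condition \<open>n \<le> \<kappa>\<^sup>2\<close>, which says that \<open>p\<close> is at least \<open>n\<^bsup>-1/2\<^esup>\<close>,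
  keeps the parameter of the exponential moment below \<open>1/2\<close>.\<close>
lemma prob_many_degrees:
  fixes \<kappa> :: real
  assumes n: "0 < n" and p: "0 \<le> p" "p \<le> 1" and \<kappa>: "0 < \<kappa>" "\<kappa> ^ 3 = p * real n ^ 2" "real n \<le> \<kappa>\<^sup>2"
    and m: "3 * \<kappa> \<le> real m"
  shows "graph_prob n p {y. 4 * m \<le> graph_degrees n y} \<le> exp (- 3 * real n)"
proof -
  define X where "X = (\<lambda>(S, U, D) (y :: nat set \<Rightarrow> bool).
    (\<Sum>e\<in>all_edges S. (real (card (e \<inter> U)) - real (card (e \<inter> D))) * (of_bool (y e) - p)))"
  define I where "I = {(S, U, D). S \<subseteq> {..<n} \<and> U \<subseteq> S \<and> D \<subseteq> S \<and> card U = m \<and> card D = m}"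
  have I_sub: "I \<subseteq> Pow {..<n} \<times> Pow {..<n} \<times> Pow {..<n}" unfolding I_def by blast
  have fI: "finite I" by (rule finite_subset[OF I_sub]) auto
  have "card I \<le> card (Pow {..<n} \<times> Pow {..<n} \<times> Pow {..<n})" by (rule card_mono[OF _ I_sub]) auto
  also have "\<dots> = 2 ^ n * (2 ^ n * 2 ^ n)" by (simp add: card_cartesian_product card_Pow)
  also have "\<dots> = (2 * (2 * 2)) ^ n" by (simp only: power_mult_distrib)
  also have "\<dots> = 8 ^ n" by simp
  finally have cardI: "card I \<le> 8 ^ n" .
  \<comment> \<open>A parameter for which the linear term \<open>2 m\<^sup>2 \<theta>\<close> dominates the variance term \<open>4 p m n \<theta>\<^sup>2\<close>.\<close>
  define \<theta> where "\<theta> = real n / (2 * \<kappa>\<^sup>2)"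
  have \<theta>: "0 \<le> \<theta>" "\<theta> \<le> 1 / 2" using \<kappa> unfolding \<theta>_def by (auto simp: field_simps)
  have expo: "\<theta>\<^sup>2 * (p * (4 * real m * real n)) - \<theta> * real (2 * m\<^sup>2) \<le> - 6 * real n"
  proof -
    define r where "r = real m / \<kappa>"
    have r: "3 \<le> r" using m \<kappa> by (simp add: r_def field_simps)
    have mr: "real m = r * \<kappa>" using \<kappa> by (simp add: r_def)
    have pn: "p = \<kappa> ^ 3 / real n ^ 2" using \<kappa> n by simp
    have "\<theta>\<^sup>2 * (p * (4 * real m * real n)) - \<theta> * real (2 * m\<^sup>2) = real n * (r - r * r)"
      using \<kappa>(1) n unfolding \<theta>_def of_nat_mult of_nat_power mr pn
      by (simp add: field_simps power2_eq_square power3_eq_cube)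
    also have "\<dots> \<le> real n * (-6)"
    proof (intro mult_left_mono)
      have "(r - 3) * (r + 2) \<ge> 0" using r by simp
      thus "r - r * r \<le> - 6" by (simp add: algebra_simps)
    qed simp
    finally show ?thesis by simp
  qed
  have "graph_prob n p {y. 4 * m \<le> graph_degrees n y}
     \<le> graph_prob n p {y. \<exists>i\<in>I. real (2 * m\<^sup>2) \<le> X i y}"
  proof (intro measure_pmf.finite_measure_mono subsetI CollectI)
    fix y assume "y \<in> {y. 4 * m \<le> graph_degrees n y}"
    hence "4 * m \<le> graph_degrees n y" by simp
    then obtain S U D where "S \<subseteq> {..<n}" "U \<subseteq> S" "D \<subseteq> S" "card U = m" "card D = m"
      and *: "real (2 * m\<^sup>2) \<le> (\<Sum>e\<in>all_edges S. (real (card (e \<inter> U)) - real (card (e \<inter> D))) * (of_bool (y e) - p))"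
      by (rule many_degrees_witness[of m n y p])
    hence "(S, U, D) \<in> I" unfolding I_def by blast
    moreover have "real (2 * m\<^sup>2) \<le> X (S, U, D) y" using * unfolding X_def by simp
    ultimately show "\<exists>i\<in>I. real (2 * m\<^sup>2) \<le> X i y" by blast
  qed simp
  also have "\<dots> \<le> real (card I) * exp (- 6 * real n)"
  proof (rule prob_union_bound_card[OF fI])
    fix i assume i: "i \<in> I"
    obtain S U D where i_eq: "i = (S, U, D)" by (cases i)
    have SUD: "S \<subseteq> {..<n}" "U \<subseteq> S" "D \<subseteq> S" "card U = m" "card D = m" using i unfolding I_def i_eq by auto
    have "graph_prob n p {y. real (2 * m\<^sup>2) \<le> X i y}
       \<le> exp (\<theta>\<^sup>2 * (p * (4 * real m * real n)) - \<theta> * real (2 * m\<^sup>2))"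
      unfolding X_def i_eq prod.case
    proof (rule tail_linear)
      show "all_edges S \<subseteq> all_edges {..<n}" using SUD by (auto simp: all_edges_def)
      show "(\<Sum>e\<in>all_edges S. p * (real (card (e \<inter> U)) - real (card (e \<inter> D)))\<^sup>2) \<le> p * (4 * real m * real n)"
        unfolding sum_distrib_left[symmetric] using p weight_square_sum(1)[OF SUD] by (intro mult_left_mono)
      fix e assume "e \<in> all_edges S"
      from weight_square_sum(2)[OF SUD this] \<theta>
      have "\<theta> * \<bar>real (card (e \<inter> U)) - real (card (e \<inter> D))\<bar> \<le> 1/2 * 2" by (intro mult_mono) auto
      thus "\<theta> * \<bar>real (card (e \<inter> U)) - real (card (e \<inter> D))\<bar> \<le> 1" by simp
    qed (use p \<theta> in auto)
    also have "\<dots> \<le> exp (- 6 * real n)" using expo by simp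
    finally show "graph_prob n p {y. real (2 * m\<^sup>2) \<le> X i y} \<le> exp (- 6 * real n)" .
  qed
  also have "\<dots> \<le> exp (3 * real n) * exp (- 6 * real n)"
  proof (intro mult_right_mono)
    have "real (card I) \<le> 8 ^ n" using cardI by (metis of_nat_le_iff of_nat_numeral of_nat_power)
    also have "\<dots> \<le> exp 3 ^ n"
    proof (intro power_mono)
      show "(8::real) \<le> exp 3" using two_power_le_exp[of 3] by simp
    qed simp
    also have "exp 3 ^ n = exp (3 * real n)" using exp_of_nat_mult[of n "3::real"] by (simp only: mult.commute)
    finally show "real (card I) \<le> exp (3 * real n)" .
  qed simp
  also have "\<dots> = exp (- 3 * real n)" unfolding exp_add[symmetric] by simp
  finally show ?thesis .
qed

section \<open>Lower bound through private neighbours: expected degree at least logarithmic\<close>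

lemma degree_graph:
  "degree (graph n y) v = card {e\<in>{e\<in>all_edges {..<n}. v \<in> e}. y e}"
  unfolding degree_def graph_def by (rule arg_cong[where f=card]) blast

lemma card_star_le:
  "card {e\<in>all_edges {..<n}. v \<in> e} \<le> n"
proof (cases "v < n")
  case True
  hence "card {e\<in>all_edges {..<n}. v \<in> e} = n - 1"
    using degree_all_edges[of "{..<n}" v] by (simp add: degree_def)
  thus ?thesis by simp
next
  case False
  hence "{e\<in>all_edges {..<n}. v \<in> e} = {}" by (auto simp: all_edges_def)
  thus ?thesis by (simp only: card.empty)
qed

lemma prob_degree_large:
  fixes p t :: real
  assumes "0 \<le> p" "p \<le> 1"
  shows "graph_prob n p {y. t \<le> real (degree (graph n y) v)} \<le> exp (2 * (real n * p) - t)"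
proof -
  let ?St = "{e\<in>all_edges {..<n}. v \<in> e}"
  have deg: "real (degree (graph n y) v) = (\<Sum>e\<in>?St. of_bool (y e))" for y
    unfolding degree_graph by (simp add: Int_def)
  have V: "(\<Sum>e\<in>?St. p * 1\<^sup>2) \<le> real n * p"
    using card_star_le[of n v] assms by (simp add: mult_right_mono)
  have "graph_prob n p {y. t \<le> real (degree (graph n y) v)}
     \<le> graph_prob n p {y. t - real n * p \<le> (\<Sum>e\<in>?St. 1 * (of_bool (y e) - p))}"
    using V by (intro measure_pmf.finite_measure_mono) (auto simp: deg sum_subtractf)
  also have "\<dots> \<le> exp (1\<^sup>2 * (real n * p) - 1 * (t - real n * p))"
    using V assms by (intro tail_linear) auto
  also have "\<dots> = exp (2 * (real n * p) - t)" by (rule arg_cong[where f=exp]) simp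
  finally show ?thesis .
qed

lemma prob_max_degree_large:
  fixes p t :: real
  assumes "0 \<le> p" "p \<le> 1" "0 < n"
  shows "graph_prob n p {y. t \<le> real (max_degree {..<n} (graph n y))}
    \<le> real n * exp (2 * (real n * p) - t)"
proof -
  have "graph_prob n p {y. t \<le> real (max_degree {..<n} (graph n y))}
     \<le> graph_prob n p {y. \<exists>v\<in>{..<n}. t \<le> real (degree (graph n y) v)}"
  proof (intro measure_pmf.finite_measure_mono subsetI CollectI)
    fix y assume "y \<in> {y. t \<le> real (max_degree {..<n} (graph n y))}"
    moreover have "max_degree {..<n} (graph n y) \<in> degree (graph n y) ` {..<n}"
      unfolding max_degree_def using assms(3) by (intro Max_in) auto
    ultimately show "\<exists>v\<in>{..<n}. t \<le> real (degree (graph n y) v)" by auto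
  qed simp
  also have "\<dots> \<le> real (card {..<n}) * exp (2 * (real n * p) - t)"
    by (intro prob_union_bound_card prob_degree_large assms) auto
  finally show ?thesis by simp
qed

lemma disjoint_stars:
  assumes "B \<inter> W = {}"
  shows "disjoint_family_on (\<lambda>u. (\<lambda>w. {u, w}) ` W) B"
  unfolding disjoint_family_on_def
proof (intro ballI impI equals0I)
  fix u u' e assume *: "u \<in> B" "u' \<in> B" "u \<noteq> u'" "e \<in> (\<lambda>w. {u, w}) ` W \<inter> (\<lambda>w. {u', w}) ` W"
  then obtain w w' where "w \<in> W" "w' \<in> W" "{u, w} = {u', w'}" by blast
  thus False using * assms by (auto simp: doubleton_eq_iff)
qed

lemma stars_subset:
  assumes "B \<inter> W = {}" "B \<subseteq> {..<n}" "W \<subseteq> {..<n}" "u \<in> B"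
  shows "(\<lambda>w. {u, w}) ` W \<subseteq> all_edges {..<n}"
proof
  fix e assume "e \<in> (\<lambda>w. {u, w}) ` W"
  then obtain w where w: "w \<in> W" "e = {u, w}" by blast
  moreover have "u \<noteq> w" using w assms by blast
  ultimately show "e \<in> all_edges {..<n}" using assms by (auto simp: all_edges_iff)
qed

text \<open>The edges between \<open>u\<close> and \<open>W\<close> form disjoint blocks for different \<open>u \<in> B\<close>, and \<open>u\<close> is a
  private neighbour of \<open>v\<close> with probability \<open>p (1 - p)\<^bsup>card W - 1\<^esup>\<close>. Used with \<open>W\<close> a
  large set for the private neighbours, and with \<open>W\<close> a pair \<open>{v, w}\<close> to count the neighbours
  of \<open>v\<close> that are not neighbours of \<open>w\<close>.\<close>
lemma prob_private_few:
  fixes p :: real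
  assumes p: "0 \<le> p" "p \<le> 1" and BW: "B \<inter> W = {}" "B \<subseteq> {..<n}" "W \<subseteq> {..<n}" "v \<in> W"
  shows "graph_prob n p
      {y. real (card {u\<in>B. y {u, v} \<and> (\<forall>w\<in>W - {v}. \<not> y {u, w})}) \<le> card B * (p * (1 - p) ^ (card W - 1)) / 2}
    \<le> exp (- (card B * (p * (1 - p) ^ (card W - 1))) / 10)"
proof (rule lower_tail_blocks[where J = "\<lambda>u. (\<lambda>w. {u, w}) ` W"])
  have fW: "finite W" using BW finite_subset by blast
  show "finite B" using BW finite_subset by blast
  show "disjoint_family_on (\<lambda>u. (\<lambda>w. {u, w}) ` W) B" by (rule disjoint_stars[OF BW(1)])
  fix u assume u: "u \<in> B"
  show sub: "(\<lambda>w. {u, w}) ` W \<subseteq> all_edges {..<n}" by (rule stars_subset[OF BW(1-3) u])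
  show "depends_on ((\<lambda>w. {u, w}) ` W) (\<lambda>y. y {u, v} \<and> (\<forall>w\<in>W - {v}. \<not> y {u, w}))"
    using BW(4) by (intro depends_onI) auto
  have same: "{u, w} = {u, w'} \<longleftrightarrow> w = w'" for w w' by (auto simp: doubleton_eq_iff)
  hence inj: "inj_on (\<lambda>w. {u, w}) W" unfolding inj_on_def by blast
  have "y {u, v} \<and> (\<forall>w\<in>W - {v}. \<not> y {u, w}) \<longleftrightarrow> (\<forall>w\<in>W. y {u, w} = (w = v))" for y :: "nat set \<Rightarrow> bool"
    using BW(4) by blast
  hence eq: "{y :: nat set \<Rightarrow> bool. y {u, v} \<and> (\<forall>w\<in>W - {v}. \<not> y {u, w})}
      = {y. \<forall>e\<in>(\<lambda>w. {u, w}) ` W. y e = (e = {u, v})}"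
    by (simp add: same)
  have "graph_prob n p {y. y {u, v} \<and> (\<forall>w\<in>W - {v}. \<not> y {u, w})}
     = (\<Prod>e\<in>(\<lambda>w. {u, w}) ` W. if e = {u, v} then p else 1 - p)"
    unfolding eq by (rule prob_pattern) (use p sub in auto)
  also have "\<dots> = (\<Prod>w\<in>W. if w = v then p else 1 - p)"
    by (simp add: prod.reindex[OF inj] same)
  also have "\<dots> = p * (\<Prod>w\<in>W - {v}. if w = v then p else 1 - p)"
    using fW BW(4) by (subst prod.remove[of _ v]) auto
  also have "(\<Prod>w\<in>W - {v}. if w = v then p else 1 - p) = (\<Prod>w\<in>W - {v}. 1 - p)"
    by (intro prod.cong) auto
  also have "\<dots> = (1 - p) ^ (card W - 1)" using BW(4) fW by simp
  finally show "p * (1 - p) ^ (card W - 1)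
     \<le> graph_prob n p {y. y {u, v} \<and> (\<forall>w\<in>W - {v}. \<not> y {u, w})}" by simp
qed simp

text \<open>For \<open>k \<le> np/16\<close> the assumption \<open>n p\<^sup>2 \<le> 1\<close> gives \<open>p k \<le> 1/16\<close>, so that a neighbour
  of one of the \<open>k\<close> vertices is private with probability at least \<open>15/16\<close>. Hence about \<open>np\<close>
  private neighbours are expected, well above the \<open>2k\<close> needed.\<close>
lemma prob_few_degrees_dense:
  fixes p :: real
  assumes n: "2 \<le> n" and p: "0 \<le> p" "p \<le> 1" "real n * p\<^sup>2 \<le> 1"
  shows "graph_prob n p {y. graph_degrees n y < nat \<lfloor>real n * p / 16\<rfloor>}
    \<le> real n * p * exp (- (real n * p) / 40)"
proof -
  define k where "k = nat \<lfloor>real n * p / 16\<rfloor>"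
  define W where "W = {..<k}"
  define B where "B = {k..<n}"
  have kle: "real k \<le> real n * p / 16" using p unfolding k_def by (intro of_nat_floor) simp
  have "real k \<le> real n / 16" using kle p mult_left_le[of p "real n"] by linarith
  hence kn: "k < n" and cB: "real (card B) \<ge> 15/16 * real n" using n by (auto simp: B_def)
  define q where "q = p * (1 - p) ^ (card W - 1)"
  have q: "15/16 * p \<le> q"
  proof -
    have "real (card W - 1) * p \<le> real k * p" using p by (intro mult_right_mono) (auto simp: W_def)
    also have "\<dots> \<le> (real n * p / 16) * p" by (intro mult_right_mono kle p)
    also have "\<dots> \<le> 1/16" using p(3) by (simp add: power2_eq_square mult_ac)
    finally have "15/16 \<le> 1 + real (card W - 1) * (- p)" by simp
    also have "\<dots> \<le> (1 + (- p)) ^ (card W - 1)" by (rule Bernoulli_inequality) (use p in simp)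
    finally have "p * (15/16) \<le> p * (1 - p) ^ (card W - 1)" using p by (intro mult_left_mono) auto
    thus ?thesis by (simp add: q_def mult.commute)
  qed
  have Bq: "225/256 * (real n * p) \<le> card B * q"
    using mult_mono[OF cB q] p by simp
  have "graph_prob n p {y. graph_degrees n y < k}
    \<le> graph_prob n p {y. \<exists>v\<in>W. real (card {u\<in>B. y {u, v} \<and> (\<forall>w\<in>W - {v}. \<not> y {u, w})}) \<le> card B * q / 2}"
  proof (intro measure_pmf.finite_measure_mono subsetI CollectI)
    fix y assume "y \<in> {y. graph_degrees n y < k}"
    hence less: "graph_degrees n y < card W" by (simp add: W_def)
    show "\<exists>v\<in>W. real (card {u\<in>B. y {u, v} \<and> (\<forall>w\<in>W - {v}. \<not> y {u, w})}) \<le> card B * q / 2"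
    proof (rule ccontr)
      assume contra: "\<not> ?thesis"
      have "card W \<le> graph_degrees n y"
      proof (rule distinct_degrees_private_neighbours)
        show "finite {..<n}" "graph n y \<subseteq> all_edges {..<n}" by (auto simp: graph_subset)
        show "W \<subseteq> {..<n}" using kn by (auto simp: W_def)
        fix v assume v: "v \<in> W"
        have "real (2 * card W) \<le> card B * q / 2" using kle Bq by (simp add: W_def)
        also have "\<dots> < real (card {u\<in>B. y {u, v} \<and> (\<forall>w\<in>W - {v}. \<not> y {u, w})})"
          using contra v by (auto simp: not_le)
        also have "{u\<in>B. y {u, v} \<and> (\<forall>w\<in>W - {v}. \<not> y {u, w})}
           = {u\<in>{..<n} - W. {u, v} \<in> graph n y \<and> (\<forall>w\<in>W - {v}. {u, w} \<notin> graph n y)}"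
          using v kn by (auto simp: graph_iff B_def W_def)
        finally show "2 * card W \<le> card {u\<in>{..<n} - W. {u, v} \<in> graph n y \<and> (\<forall>w\<in>W - {v}. {u, w} \<notin> graph n y)}"
          by linarith
      qed
      thus False using less by simp
    qed
  qed simp
  also have "\<dots> \<le> real (card W) * exp (- (card B * q) / 10)"
  proof (rule prob_union_bound_card)
    show "finite W" by (simp add: W_def)
    fix v assume "v \<in> W"
    moreover have "B \<inter> W = {}" "B \<subseteq> {..<n}" "W \<subseteq> {..<n}" using kn by (auto simp: B_def W_def)
    ultimately show "graph_prob n p
        {y. real (card {u\<in>B. y {u, v} \<and> (\<forall>w\<in>W - {v}. \<not> y {u, w})}) \<le> card B * q / 2}
      \<le> exp (- (card B * q) / 10)"
      unfolding q_def using p by (intro prob_private_few)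
  qed
  also have "\<dots> \<le> (real n * p) * exp (- (real n * p) / 40)"
  proof (intro mult_mono)
    have "0 \<le> real n * p" using p by simp
    thus "real (card W) \<le> real n * p" using kle unfolding W_def card_lessThan by linarith
    show "exp (- (card B * q) / 10) \<le> exp (- (real n * p) / 40)" 
      unfolding exp_le_cancel_iff using Bq \<open>0 \<le> real n * p\<close> by linarith
  qed (use p in auto)
  finally show ?thesis by (simp add: k_def)
qed

section \<open>Lower bound through private neighbours: expected degree below logarithmic\<close>

lemma power_self_le_exp_fact: "real D ^ D \<le> exp (real D) * fact D"
proof -
  have "(\<Sum>k\<in>{D}. real D ^ k /\<^sub>R fact k) \<le> (\<Sum>k. real D ^ k /\<^sub>R fact k)"
    by (intro sum_le_suminf summable_exp_generic) auto
  hence "real D ^ D / fact D \<le> exp (real D)" by (simp add: exp_def field_simps)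
  thus ?thesis by (simp add: field_simps)
qed

lemma prob_at_least_le:
  fixes p :: real
  assumes E: "finite E" "F \<subseteq> E" and p: "0 \<le> p" "p \<le> 1"
  shows "measure_pmf.prob (coins E (\<lambda>_. p)) {y. d \<le> card {e\<in>F. y e}} \<le> real (card F choose d) * p ^ d"
proof -
  have fF: "finite F" using E finite_subset by blast
  have "measure_pmf.prob (coins E (\<lambda>_. p)) {y. d \<le> card {e\<in>F. y e}}
     \<le> measure_pmf.prob (coins E (\<lambda>_. p)) {y. \<exists>T\<in>{T. T \<subseteq> F \<and> card T = d}. \<forall>e\<in>T. y e}"
  proof (intro measure_pmf.finite_measure_mono subsetI CollectI)
    fix y assume "y \<in> {y. d \<le> card {e\<in>F. y e}}"
    hence "d \<le> card {e\<in>F. y e}" by simp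
    then obtain T where "T \<subseteq> {e\<in>F. y e}" "card T = d" by (meson obtain_subset_with_card_n)
    thus "\<exists>T\<in>{T. T \<subseteq> F \<and> card T = d}. \<forall>e\<in>T. y e" by blast
  qed simp
  also have "\<dots> \<le> real (card {T. T \<subseteq> F \<and> card T = d}) * p ^ d"
  proof (rule prob_union_bound_card)
    show "finite {T. T \<subseteq> F \<and> card T = d}" using fF by simp
    fix T assume T: "T \<in> {T. T \<subseteq> F \<and> card T = d}"
    have "measure_pmf.prob (coins E (\<lambda>_. p)) {y. \<forall>e\<in>T. y e} = (\<Prod>e\<in>T. p)"
      by (rule prob_all_true) (use T E p in auto)
    thus "measure_pmf.prob (coins E (\<lambda>_. p)) {y. \<forall>e\<in>T. y e} \<le> p ^ d" using T by simp
  qed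
  finally show ?thesis using fF by (simp add: n_subsets)
qed

lemma prob_at_least_ge:
  fixes p :: real
  assumes E: "finite E" "F \<subseteq> E" and p: "0 \<le> p" "p \<le> 1"
  shows "real (card F choose d) * (p ^ d * (1 - p) ^ (card F - d))
    \<le> measure_pmf.prob (coins E (\<lambda>_. p)) {y. d \<le> card {e\<in>F. y e}}"
proof -
  have fF: "finite F" using E finite_subset by blast
  let ?I = "{T. T \<subseteq> F \<and> card T = d}"
  let ?A = "\<lambda>T. {y :: 'a \<Rightarrow> bool. \<forall>e\<in>F. y e = (e \<in> T)}"
  have fI: "finite ?I" using fF by simp
  have "measure_pmf.prob (coins E (\<lambda>_. p)) (?A T) = p ^ d * (1 - p) ^ (card F - d)" if T: "T \<in> ?I" for T
  proof -
    have fT: "finite T" using T fF finite_subset by blast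
    have "measure_pmf.prob (coins E (\<lambda>_. p)) (?A T) = (\<Prod>e\<in>F. if e \<in> T then p else 1 - p)"
      by (rule prob_pattern) (use E p in auto)
    also have "\<dots> = (\<Prod>e\<in>T. if e \<in> T then p else 1 - p) * (\<Prod>e\<in>F - T. if e \<in> T then p else 1 - p)"
      using fF T by (subst prod.subset_diff[of T F]) auto
    also have "\<dots> = (\<Prod>e\<in>T. p) * (\<Prod>e\<in>F - T. 1 - p)" by (intro arg_cong2[where f=times] prod.cong) auto
    also have "\<dots> = p ^ d * (1 - p) ^ (card F - d)" using T fT by (simp add: card_Diff_subset)
    finally show ?thesis .
  qed
  hence "(\<Sum>T\<in>?I. measure_pmf.prob (coins E (\<lambda>_. p)) (?A T)) = real (card ?I) * (p ^ d * (1 - p) ^ (card F - d))"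
    by simp
  moreover have "measure_pmf.prob (coins E (\<lambda>_. p)) (\<Union>T\<in>?I. ?A T) = (\<Sum>T\<in>?I. measure_pmf.prob (coins E (\<lambda>_. p)) (?A T))"
  proof (rule measure_pmf.finite_measure_finite_Union[OF fI])
    show "disjoint_family_on ?A ?I"
      unfolding disjoint_family_on_def
    proof (intro ballI impI equals0I)
      fix T T' y assume *: "T \<in> ?I" "T' \<in> ?I" "T \<noteq> T'" "y \<in> ?A T \<inter> ?A T'"
      hence "e \<in> T \<longleftrightarrow> e \<in> T'" if "e \<in> F" for e using that by blast
      hence "T = T'" using * by blast
      thus False using * by blast
    qed
  qed simp
  moreover have "measure_pmf.prob (coins E (\<lambda>_. p)) (\<Union>T\<in>?I. ?A T)
     \<le> measure_pmf.prob (coins E (\<lambda>_. p)) {y. d \<le> card {e\<in>F. y e}}"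
  proof (intro measure_pmf.finite_measure_mono subsetI CollectI)
    fix y assume "y \<in> (\<Union>T\<in>?I. ?A T)"
    then obtain T where T: "T \<subseteq> F" "card T = d" "\<forall>e\<in>F. y e = (e \<in> T)" by blast
    hence "{e\<in>F. y e} = T" by blast
    thus "d \<le> card {e\<in>F. y e}" using T by simp
  qed simp
  ultimately show ?thesis using fF by (simp add: n_subsets)
qed

lemma card_star_image:
  assumes "v \<notin> B"
  shows "card {u\<in>B. y {u, v}} = card {e\<in>(\<lambda>u. {u, v}) ` B. y e}"
proof -
  have inj: "inj_on (\<lambda>u. {u, v}) {u\<in>B. y {u, v}}"
    by (rule inj_onI) (auto simp: doubleton_eq_iff)
  have "{e\<in>(\<lambda>u. {u, v}) ` B. y e} = (\<lambda>u. {u, v}) ` {u\<in>B. y {u, v}}" by blast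
  thus ?thesis using card_image[OF inj] by simp
qed

text \<open>Three common neighbours of two vertices are six edges on five vertices.\<close>
lemma prob_large_codegree:
  fixes p :: real
  assumes p: "0 \<le> p" "p \<le> 1" and AB: "A \<subseteq> {..<n}" "B \<subseteq> {..<n}" "A \<inter> B = {}"
  shows "graph_prob n p
      {y. \<exists>v\<in>A. \<exists>w\<in>A. v \<noteq> w \<and> 3 \<le> card {u\<in>B. y {u, v} \<and> y {u, w}}} \<le> real n ^ 5 * p ^ 6"
proof -
  define I where "I = {(v, w). v \<in> A \<and> w \<in> A \<and> v \<noteq> w} \<times> {T. T \<subseteq> B \<and> card T = 3}"
  define F where "F = (\<lambda>((v, w), T). (\<lambda>u. {u, v}) ` T \<union> (\<lambda>u. {u, w}) ` (T :: nat set))"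
  have fA: "finite A" "finite B" using AB finite_subset by blast+
  have sub: "{(v, w). v \<in> A \<and> w \<in> A \<and> v \<noteq> w} \<subseteq> A \<times> A" by blast
  have fI: "finite I" unfolding I_def using fA finite_subset[OF sub] by simp
  have "card I \<le> n ^ 2 * n ^ 3"
  proof -
    have "card {(v, w). v \<in> A \<and> w \<in> A \<and> v \<noteq> w} \<le> card (A \<times> A)" using sub fA by (intro card_mono) auto
    also have "\<dots> \<le> n ^ 2" using card_mono[OF _ AB(1)] by (simp add: card_cartesian_product power2_eq_square mult_le_mono)
    finally have 1: "card {(v, w). v \<in> A \<and> w \<in> A \<and> v \<noteq> w} \<le> n ^ 2" .
    have "card {T. T \<subseteq> B \<and> card T = 3} = card B choose 3" using fA by (simp add: n_subsets)
    also have "\<dots> \<le> card B ^ 3" by (cases "3 \<le> card B") (auto intro: binomial_le_pow simp: not_le binomial_eq_0)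
    also have "\<dots> \<le> n ^ 3" using card_mono[OF _ AB(2)] by (intro power_mono) auto
    finally show ?thesis unfolding I_def card_cartesian_product using 1 by (intro mult_le_mono)
  qed
  hence "card I \<le> n ^ 5" by (simp flip: power_add)
  hence "real (card I) \<le> real (n ^ 5)" by (rule of_nat_mono)
  hence cI: "real (card I) \<le> real n ^ 5" by simp
  have "graph_prob n p
      {y. \<exists>v\<in>A. \<exists>w\<in>A. v \<noteq> w \<and> 3 \<le> card {u\<in>B. y {u, v} \<and> y {u, w}}}
    \<le> graph_prob n p {y. \<exists>i\<in>I. \<forall>e\<in>F i. y e}"
  proof (intro measure_pmf.finite_measure_mono subsetI CollectI)
    fix y assume "y \<in> {y. \<exists>v\<in>A. \<exists>w\<in>A. v \<noteq> w \<and> 3 \<le> card {u\<in>B. y {u, v} \<and> y {u, w}}}"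
    then obtain v w where vw: "v \<in> A" "w \<in> A" "v \<noteq> w" "3 \<le> card {u\<in>B. y {u, v} \<and> y {u, w}}" by blast
    then obtain T where T: "T \<subseteq> {u\<in>B. y {u, v} \<and> y {u, w}}" "card T = 3" by (meson obtain_subset_with_card_n)
    have "((v, w), T) \<in> I" using vw T unfolding I_def by blast
    moreover have "\<forall>e\<in>F ((v, w), T). y e" using T unfolding F_def by auto
    ultimately show "\<exists>i\<in>I. \<forall>e\<in>F i. y e" by blast
  qed simp
  also have "\<dots> \<le> real (card I) * p ^ 6"
  proof (rule prob_union_bound_card[OF fI])
    fix i assume "i \<in> I"
    then obtain v w T where i: "i = ((v, w), T)" and vw: "v \<in> A" "w \<in> A" "v \<noteq> w" and T: "T \<subseteq> B" "card T = 3"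
      unfolding I_def by blast
    have inj: "inj_on (\<lambda>u. {u, x}) T" for x by (rule inj_onI) (auto simp: doubleton_eq_iff)
    have nin: "v \<notin> T" "w \<notin> T" using vw T AB by blast+
    have fT: "finite T" using T card_ge_0_finite[of T] by simp
    have "(\<lambda>u. {u, v}) ` T \<inter> (\<lambda>u. {u, w}) ` T = {}"
    proof (rule equals0I)
      fix e assume "e \<in> (\<lambda>u. {u, v}) ` T \<inter> (\<lambda>u. {u, w}) ` T"
      then obtain u u' where "u \<in> T" "u' \<in> T" "{u, v} = {u', w}" by blast
      thus False using nin vw by (auto simp: doubleton_eq_iff)
    qed
    hence cF: "card (F i) = 6" unfolding F_def i using fT T inj by (simp add: card_Un_disjoint card_image)
    have Fsub: "F i \<subseteq> all_edges {..<n}"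
    proof
      fix e assume "e \<in> F i"
      then obtain u x where ux: "e = {u, x}" "u \<in> T" "x \<in> A" unfolding F_def i using vw by auto
      moreover have "u \<noteq> x" using ux T AB by blast
      ultimately show "e \<in> all_edges {..<n}" using T AB by (auto simp: all_edges_iff)
    qed
    have "graph_prob n p {y. \<forall>e\<in>F i. y e} = (\<Prod>e\<in>F i. p)"
      by (rule prob_all_true) (use p Fsub in auto)
    thus "graph_prob n p {y. \<forall>e\<in>F i. y e} \<le> p ^ 6" using cF by simp
  qed
  also have "\<dots> \<le> real n ^ 5 * p ^ 6" using cI p by (intro mult_right_mono) auto
  finally show ?thesis .
qed

text \<open>Of the \<open>6k\<close> neighbours of a vertex at most \<open>2k\<close> are shared with the other \<open>k - 1\<close>
  vertices, which leaves the \<open>2k\<close> private ones.\<close>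
lemma distinct_degrees_ge_many_high:
  assumes A: "A \<subseteq> {..<n}" "B \<subseteq> {..<n}" "A \<inter> B = {}"
    and high: "k \<le> card {v\<in>A. 6 * k \<le> card {u\<in>B. y {u, v}}}"
    and codeg: "\<And>v w. v \<in> A \<Longrightarrow> w \<in> A \<Longrightarrow> v \<noteq> w \<Longrightarrow> card {u\<in>B. y {u, v} \<and> y {u, w}} < 3"
  shows "k \<le> graph_degrees n y"
proof -
  obtain W where W: "W \<subseteq> {v\<in>A. 6 * k \<le> card {u\<in>B. y {u, v}}}" "card W = k" "finite W"
    by (rule obtain_subset_with_card_n[OF high])
  have fA: "finite A" "finite B" "finite W" using A W(3) finite_subset by blast+
  have "card W \<le> graph_degrees n y"
  proof (rule distinct_degrees_private_neighbours)
    show "finite {..<n}" "graph n y \<subseteq> all_edges {..<n}" by (auto simp: graph_subset)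
    show "W \<subseteq> {..<n}" using W A by blast
    fix v assume v: "v \<in> W"
    let ?P = "{u\<in>{..<n} - W. {u, v} \<in> graph n y \<and> (\<forall>w\<in>W - {v}. {u, w} \<notin> graph n y)}"
    let ?C = "\<Union>w\<in>W - {v}. {u\<in>B. y {u, v} \<and> y {u, w}}"
    have BW: "B \<inter> W = {}" using W A by blast
    have fin: "finite (?P \<union> ?C)" using fA by simp
    have "{u\<in>B. y {u, v}} \<subseteq> ?P \<union> ?C"
    proof
      fix u assume u: "u \<in> {u\<in>B. y {u, v}}"
      show "u \<in> ?P \<union> ?C"
      proof (cases "u \<in> ?C")
        case False
        hence "\<not> y {u, w}" if "w \<in> W - {v}" for w using u that by blast
        hence no: "\<forall>w\<in>W - {v}. {u, w} \<notin> graph n y" by (simp add: graph_iff)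
        have "u \<in> B" "v \<in> A" "y {u, v}" using u v W(1) by blast+
        hence "u \<in> {..<n}" "v \<in> {..<n}" "u \<noteq> v" "u \<notin> W" using A BW by blast+
        hence "u \<in> ?P" using no \<open>y {u, v}\<close> by (simp add: graph_iff)
        thus ?thesis by blast
      qed blast
    qed
    hence "card {u\<in>B. y {u, v}} \<le> card (?P \<union> ?C)" by (rule card_mono[OF fin])
    hence 1: "card {u\<in>B. y {u, v}} \<le> card ?P + card ?C" using card_Un_le le_trans by blast
    have "card ?C \<le> (\<Sum>w\<in>W - {v}. card {u\<in>B. y {u, v} \<and> y {u, w}})"
      by (rule card_UN_le) (use fA in simp)
    also have "\<dots> \<le> (\<Sum>w\<in>W - {v}. 2)"
    proof (rule sum_mono)
      fix w assume w: "w \<in> W - {v}"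
      have "card {u\<in>B. y {u, v} \<and> y {u, w}} < 3" by (rule codeg) (use v w W in auto)
      thus "card {u\<in>B. y {u, v} \<and> y {u, w}} \<le> 2" by simp
    qed
    also have "\<dots> \<le> 2 * card W" using card_Diff1_le[of W v] by simp
    finally have 2: "card ?C \<le> 2 * card W" .
    have "6 * k \<le> card {u\<in>B. y {u, v}}" using v W(1) by blast
    thus "2 * card W \<le> card ?P" using 1 2 W(2) by linarith
  qed
  thus ?thesis using W by simp
qed

text \<open>The last hypothesis says that \<open>\<beta> = e n p / D\<close> satisfies \<open>\<beta>\<^sup>D > n\<^sup>-\<^sup>2\<close>. As
  \<open>d \<le> D/10\<close>, on the one hand \<open>M p / d \<ge> 5 n p / D \<ge> \<beta>\<close>, and on the other \<open>\<beta>\<^sup>d\<close>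
  is at least \<open>n\<^bsup>-1/5\<^esup>\<close>. The factor for the absent edges is at least
  \<open>exp (-2 n p) \<ge> n\<^bsup>-1/5\<^esup>\<close> too.\<close>
lemma binomial_prob_lower:
  fixes p L :: real
  assumes n: "1 < n" and L: "L = ln (real n)" and p: "0 \<le> p" "p \<le> 1/2" "real n * p \<le> L / 10"
    and d: "1 \<le> d" "10 * d \<le> D" "d \<le> M" and M: "real n / 2 \<le> real M" "M \<le> n"
    and D: "real D ^ D < (exp 1 * (real n * p)) ^ D * real n ^ 2"
  shows "exp (- 2/5 * L) \<le> real (M choose d) * (p ^ d * (1 - p) ^ (M - d))"
proof -
  have D0: "0 < D" using d by simp
  have Lpos: "0 < L" using n by (simp add: L)
  define \<beta> where "\<beta> = exp 1 * (real n * p) / real D"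
  have D1: "1 < \<beta> ^ D * real n ^ 2"
    using D D0 unfolding \<beta>_def power_divide by (simp add: field_simps)
  have "p \<noteq> 0"
  proof
    assume "p = 0"
    hence "real D ^ D < 0" using D D0 by (simp add: zero_power)
    thus False by (simp add: not_less)
  qed
  hence \<beta>: "0 < \<beta>" using p n D0 by (simp add: \<beta>_def)
  have "0 < ln (\<beta> ^ D * real n ^ 2)" using D1 by simp
  also have "\<dots> = real D * ln \<beta> + 2 * L" using \<beta> n by (simp add: ln_mult ln_realpow L)
  finally have lnD: "- 2 * L < real D * ln \<beta>" by simp
  have lnd: "- L / 5 \<le> real d * ln \<beta>"
  proof (cases "0 \<le> ln \<beta>")
    case True
    hence "0 \<le> real d * ln \<beta>" by simp
    thus ?thesis using Lpos by linarith
  next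
    case False
    hence "real D * ln \<beta> \<le> real (10 * d) * ln \<beta>" using d by (intro mult_right_mono_neg of_nat_mono) auto
    thus ?thesis using lnD by simp
  qed
  have "exp (- L / 5) \<le> exp (real d * ln \<beta>)" using lnd by simp
  also have "\<dots> = \<beta> ^ d" using \<beta> by (simp add: exp_of_nat_mult)
  also have "\<dots> \<le> (real M * p / real d) ^ d"
  proof (rule power_mono)
    have "\<beta> \<le> 3 * (real n * p) / real D" unfolding \<beta>_def
      using exp_le p by (intro divide_right_mono mult_right_mono) auto
    also have "\<dots> \<le> 5 * (real n * p) / real D" using p by (intro divide_right_mono) auto
    also have "\<dots> \<le> 5 * (real n * p) / (10 * real d)"
      using d p by (intro divide_left_mono) auto
    also have "\<dots> = (real n / 2) * p / real d" by simp
    also have "\<dots> \<le> real M * p / real d" using M p by (intro divide_right_mono mult_right_mono) auto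
    finally show "\<beta> \<le> real M * p / real d" .
  qed (use \<beta> in simp)
  also have "\<dots> = (real M / real d) ^ d * p ^ d" by (simp add: power_mult_distrib power_divide)
  also have "\<dots> \<le> real (M choose d) * p ^ d"
    using binomial_ge_n_over_k_pow_k[OF d(3)] p by (intro mult_right_mono) auto
  finally have 1: "exp (- L / 5) \<le> real (M choose d) * p ^ d" .
  have "exp (- L / 5) \<le> exp (real (M - d) * (- 2 * p))"
  proof -
    have "real (M - d) * (2 * p) \<le> real n * (2 * p)" using M p by (intro mult_right_mono) auto
    thus ?thesis using p(3) by simp
  qed
  also have "\<dots> = exp (- 2 * p) ^ (M - d)" by (rule exp_of_nat_mult)
  also have "\<dots> \<le> (1 - p) ^ (M - d)"
  proof (rule power_mono)
    have "- 2 * p \<le> - p - 2 * p\<^sup>2" using p mult_right_mono[of p "1/2" p] by (simp add: power2_eq_square)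
    also have "\<dots> \<le> ln (1 - p)" by (rule ln_one_minus_pos_lower_bound) (use p in auto)
    finally have "exp (- 2 * p) \<le> exp (ln (1 - p))" by simp
    thus "exp (- 2 * p) \<le> 1 - p" using p by simp
  qed simp
  finally have 2: "exp (- L / 5) \<le> (1 - p) ^ (M - d)" .
  have "exp (- 2/5 * L) = exp (- L / 5) * exp (- L / 5)" unfolding exp_add[symmetric] by (rule arg_cong[where f=exp]) simp
  also have "\<dots> \<le> (real (M choose d) * p ^ d) * (1 - p) ^ (M - d)"
    using 1 2 p by (intro mult_mono) auto
  finally show ?thesis by (simp add: mult.assoc)
qed

text \<open>The expected number of \<open>D\<close>-sets of neighbours of one vertex is at most
  \<open>(np)\<^sup>D / D! \<le> (e n p / D)\<^sup>D\<close>.\<close>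
lemma prob_degree_threshold:
  fixes p :: real
  assumes n: "0 < n" and p: "0 \<le> p" "p \<le> 1"
    and D: "1 \<le> D" "(exp 1 * (real n * p)) ^ D * real n ^ 2 \<le> real D ^ D"
  shows "graph_prob n p {y. \<exists>v\<in>{..<n}. D \<le> degree (graph n y) v} \<le> 1 / real n"
proof -
  have "graph_prob n p {y. D \<le> degree (graph n y) v} \<le> 1 / real n ^ 2" for v
  proof -
    let ?F = "{e\<in>all_edges {..<n}. v \<in> e}"
    have "graph_prob n p {y. D \<le> degree (graph n y) v} \<le> real (card ?F choose D) * p ^ D"
      unfolding degree_graph by (rule prob_at_least_le) (use p in auto)
    also have "\<dots> \<le> (real n ^ D / fact D) * p ^ D"
    proof (intro mult_right_mono)
      have "(card ?F choose D) * fact D \<le> card ?F ^ D" by (rule binomial_fact_pow)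
      also have "\<dots> \<le> n ^ D" by (intro power_mono card_star_le) simp
      finally have "real ((card ?F choose D) * fact D) \<le> real (n ^ D)" by (rule of_nat_mono)
      thus "real (card ?F choose D) \<le> real n ^ D / fact D" by (simp add: field_simps)
    qed (use p in simp)
    also have "\<dots> = (real n * p) ^ D / fact D" by (simp add: power_mult_distrib)
    also have "\<dots> \<le> (real n * p) ^ D * exp (real D) / real D ^ D"
    proof -
      have "(real n * p) ^ D * real D ^ D \<le> (real n * p) ^ D * (exp (real D) * fact D)"
        using power_self_le_exp_fact p by (intro mult_left_mono) auto
      thus ?thesis using D(1) by (simp add: field_simps)
    qed
    also have "\<dots> = (exp 1 * (real n * p)) ^ D / real D ^ D"
      using exp_of_nat_mult[of D "1::real"] by (simp add: power_mult_distrib)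
    also have "\<dots> \<le> 1 / real n ^ 2" using D n by (simp add: field_simps)
    finally show ?thesis .
  qed
  hence "graph_prob n p {y. \<exists>v\<in>{..<n}. D \<le> degree (graph n y) v} \<le> real (card {..<n}) * (1 / real n ^ 2)"
    by (intro prob_union_bound_card) auto
  also have "\<dots> = 1 / real n" using n by (simp add: power2_eq_square)
  finally show ?thesis .
qed

text \<open>Comparing \<open>\<Delta>\<close> with the threshold \<open>D\<close> rather than with its distribution treats all \<open>p\<close> at
  once, including those for which \<open>\<Delta>\<close> is bounded or is not concentrated. Splitting the
  vertices into \<open>A\<close> and \<open>B\<close> makes the degrees from \<open>A\<close> into \<open>B\<close> independent.\<close>
lemma prob_few_degrees_sparse:
  fixes p L :: real
  assumes n: "1 < n" and L: "L = ln (real n)" and p: "0 \<le> p" "p \<le> 1/2" "real n * p \<le> L / 10"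
    and large: "2 * L + 1 \<le> real n / 2" "2 * L + 1 \<le> exp (3/5 * L) / 6"
  shows "graph_prob n p
      {y. \<not> max_degree {..<n} (graph n y) \<le> 120 * graph_degrees n y}
    \<le> 1 / real n + real n ^ 5 * p ^ 6 + exp (- exp (3/5 * L) / 30)"
proof -
  have Lpos: "0 < L" using n by (simp add: L)
  define T where "T = (\<lambda>d. 1 \<le> d \<and> (exp 1 * (real n * p)) ^ d * real n ^ 2 \<le> real d ^ d)"
  define D where "D = (LEAST d. T d)"
  \<comment> \<open>Some \<open>d = O(ln n)\<close> qualifies, because \<open>e\<^sup>2 n p \<le> d\<close> gives \<open>(e n p / d)\<^sup>d \<le> exp (- d) \<le> n\<^sup>-\<^sup>2\<close>.\<close>
  have T1: "T (nat \<lceil>2 * L\<rceil>)"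
  proof -
    define d where "d = nat \<lceil>2 * L\<rceil>"
    have "0 < \<lceil>2 * L\<rceil>" using Lpos by simp
    hence d: "2 * L \<le> real d" "1 \<le> d" unfolding d_def by linarith+
    have "exp 1 * (exp 1 * (real n * p)) \<le> 3 * (3 * (real n * p))"
      using exp_le p by (intro mult_mono) auto
    also have "\<dots> \<le> real d" using p d Lpos by linarith
    finally have "exp 1 * (real n * p) \<le> real d / exp 1" by (simp add: field_simps)
    hence "(exp 1 * (real n * p)) ^ d \<le> (real d / exp 1) ^ d" using p by (intro power_mono) auto
    also have "\<dots> = real d ^ d / exp (real d)" using exp_of_nat_mult[of d "1::real"] by (simp add: power_divide)
    finally have 1: "(exp 1 * (real n * p)) ^ d \<le> real d ^ d / exp (real d)" .
    have "real n ^ 2 = exp L ^ 2" using n by (simp add: L)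
    also have "\<dots> = exp (2 * L)" using exp_of_nat_mult[of 2 L] by simp
    also have "\<dots> \<le> exp (real d)" using d by simp
    finally have "(exp 1 * (real n * p)) ^ d * real n ^ 2 \<le> (real d ^ d / exp (real d)) * exp (real d)"
      using 1 p by (intro mult_mono) auto
    thus ?thesis using d by (simp add: T_def flip: d_def)
  qed
  have TD: "T D" unfolding D_def by (rule LeastI[of T, OF T1])
  have "D \<le> nat \<lceil>2 * L\<rceil>" unfolding D_def by (rule Least_le[of T, OF T1])
  hence Dle: "real D \<le> 2 * L + 1" using Lpos by linarith
  have below: "\<not> T d" if "d < D" for d using that not_less_Least unfolding D_def by blast
  define h where "h = n div 2"
  define A where "A = {..<h}"
  define B where "B = {h..<n}"
  have AB: "A \<subseteq> {..<n}" "B \<subseteq> {..<n}" "A \<inter> B = {}" by (auto simp: A_def B_def h_def)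
  have cB: "real n / 2 \<le> real (card B)" "card B \<le> n" by (auto simp: B_def h_def)
  have cA: "real n / 3 \<le> real (card A)" 
  proof -
    have "n \<le> 3 * (n div 2)" using n by presburger
    hence "real n \<le> real (3 * (n div 2))" by (rule of_nat_mono)
    thus ?thesis by (simp add: A_def h_def)
  qed
  \<comment> \<open>Degree \<open>6k\<close> is at most a tenth of \<open>D - 1\<close>; the case \<open>k = 0\<close> is the one of bounded \<open>\<Delta>\<close>.\<close>
  define k where "k = (D - 1) div 60"
  define q where "q = exp (- 2/5 * L)"
  define H where "H = (\<lambda>v (y :: nat set \<Rightarrow> bool). 6 * k \<le> card {u\<in>B. y {u, v}})"
  define Few where "Few = {y. 1 \<le> k \<and> real (card {v\<in>A. H v y}) \<le> card A * q / 2}"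
  define Cod where "Cod = {y :: nat set \<Rightarrow> bool. \<exists>v\<in>A. \<exists>w\<in>A. v \<noteq> w \<and> 3 \<le> card {u\<in>B. y {u, v} \<and> y {u, w}}}"
  define Big where "Big = {y. \<exists>v\<in>{..<n}. D \<le> degree (graph n y) v}"
  have nq: "real n * q = exp (3/5 * L)"
  proof -
    have "real n * q = exp L * q" using n by (simp add: L)
    also have "\<dots> = exp (3/5 * L)" unfolding q_def exp_add[symmetric] by (rule arg_cong[where f=exp]) simp
    finally show ?thesis .
  qed
  have Aq: "exp (3/5 * L) / 3 \<le> card A * q"
  proof -
    have "real n / 3 * q \<le> real (card A) * q" by (intro mult_right_mono cA) (simp add: q_def)
    thus ?thesis using nq by linarith
  qed
  have few: "graph_prob n p Few \<le> exp (- exp (3/5 * L) / 30)"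
  proof (cases "1 \<le> k")
    case k: True
    have D1: "1 \<le> D - 1" "10 * (6 * k) \<le> D - 1" using k by (auto simp: k_def)
    have "\<not> T (D - 1)" by (rule below) (use D1 in simp)
    hence bD: "real (D - 1) ^ (D - 1) < (exp 1 * (real n * p)) ^ (D - 1) * real n ^ 2"
      using D1(1) unfolding T_def not_le[symmetric] by blast
    have "real (6 * k) \<le> real D" using D1 by linarith
    also have "\<dots> \<le> real n / 2" using Dle large(1) by linarith
    finally have kB: "6 * k \<le> card B" using cB by linarith
    have "graph_prob n p {y. real (card {v\<in>A. H v y}) \<le> card A * q / 2}
       \<le> exp (- (card A * q) / 10)"
    proof (rule lower_tail_blocks[where J = "\<lambda>v. (\<lambda>u. {v, u}) ` B"])
      show "finite A" by (simp add: A_def)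
      show "disjoint_family_on (\<lambda>v. (\<lambda>u. {v, u}) ` B) A" by (rule disjoint_stars[OF AB(3)])
      fix v assume v: "v \<in> A"
      show sub: "(\<lambda>u. {v, u}) ` B \<subseteq> all_edges {..<n}" by (rule stars_subset[OF AB(3,1,2) v])
      show "depends_on ((\<lambda>u. {v, u}) ` B) (H v)"
      proof (rule depends_onI)
        fix y y' :: "nat set \<Rightarrow> bool" assume "\<And>e. e \<in> (\<lambda>u. {v, u}) ` B \<Longrightarrow> y e = y' e"
        hence "{u\<in>B. y {u, v}} = {u\<in>B. y' {u, v}}" by (auto simp: insert_commute)
        thus "H v y = H v y'" by (simp add: H_def)
      qed
      have vB: "v \<notin> B" using v AB by blast
      have comm: "(\<lambda>u. {v, u}) ` B = (\<lambda>u. {u, v}) ` B" by (simp add: insert_commute)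
      have inj: "inj_on (\<lambda>u. {u, v}) B" by (rule inj_onI) (auto simp: doubleton_eq_iff)
      have "q \<le> real (card B choose (6 * k)) * (p ^ (6 * k) * (1 - p) ^ (card B - 6 * k))"
        unfolding q_def by (rule binomial_prob_lower[OF n L p _ D1(2) kB cB bD]) (use k in simp)
      also have "card B = card ((\<lambda>u. {u, v}) ` B)" using inj by (simp add: card_image)
      also have "real (card ((\<lambda>u. {u, v}) ` B) choose (6 * k))
          * (p ^ (6 * k) * (1 - p) ^ (card ((\<lambda>u. {u, v}) ` B) - 6 * k))
        \<le> graph_prob n p {y. 6 * k \<le> card {e\<in>(\<lambda>u. {u, v}) ` B. y e}}"
        by (rule prob_at_least_ge) (use p sub comm in auto)
      also have "\<dots> = graph_prob n p {y. H v y}"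
        unfolding H_def card_star_image[OF vB] ..
      finally show "q \<le> graph_prob n p {y. H v y}" .
    qed simp
    also have "\<dots> \<le> exp (- exp (3/5 * L) / 30)" using Aq by simp
    finally show ?thesis using k by (simp add: Few_def)
  qed (simp add: Few_def)
  have cod: "graph_prob n p Cod \<le> real n ^ 5 * p ^ 6"
    unfolding Cod_def by (rule prob_large_codegree) (use p AB in auto)
  have big: "graph_prob n p Big \<le> 1 / real n"
    unfolding Big_def by (rule prob_degree_threshold) (use n p TD in \<open>auto simp: T_def\<close>)
  have good: "max_degree {..<n} (graph n y) \<le> 120 * graph_degrees n y"
    if y: "y \<notin> Big" "y \<notin> Cod" "y \<notin> Few" for y
  proof -
    have "max_degree {..<n} (graph n y) < D"
      by (rule max_degree_less) (use y(1) n in \<open>auto simp: Big_def not_le\<close>)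
    also have "D \<le> 60 * ((D - 1) div 60 + 1)" by presburger
    finally have md: "max_degree {..<n} (graph n y) < 60 * (k + 1)" unfolding k_def .
    have pos: "1 \<le> graph_degrees n y"
      by (rule distinct_degrees_pos[of _ 0]) (use n in auto)
    show ?thesis
    proof (cases "1 \<le> k")
      case True
      have "real k \<le> real D" unfolding k_def by simp
      also have "\<dots> \<le> card A * q / 2" using Dle large(2) Aq by linarith
      also have "\<dots> < real (card {v\<in>A. H v y})" using y(3) True by (simp add: Few_def)
      finally have "k \<le> card {v\<in>A. 6 * k \<le> card {u\<in>B. y {u, v}}}" unfolding H_def by linarith
      hence "k \<le> graph_degrees n y"
        by (rule distinct_degrees_ge_many_high[OF AB]) (use y(2) in \<open>auto simp: Cod_def not_le\<close>)
      moreover have "60 * (k + 1) \<le> 120 * k" using True by simp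
      ultimately show ?thesis using md by simp
    next
      case False
      thus ?thesis using md pos by simp
    qed
  qed
  have "graph_prob n p
      {y. \<not> max_degree {..<n} (graph n y) \<le> 120 * graph_degrees n y}
    \<le> graph_prob n p (Big \<union> Cod \<union> Few)"
    using good by (intro measure_pmf.finite_measure_mono) auto
  also have "\<dots> \<le> graph_prob n p (Big \<union> Cod) + graph_prob n p Few"
    by (rule measure_Un_le) auto
  also have "\<dots> \<le> graph_prob n p Big + graph_prob n p Cod
      + graph_prob n p Few"
    by (intro add_right_mono measure_Un_le) auto
  finally show ?thesis using few cod big by linarith
qed

section \<open>Rounding a random set without too many collisions\<close>

lemma central_binomial_upper: "real (2 * m + 1) * real (2 * m choose m) ^ 2 \<le> 16 ^ m"
proof (induction m)
  case (Suc m)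
  define c D where "c = (2 * m choose m)" and "D = (2 * Suc m choose Suc m)"
  have 1: "Suc m * (2 * m + 2 choose Suc m) = (2 * m + 2) * (2 * m + 1 choose m)"
    using Suc_times_binomial_eq[of "2 * m + 1" m] by (simp add: mult.commute)
  have 2: "Suc m * (2 * m + 1 choose m) = (2 * m + 1) * (2 * m choose m)"
    using binomial_absorb_comp[of "2 * m + 1" m] by simp
  have "2 * Suc m = 2 * m + 2" by simp
  hence "Suc m * D = 2 * (Suc m * (2 * m + 1 choose m))" using 1 unfolding D_def by simp
  hence "Suc m * D = 2 * ((2 * m + 1) * c)" using 2 unfolding c_def by simp
  hence "real (Suc m * D) = real (2 * ((2 * m + 1) * c))" by (rule arg_cong)
  hence rec: "(real m + 1) * real D = 2 * ((2 * real m + 1) * real c)" by (simp add: algebra_simps)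
  have step: "(2 * a + 3) * d\<^sup>2 \<le> 16 * X"
    if "(a + 1) * d = 2 * ((2 * a + 1) * c)" "(2 * a + 1) * c\<^sup>2 \<le> X" "0 \<le> a" for a c d X :: real
  proof -
    have "(a + 1)\<^sup>2 * ((2 * a + 3) * d\<^sup>2) = (2 * a + 3) * ((a + 1) * d)\<^sup>2"
      by (simp add: power_mult_distrib)
    also have "\<dots> = 4 * (((2 * a + 1) * (2 * a + 3)) * ((2 * a + 1) * c\<^sup>2))"
      unfolding that(1) by (simp add: power2_eq_square)
    also have "\<dots> \<le> 4 * ((4 * (a + 1)\<^sup>2) * X)"
    proof -
      have h: "(2 * a + 1) * (2 * a + 3) \<le> 4 * (a + 1)\<^sup>2" by (simp add: power2_eq_square algebra_simps)
      have "((2 * a + 1) * (2 * a + 3)) * ((2 * a + 1) * c\<^sup>2) \<le> (4 * (a + 1)\<^sup>2) * X"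
        by (rule mult_mono[OF h that(2)]) (use that(3) in auto)
      thus ?thesis by (rule mult_left_mono) simp
    qed
    also have "\<dots> = (a + 1)\<^sup>2 * (16 * X)" by simp
    finally show ?thesis using that(3) by (subst (asm) mult_le_cancel_left_pos) auto
  qed
  have "(2 * real m + 1) * (real c)\<^sup>2 \<le> 16 ^ m" using Suc.IH unfolding c_def by (simp add: add.commute)
  from step[OF rec this] have "(2 * real m + 3) * (real D)\<^sup>2 \<le> 16 ^ Suc m" by simp
  moreover have "real (2 * Suc m + 1) = 2 * real m + 3" by simp
  ultimately show ?case unfolding D_def by (simp only:)
qed simp

lemma binomial_upper:
  assumes "0 < n"
  shows "real (n choose c) \<le> 2 ^ n / sqrt (real n)"
proof -
  have even: "real (2 * m choose c) \<le> 2 ^ (2 * m) / sqrt (real (2 * m + 1))" for m c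
  proof -
    have "real (2 * m choose c) \<le> real (2 * m choose m)" using binomial_maximum'[of m c] by simp
    also have "\<dots> \<le> 2 ^ (2 * m) / sqrt (real (2 * m + 1))"
    proof -
      have "sqrt (real (2 * m + 1) * real (2 * m choose m) ^ 2) \<le> sqrt (16 ^ m)"
        using central_binomial_upper by (rule real_sqrt_le_mono)
      moreover have "(16::real) ^ m = (2 ^ (2 * m)) ^ 2"
      proof -
        have "(16::real) ^ m = (4 * 4) ^ m" by simp
        also have "\<dots> = 4 ^ m * 4 ^ m" by (rule power_mult_distrib)
        also have "(4::real) ^ m = 2 ^ (2 * m)" by (simp add: power_mult)
        finally show ?thesis by (simp only: power2_eq_square)
      qed
      ultimately have "sqrt (real (2 * m + 1)) * real (2 * m choose m) \<le> 2 ^ (2 * m)"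
        by (simp add: real_sqrt_mult)
      thus ?thesis by (simp add: field_simps)
    qed
    finally show ?thesis .
  qed
  show ?thesis
  proof (cases "even n")
    case True
    then obtain m where m: "n = 2 * m" by blast
    have "2 ^ (2 * m) / sqrt (real (2 * m + 1)) \<le> 2 ^ n / sqrt (real n)"
      using assms m by (intro frac_le) auto
    thus ?thesis using even[of m c] m by simp
  next
    case False
    then obtain m where m: "n = 2 * m + 1" by (rule oddE)
    have "real (n choose c) \<le> 2 * (2 ^ (2 * m) / sqrt (real n))"
    proof (cases c)
      case 0
      have "1 \<le> 2 ^ (2 * m) / sqrt (real n)" using even[of m 0] m by simp
      thus ?thesis using 0 by simp
    next
      case (Suc c')
      have "real (n choose c) = real (2 * m choose c') + real (2 * m choose Suc c')" using m Suc by simp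
      thus ?thesis using even[of m c'] even[of m "Suc c'"] m by simp
    qed
    thus ?thesis using m by simp
  qed
qed

text \<open>Anticoncentration of the symmetric binomial distribution: its largest point mass.\<close>
lemma fair_coins_point_prob:
  assumes "finite F" "F \<noteq> {}" "\<And>u. u \<in> F \<Longrightarrow> \<pi> u = 1 / 2"
  shows "measure_pmf.prob (coins F \<pi>) {y. card {u\<in>F. y u} = c} \<le> 1 / sqrt (real (card F))"
proof -
  have c0: "0 < card F" using assms by (simp add: card_gt_0_iff)
  have "coins F \<pi> = Pi_pmf F False (\<lambda>_. bernoulli_pmf (1/2))"
    unfolding coins_def by (rule Pi_pmf_cong) (simp_all only: assms(3))
  hence "binomial_pmf (card F) (1/2) = map_pmf (\<lambda>f. card {x\<in>F. f x}) (coins F \<pi>)"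
    using binomial_pmf_altdef'[OF assms(1) refl, of "1/2" False] by simp
  hence "measure_pmf.prob (coins F \<pi>) {y. card {u\<in>F. y u} = c} = pmf (binomial_pmf (card F) (1/2)) c"
    by (simp add: pmf_map vimage_def)
  also have "\<dots> = real (card F choose c) * (1/2) ^ c * (1 - 1/2) ^ (card F - c)"
    by (subst pmf_binomial) auto
  also have "\<dots> \<le> real (card F choose c) / 2 ^ card F"
  proof (cases "c \<le> card F")
    case True
    have "(1/2::real) ^ c * (1/2) ^ (card F - c) = (1/2) ^ card F"
      using True by (simp flip: power_add)
    thus ?thesis by (simp add: mult.assoc power_divide)
  qed (simp add: binomial_eq_0 not_le)
  also have "\<dots> \<le> (2 ^ card F / sqrt (real (card F))) / 2 ^ card F"
    by (intro divide_right_mono binomial_upper c0) simp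
  finally show ?thesis by simp
qed

text \<open>Freeze every coin outside \<open>F\<close>. As \<open>F\<close> lies in \<open>N\<close> and misses \<open>N'\<close>, a collision then
  prescribes the number of heads among the fair coins of \<open>F\<close>.\<close>
lemma prob_collision:
  fixes a b :: nat
  assumes B: "finite B" "N \<subseteq> B" "N' \<subseteq> B" and F: "F \<subseteq> N - N'" "F \<noteq> {}" "\<And>u. u \<in> F \<Longrightarrow> \<pi> u = 1 / 2"
  shows "measure_pmf.prob (coins B \<pi>) {y. a + card {u\<in>N. y u} = b + card {u\<in>N'. y u}} \<le> 1 / sqrt (real (card F))"
proof -
  let ?m = "\<lambda>f g u. if u \<in> F then f u else (g u :: bool)"
  have FB: "F \<subseteq> B" using B(2) F(1) by blast
  have fin: "finite F" "finite N"
    using finite_subset[OF FB B(1)] finite_subset[OF B(2) B(1)] by simp_all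
  have *: "measure_pmf.expectation (coins F \<pi>) (\<lambda>f. of_bool (a + card {u\<in>N. ?m f g u} = b + card {u\<in>N'. ?m f g u}))
    \<le> 1 / sqrt (real (card F))" for g :: "'a \<Rightarrow> bool"
  proof -
    have N': "{u\<in>N'. ?m f g u} = {u\<in>N'. g u}" for f
    proof (rule Collect_cong)
      fix u show "(u \<in> N' \<and> ?m f g u) = (u \<in> N' \<and> g u)" using F(1) by (cases "u \<in> F") auto
    qed
    have N: "card {u\<in>N. ?m f g u} = card {u\<in>F. f u} + card {u\<in>N - F. g u}" for f
    proof -
      have "{u\<in>N. ?m f g u} = {u\<in>F. f u} \<union> {u\<in>N - F. g u}"
      proof (rule set_eqI)
        fix u show "u \<in> {u\<in>N. ?m f g u} \<longleftrightarrow> u \<in> {u\<in>F. f u} \<union> {u\<in>N - F. g u}"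
          using F(1) by (cases "u \<in> F") auto
      qed
      moreover have "{u\<in>F. f u} \<inter> {u\<in>N - F. g u} = {}" by blast
      ultimately show ?thesis using fin by (simp add: card_Un_disjoint)
    qed
    have "measure_pmf.prob (coins F \<pi>) {f. a + card {u\<in>N. ?m f g u} = b + card {u\<in>N'. ?m f g u}}
       \<le> measure_pmf.prob (coins F \<pi>) {f. card {u\<in>F. f u} = b + card {u\<in>N'. g u} - a - card {u\<in>N - F. g u}}"
    proof (intro measure_pmf.finite_measure_mono subsetI)
      fix f assume "f \<in> {f. a + card {u\<in>N. ?m f g u} = b + card {u\<in>N'. ?m f g u}}"
      hence "a + (card {u\<in>F. f u} + card {u\<in>N - F. g u}) = b + card {u\<in>N'. g u}"
        by (simp only: mem_Collect_eq N N')
      hence "card {u\<in>F. f u} = b + card {u\<in>N'. g u} - a - card {u\<in>N - F. g u}" by linarith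
      thus "f \<in> {f. card {u\<in>F. f u} = b + card {u\<in>N'. g u} - a - card {u\<in>N - F. g u}}"
        by (simp only: mem_Collect_eq)
    qed simp
    also have "\<dots> \<le> 1 / sqrt (real (card F))" by (rule fair_coins_point_prob[OF fin(1) F(2,3)])
    finally show ?thesis unfolding prob_eq_expectation .
  qed
  have "measure_pmf.prob (coins B \<pi>) {y. a + card {u\<in>N. y u} = b + card {u\<in>N'. y u}}
    = measure_pmf.expectation (coins (B - F) \<pi>) (\<lambda>g. measure_pmf.expectation (coins F \<pi>)
        (\<lambda>f. of_bool (a + card {u\<in>N. ?m f g u} = b + card {u\<in>N'. ?m f g u})))"
    unfolding prob_eq_expectation by (rule coins_split[OF B(1) FB])
  also have "\<dots> \<le> measure_pmf.expectation (coins (B - F) \<pi>) (\<lambda>g. 1 / sqrt (real (card F)))"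
    using B(1) * by (intro expectation_mono_coins) auto
  finally show ?thesis by simp
qed

text \<open>Discard every index that collides with a smaller one; each discarded index accounts for a
  pair.\<close>
lemma card_image_collisions:
  fixes f :: "nat \<Rightarrow> 'b"
  assumes "finite G"
  shows "card G \<le> card (f ` G) + card {(i, j). i \<in> G \<and> j \<in> G \<and> i < j \<and> f i = f j}"
proof -
  let ?P = "{(i, j). i \<in> G \<and> j \<in> G \<and> i < j \<and> f i = f j}"
  define M where "M = {j\<in>G. \<exists>i\<in>G. i < j \<and> f i = f j}"
  have fP: "finite ?P" by (rule finite_subset[of _ "G \<times> G"]) (use assms in auto)
  have "inj_on f (G - M)"
  proof (rule inj_onI)
    fix i j assume *: "i \<in> G - M" "j \<in> G - M" "f i = f j"
    have "\<not> i < j" using * unfolding M_def by blast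
    moreover have "\<not> j < i" using * unfolding M_def by force
    ultimately show "i = j" by simp
  qed
  hence "card (G - M) = card (f ` (G - M))" by (simp add: card_image)
  also have "\<dots> \<le> card (f ` G)" using assms by (intro card_mono) auto
  finally have 1: "card (G - M) \<le> card (f ` G)" .
  have "M \<subseteq> snd ` ?P" unfolding M_def by force
  hence "card M \<le> card ?P" using fP by (rule surj_card_le[rotated])
  moreover have "card G \<le> card (G - M) + card M"
    using assms card_Diff_subset[of M G] card_mono[of G M] by (auto simp: M_def intro: finite_subset)
  ultimately show ?thesis using 1 by linarith
qed

text \<open>Here \<open>N i\<close> is the set of neighbours of \<open>i\<close> among the vertices \<open>B\<close> that may be kept, \<open>d i\<close>
  its degree among the \<open>k\<close> vertices themselves, and \<open>\<pi> u\<close> the probability of keeping \<open>u\<close>. Up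
  to the common shift \<open>m\<close> the expected degrees follow, with average error \<open>C s\<close>, a sequence
  \<open>\<mu>\<close> of slope \<open>K\<close>; the sampling error is of order \<open>s\<close> as well. So all but an expected quarter
  of the degrees are within \<open>8 (C + 1) s\<close> of their target. Two such degrees can only
  coincide if the indices differ by at most \<open>16 (C + 1) s / K\<close>, and then do so with
  probability at most \<open>4 / s\<close>. This makes at most \<open>64 (C + 1) k / K \<le> k / 8\<close>
  collisions on average.\<close>
lemma random_rounding_separates:
  fixes \<mu> :: "nat \<Rightarrow> real" and d :: "nat \<Rightarrow> nat" and N :: "nat \<Rightarrow> 'a set" and s C K m :: real
  assumes B: "finite B" "B2 \<subseteq> B" and k: "0 < k" and s: "1 \<le> s" and C: "0 \<le> C" and K: "512 * (C + 1) \<le> K"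
    and \<pi>: "\<And>u. u \<in> B \<Longrightarrow> 0 \<le> \<pi> u \<and> \<pi> u \<le> 1" "\<And>u. u \<in> B2 \<Longrightarrow> \<pi> u = 1 / 2"
    and N: "\<And>i. i < k \<Longrightarrow> N i \<subseteq> B" "\<And>i. i < k \<Longrightarrow> real (card (N i)) \<le> 3 * s\<^sup>2"
    and codiff: "\<And>i j. i < k \<Longrightarrow> j < k \<Longrightarrow> i \<noteq> j \<Longrightarrow> s\<^sup>2 / 16 \<le> real (card (N i \<inter> B2 - N j))"
    and spread: "\<And>i j. i < j \<Longrightarrow> j < k \<Longrightarrow> K * real (j - i) \<le> \<mu> j - \<mu> i"
    and l1: "(\<Sum>i<k. \<bar>(\<Sum>u\<in>N i. \<pi> u) + real (d i) - m - \<mu> i\<bar>) \<le> C * real k * s"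
  obtains T where "T \<subseteq> B" "real k / 2 \<le> real (card ((\<lambda>i. d i + card (N i \<inter> T)) ` {..<k}))"
proof -
  define Q where "Q = coins B \<pi>"
  define Z where "Z = (\<lambda>i y. d i + card {u\<in>N i. y u})"
  define r where "r = 8 * (C + 1)"
  define far where "far = (\<lambda>i (y :: 'a \<Rightarrow> bool). r * s < \<bar>real (Z i y) - m - \<mu> i\<bar>)"
  \<comment> \<open>The pairs that can collide without one of the two degrees being far from its target.\<close>
  define P where "P = {(i, j). i < j \<and> j < k \<and> K * real (j - i) \<le> 2 * r * s}"
  define I where "I = {i\<in>{..<k}. 8 * C * s < \<bar>(\<Sum>u\<in>N i. \<pi> u) + real (d i) - m - \<mu> i\<bar>}"
  have "0 < 512 * (C + 1)" using C by simp
  hence Kpos: "0 < K" using K by (rule less_le_trans)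
  have fN: "finite (N i)" if "i < k" for i using N(1)[OF that] B(1) by (rule finite_subset)
  have Psub: "P \<subseteq> (\<lambda>(i, t). (i, i + t)) ` ({..<k} \<times> {1..nat \<lfloor>2 * r * s / K\<rfloor>})"
  proof
    fix x assume "x \<in> P"
    then obtain i j where x: "x = (i, j)" "i < j" "j < k" "K * real (j - i) \<le> 2 * r * s" unfolding P_def by blast
    have "real (j - i) \<le> 2 * r * s / K" using x(4) Kpos by (simp add: field_simps)
    hence "j - i \<le> nat \<lfloor>2 * r * s / K\<rfloor>" by (simp add: le_nat_floor)
    hence "(i, j - i) \<in> {..<k} \<times> {1..nat \<lfloor>2 * r * s / K\<rfloor>}" using x by auto
    moreover have "x = (\<lambda>(i, t). (i, i + t)) (i, j - i)" using x by simp
    ultimately show "x \<in> (\<lambda>(i, t). (i, i + t)) ` ({..<k} \<times> {1..nat \<lfloor>2 * r * s / K\<rfloor>})" by blast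
  qed
  have fP: "finite P" by (rule finite_subset[OF Psub]) simp
  have "card P \<le> card ((\<lambda>(i, t). (i, i + t)) ` ({..<k} \<times> {1..nat \<lfloor>2 * r * s / K\<rfloor>}))"
    by (rule card_mono[OF _ Psub]) simp
  also have "\<dots> \<le> card ({..<k} \<times> {1..nat \<lfloor>2 * r * s / K\<rfloor>})" by (rule card_image_le) simp
  also have "\<dots> = k * nat \<lfloor>2 * r * s / K\<rfloor>" by (simp add: card_cartesian_product)
  finally have "real (card P) \<le> real (k * nat \<lfloor>2 * r * s / K\<rfloor>)" by (rule of_nat_mono)
  also have "\<dots> \<le> real k * (2 * r * s / K)"
    unfolding of_nat_mult using C s Kpos by (intro mult_left_mono of_nat_floor) (auto simp: r_def)
  finally have cardP: "real (card P) \<le> real k * (2 * r * s / K)" .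
  \<comment> \<open>Markov's inequality for the average error.\<close>
  have cardI: "real (card I) \<le> real k / 8"
  proof (cases "C = 0")
    case True
    have "I = {}"
    proof (rule equals0I)
      fix i assume i: "i \<in> I"
      have "\<bar>(\<Sum>u\<in>N i. \<pi> u) + real (d i) - m - \<mu> i\<bar> \<le> (\<Sum>i<k. \<bar>(\<Sum>u\<in>N i. \<pi> u) + real (d i) - m - \<mu> i\<bar>)"
        using i unfolding I_def by (intro member_le_sum) auto
      also have "\<dots> \<le> 0" using l1 True by simp
      finally show False using True i unfolding I_def by simp
    qed
    thus ?thesis by simp
  next
    case False
    have "real (card I) * (8 * C * s) = (\<Sum>i\<in>I. 8 * C * s)" by simp
    also have "\<dots> \<le> (\<Sum>i\<in>I. \<bar>(\<Sum>u\<in>N i. \<pi> u) + real (d i) - m - \<mu> i\<bar>)"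
      by (intro sum_mono) (auto simp: I_def)
    also have "\<dots> \<le> (\<Sum>i<k. \<bar>(\<Sum>u\<in>N i. \<pi> u) + real (d i) - m - \<mu> i\<bar>)"
      by (intro sum_mono2) (auto simp: I_def)
    also have "\<dots> \<le> (real k / 8) * (8 * C * s)" using l1 by (simp add: mult_ac)
    finally show ?thesis using False C s by (subst (asm) mult_le_cancel_right_pos) auto
  qed
  have far_prob: "measure_pmf.prob Q {y. far i y} \<le> 1 / 8 + of_bool (i \<in> I)" if i: "i < k" for i
  proof (cases "i \<in> I")
    case True
    have "measure_pmf.prob Q {y. far i y} \<le> 1" by simp
    thus ?thesis using True by (simp del: measure_pmf.prob_le_1)
  next
    case False
    have "measure_pmf.prob Q {y. far i y}
      \<le> measure_pmf.prob Q {y. 8 * s \<le> \<bar>\<Sum>u\<in>N i. 1 * (of_bool (y u) - \<pi> u)\<bar>}"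
    proof (intro measure_pmf.finite_measure_mono subsetI CollectI)
      fix y assume "y \<in> {y. far i y}"
      hence "r * s < \<bar>real (Z i y) - m - \<mu> i\<bar>" by (simp add: far_def)
      moreover have "real (card {u\<in>N i. y u}) = (\<Sum>u\<in>N i. of_bool (y u))"
        using fN[OF i] by (simp add: Int_def)
      hence "real (Z i y) - m - \<mu> i = (\<Sum>u\<in>N i. 1 * (of_bool (y u) - \<pi> u)) + ((\<Sum>u\<in>N i. \<pi> u) + real (d i) - m - \<mu> i)"
        by (simp add: Z_def sum_subtractf)
      moreover have "\<bar>(\<Sum>u\<in>N i. \<pi> u) + real (d i) - m - \<mu> i\<bar> \<le> 8 * C * s" using False i by (simp add: I_def)
      moreover have "r * s = 8 * C * s + 8 * s" by (simp add: r_def algebra_simps)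
      ultimately show "8 * s \<le> \<bar>\<Sum>u\<in>N i. 1 * (of_bool (y u) - \<pi> u)\<bar>" by linarith
    qed simp
    also have "\<dots> \<le> 2 * exp ((1 / s)\<^sup>2 * (3 * s\<^sup>2) - (1 / s) * (8 * s))"
      unfolding Q_def
    proof (rule tail_linear_abs)
      have "(\<Sum>u\<in>N i. \<pi> u * 1\<^sup>2) \<le> (\<Sum>u\<in>N i. 1)" using \<pi>(1) N(1)[OF i] by (intro sum_mono) auto
      thus "(\<Sum>u\<in>N i. \<pi> u * 1\<^sup>2) \<le> 3 * s\<^sup>2" using N(2)[OF i] by simp
    qed (use B \<pi> N(1)[OF i] s in auto)
    also have "(1 / s)\<^sup>2 * (3 * s\<^sup>2) - (1 / s) * (8 * s) = - 5" using s by (simp add: power_divide)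
    also have "2 * exp (-5::real) \<le> 1 / 8"
    proof -
      have "16 \<le> exp (5::real)" using two_power_le_exp[of 5] by simp
      thus ?thesis by (simp add: exp_minus field_simps)
    qed
    finally show ?thesis using False by simp
  qed
  have coll_prob: "measure_pmf.prob Q {y. Z (fst x) y = Z (snd x) y} \<le> 4 / s" if x: "x \<in> P" for x
  proof -
    obtain i j where ij: "x = (i, j)" "i < j" "j < k" using x unfolding P_def by blast
    let ?F = "N i \<inter> B2 - N j"
    have F: "s\<^sup>2 / 16 \<le> real (card ?F)" using codiff[of i j] ij by simp
    moreover have "0 < s\<^sup>2 / 16" using s by simp
    ultimately have Fne: "?F \<noteq> {}" by (metis card.empty not_le of_nat_0)
    have cpos: "0 < real (card ?F)" using F \<open>0 < s\<^sup>2 / 16\<close> by linarith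
    have "measure_pmf.prob Q {y. Z i y = Z j y} \<le> 1 / sqrt (real (card ?F))"
      unfolding Q_def Z_def using ij
      by (intro prob_collision[OF B(1)] N Fne \<pi>) auto
    also have "\<dots> \<le> 1 / sqrt (s\<^sup>2 / 16)" using F s by (intro divide_left_mono real_sqrt_le_mono mult_pos_pos)
        (use \<open>0 < s\<^sup>2 / 16\<close> F cpos in \<open>simp_all only: real_sqrt_gt_zero zero_le_one\<close>)
    also have "sqrt (s\<^sup>2 / 16) = s / 4" using s by (simp add: real_sqrt_divide)
    finally show ?thesis by (simp add: ij)
  qed
  define X where "X = (\<lambda>y. (\<Sum>i<k. of_bool (far i y)) + (\<Sum>x\<in>P. of_bool (Z (fst x) y = Z (snd x) y)) :: real)"
  have "measure_pmf.expectation Q X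
    = (\<Sum>i<k. measure_pmf.prob Q {y. far i y}) + (\<Sum>x\<in>P. measure_pmf.prob Q {y. Z (fst x) y = Z (snd x) y})"
    unfolding X_def prob_eq_expectation Q_def using B(1)
    by (simp add: Bochner_Integration.integral_add Bochner_Integration.integral_sum del: sum_of_bool_eq)
  also have "\<dots> \<le> (\<Sum>i<k. 1 / 8 + of_bool (i \<in> I)) + (\<Sum>x\<in>P. 4 / s)"
    by (intro add_mono sum_mono far_prob coll_prob) auto
  also have "(\<Sum>i<k. 1 / 8 + of_bool (i \<in> I) :: real) = real k / 8 + real (card I)"
  proof -
    have "(\<Sum>i<k. of_bool (i \<in> I) :: real) = real (card ({..<k} \<inter> I))" by (simp add: Int_def)
    also have "{..<k} \<inter> I = I" unfolding I_def by blast
    finally show ?thesis by (simp add: sum.distrib)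
  qed
  also have "(\<Sum>x\<in>P. 4 / s) \<le> real k / 8"
  proof -
    have "(\<Sum>x\<in>P. 4 / s) = real (card P) * (4 / s)" by simp
    also have "\<dots> \<le> real k * (2 * r * s / K) * (4 / s)" using s by (intro mult_right_mono cardP) auto
    also have "\<dots> = real k * (8 * r / K)" using s by (simp add: field_simps)
    also have "\<dots> \<le> real k * (1 / 8)"
      using K Kpos by (intro mult_left_mono) (auto simp: r_def field_simps)
    finally show ?thesis by simp
  qed
  finally have EX: "measure_pmf.expectation Q X \<le> 3 / 8 * real k" using cardI by simp
  \<comment> \<open>Some outcome does as well as the average; it gives the set that is kept.\<close>
  have "\<exists>y. X y < real k / 2"
  proof (rule ccontr)
    assume "\<not> ?thesis"
    hence "measure_pmf.expectation Q (\<lambda>_. real k / 2) \<le> measure_pmf.expectation Q X"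
      unfolding Q_def by (intro expectation_mono_coins[OF B(1)]) (auto simp: not_less)
    thus False using EX k by simp
  qed
  then obtain y where y: "X y < real k / 2" by blast
  define T where "T = {u\<in>B. y u}"
  have NT: "d i + card (N i \<inter> T) = Z i y" if "i < k" for i
  proof -
    have "N i \<inter> T = {u\<in>N i. y u}" using N(1)[OF that] unfolding T_def by blast
    thus ?thesis by (simp add: Z_def)
  qed
  define G where "G = {i\<in>{..<k}. \<not> far i y}"
  have coll_sub: "{(i, j). i \<in> G \<and> j \<in> G \<and> i < j \<and> Z i y = Z j y} \<subseteq> {x\<in>P. Z (fst x) y = Z (snd x) y}"
  proof
    fix x assume "x \<in> {(i, j). i \<in> G \<and> j \<in> G \<and> i < j \<and> Z i y = Z j y}"
    then obtain i j where x: "x = (i, j)" "i \<in> G" "j \<in> G" "i < j" "Z i y = Z j y" by blast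
    have "\<bar>real (Z i y) - m - \<mu> i\<bar> \<le> r * s" "\<bar>real (Z j y) - m - \<mu> j\<bar> \<le> r * s" "j < k"
      using x unfolding G_def far_def by auto
    moreover have "K * real (j - i) \<le> \<mu> j - \<mu> i" using spread[of i j] x(4) \<open>j < k\<close> .
    ultimately have "K * real (j - i) \<le> 2 * r * s" using x(5) by linarith
    thus "x \<in> {x\<in>P. Z (fst x) y = Z (snd x) y}" using x \<open>j < k\<close> unfolding P_def by simp
  qed
  have "card G \<le> card ((\<lambda>i. Z i y) ` G) + card {(i, j). i \<in> G \<and> j \<in> G \<and> i < j \<and> Z i y = Z j y}"
    by (rule card_image_collisions) (simp add: G_def)
  also have "card {(i, j). i \<in> G \<and> j \<in> G \<and> i < j \<and> Z i y = Z j y} \<le> card {x\<in>P. Z (fst x) y = Z (snd x) y}"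
    using fP by (intro card_mono coll_sub) auto
  also have "card ((\<lambda>i. Z i y) ` G) \<le> card ((\<lambda>i. Z i y) ` {..<k})" by (intro card_mono) (auto simp: G_def)
  finally have "real (card G) \<le> real (card ((\<lambda>i. Z i y) ` {..<k})) + real (card {x\<in>P. Z (fst x) y = Z (snd x) y})"
    by (simp flip: of_nat_add)
  moreover have "real (card G) = real k - (\<Sum>i<k. of_bool (far i y))"
  proof -
    have "G = {..<k} - {i\<in>{..<k}. far i y}" unfolding G_def by blast
    moreover have "card ({..<k} - {i\<in>{..<k}. far i y}) = card {..<k} - card {i\<in>{..<k}. far i y}"
      by (rule card_Diff_subset) auto
    ultimately have "card G = k - card {i\<in>{..<k}. far i y}" by simp
    moreover have "card {i\<in>{..<k}. far i y} \<le> k" using card_mono[of "{..<k}" "{i\<in>{..<k}. far i y}"] by auto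
    ultimately show ?thesis by (simp add: Int_def of_nat_diff)
  qed
  moreover have "real (card {x\<in>P. Z (fst x) y = Z (snd x) y}) = (\<Sum>x\<in>P. of_bool (Z (fst x) y = Z (snd x) y))"
    using fP by (simp add: Int_def)
  ultimately have "real k / 2 \<le> real (card ((\<lambda>i. Z i y) ` {..<k}))" using y unfolding X_def by linarith
  moreover have "(\<lambda>i. d i + card (N i \<inter> T)) ` {..<k} = (\<lambda>i. Z i y) ` {..<k}"
    by (intro image_cong) (auto simp: NT)
  ultimately show ?thesis using that[of T] by (simp add: T_def)
qed

section \<open>Tilting the choice of a vertex by its neighbourhood\<close>

definition clamp_half :: "real \<Rightarrow> real" where
  "clamp_half t = max (- 1 / 2) (min (1 / 2) t)"

definition row_sum :: "nat \<Rightarrow> real \<Rightarrow> (nat \<Rightarrow> real) \<Rightarrow> (nat set \<Rightarrow> bool) \<Rightarrow> nat \<Rightarrow> real" where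
  "row_sum k p w y u = (\<Sum>i<k. w i * (of_bool (y {u, i}) - p))"

text \<open>The probability of keeping \<open>u\<close>, tilted towards the vertices \<open>u\<close> whose neighbours have large
  weight. The strength \<open>g u\<close> of the tilt depends on \<open>u\<close> so that \<open>g u = 0\<close> describes the
  vertices that are kept by a fair coin.\<close>
definition incl_prob :: "nat \<Rightarrow> real \<Rightarrow> (nat \<Rightarrow> real) \<Rightarrow> (nat \<Rightarrow> real) \<Rightarrow> (nat set \<Rightarrow> bool) \<Rightarrow> nat \<Rightarrow> real" where
  "incl_prob k p g w y u = 1 / 2 + clamp_half (g u * row_sum k p w y u)"

abbreviation spokes :: "nat \<Rightarrow> nat \<Rightarrow> nat set set" where
  "spokes k u \<equiv> (\<lambda>i. {u, i}) ` {..<k}"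

lemma incl_prob_bounds: "0 \<le> incl_prob k p g w y u" "incl_prob k p g w y u \<le> 1"
  by (auto simp: incl_prob_def clamp_half_def)

lemma spokes_inj: "inj_on (\<lambda>i. {u, i :: nat}) A"
  by (rule inj_onI) (auto simp: doubleton_eq_iff)

lemma row_sum_edges:
  "row_sum k p w y u = (\<Sum>e\<in>spokes k u. w (inv_into {..<k} (\<lambda>i. {u, i}) e) * (of_bool (y e) - p))"
  unfolding row_sum_def by (subst sum.reindex[OF spokes_inj]) (auto simp: inv_into_f_f[OF spokes_inj])

lemma spokes_subset: "k \<le> u \<Longrightarrow> u < n \<Longrightarrow> spokes k u \<subseteq> all_edges {..<n}"
  by (auto simp: all_edges_iff)

lemma mgf_row_sum:
  fixes p \<theta> :: real
  assumes u: "k \<le> u" "u < n" and p: "0 \<le> p" "p \<le> 1" and w: "\<And>i. \<bar>w i\<bar> \<le> 1" and \<theta>: "\<bar>\<theta>\<bar> \<le> 1"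
  shows "measure_pmf.expectation (edge_coins n p) (\<lambda>y. exp (\<theta> * row_sum k p w y u)) \<le> exp (\<theta>\<^sup>2 * (real k * p))"
proof -
  define v where "v = (\<lambda>e. \<theta> * w (inv_into {..<k} (\<lambda>i. {u, i}) e))"
  have v: "\<bar>v e\<bar> \<le> \<bar>\<theta>\<bar>" for e
    unfolding v_def abs_mult using mult_left_mono[OF w, of "\<bar>\<theta>\<bar>"] by simp
  have "measure_pmf.expectation (edge_coins n p) (\<lambda>y. exp (\<theta> * row_sum k p w y u))
    = measure_pmf.expectation (edge_coins n p) (\<lambda>y. exp (\<Sum>e\<in>spokes k u. v e * (of_bool (y e) - p)))"
    unfolding row_sum_edges v_def sum_distrib_left by (simp only: mult.assoc)
  also have "\<dots> \<le> exp (\<Sum>e\<in>spokes k u. p * (v e)\<^sup>2)"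
    using p v \<theta> by (intro mgf_linear spokes_subset u) (auto intro: order_trans[OF v])
  also have "\<dots> \<le> exp (\<theta>\<^sup>2 * (real k * p))"
  proof -
    have "(\<Sum>e\<in>spokes k u. p * (v e)\<^sup>2) \<le> (\<Sum>e\<in>spokes k u. p * \<theta>\<^sup>2)"
      using p v by (intro sum_mono mult_left_mono) (auto simp: abs_le_square_iff)
    also have "\<dots> = \<theta>\<^sup>2 * (real k * p)" by (simp add: card_image[OF spokes_inj])
    finally show ?thesis by simp
  qed
  finally show ?thesis .
qed

text \<open>Unlike \<open>exp_le_quadratic\<close> this has no restriction on \<open>x\<close>, as is needed for a single vertex
  \<open>u\<close>, whose contribution can be of order \<open>k\<close>.\<close>
lemma exp_sub_le: "exp x \<le> 1 + x + x\<^sup>2 * exp \<bar>x\<bar>" for x :: real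
proof -
  have "1 - x \<le> exp (- x)" using exp_ge_add_one_self[of "- x"] by simp
  hence "exp x * (1 - x) \<le> exp x * exp (- x)" by (intro mult_left_mono) auto
  hence a: "exp x - 1 \<le> x * exp x" by (simp add: exp_minus_inverse algebra_simps)
  have b: "x \<le> exp x - 1" using exp_ge_add_one_self[of x] by linarith
  show ?thesis
  proof (cases "0 \<le> x")
    case True
    have "exp x - 1 - x \<le> x * (exp x - 1)" using a by (simp add: algebra_simps)
    also have "\<dots> \<le> x * (x * exp x)" using a True by (intro mult_left_mono)
    finally show ?thesis using True by (simp add: power2_eq_square)
  next
    case False
    have "exp x - 1 - x \<le> x * (exp x - 1)" using a by (simp add: algebra_simps)
    also have "\<dots> \<le> x * x" using b False by (intro mult_left_mono_neg) auto
    also have "\<dots> \<le> x\<^sup>2 * exp \<bar>x\<bar>" by (simp add: power2_eq_square mult_le_cancel_left1)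
    finally show ?thesis by simp
  qed
qed

text \<open>A centred exponential moment for a variable about which only a pointwise bound by a well
  understood \<open>V\<close> is known. The quadratic remainder \<open>(\<rho> V)\<^sup>2 exp \<bar>\<rho> V\<bar>\<close> is at most
  \<open>8 \<rho>\<^sup>2 exp \<bar>V\<bar>\<close> as long as \<open>\<rho> \<le> 1/2\<close>, because \<open>z\<^sup>2 \<le> 8 exp (z/2)\<close>; the constant is
  \<open>8 (e + e) \<le> 48\<close>.\<close>
lemma mgf_dominated:
  fixes X V :: "('e \<Rightarrow> bool) \<Rightarrow> real"
  assumes E: "finite E" and dom: "\<And>y. \<bar>X y\<bar> \<le> \<bar>V y\<bar>" and \<rho>: "0 \<le> \<rho>" "\<rho> \<le> 1 / 2"
    and V: "coins_exp E p (\<lambda>y. exp (V y)) \<le> exp 1"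
      "coins_exp E p (\<lambda>y. exp (- V y)) \<le> exp 1"
  shows "coins_exp E p (\<lambda>y. exp (\<rho> * (X y - coins_exp E p X)))
    \<le> exp (48 * \<rho>\<^sup>2)"
proof -
  let ?E = "coins_exp E p"
  have pt: "exp (\<rho> * X y) \<le> 1 + \<rho> * X y + 8 * \<rho>\<^sup>2 * (exp (V y) + exp (- V y))" for y
  proof -
    define z where "z = \<bar>V y\<bar>"
    have "(\<rho> * X y)\<^sup>2 \<le> \<rho>\<^sup>2 * z\<^sup>2"
      unfolding power_mult_distrib z_def using dom[of y] by (intro mult_left_mono) (auto simp: abs_le_square_iff[symmetric])
    moreover have "exp \<bar>\<rho> * X y\<bar> \<le> exp (z / 2)"
    proof -
      have "\<bar>\<rho> * X y\<bar> \<le> 1 / 2 * z" unfolding abs_mult z_def using \<rho> dom[of y] by (intro mult_mono) auto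
      thus ?thesis by simp
    qed
    ultimately have "(\<rho> * X y)\<^sup>2 * exp \<bar>\<rho> * X y\<bar> \<le> (\<rho>\<^sup>2 * z\<^sup>2) * exp (z / 2)"
      by (intro mult_mono) auto
    also have "\<dots> \<le> (\<rho>\<^sup>2 * (8 * exp (z / 2))) * exp (z / 2)"
    proof -
      have "1 + z / 2 + (z / 2)\<^sup>2 / 2 \<le> exp (z / 2)" by (rule exp_lower_Taylor_quadratic) (simp add: z_def)
      hence "z\<^sup>2 \<le> 8 * exp (z / 2)" unfolding z_def by (simp add: power_divide)
      thus ?thesis by (intro mult_right_mono mult_left_mono) auto
    qed
    also have "\<dots> = 8 * \<rho>\<^sup>2 * (exp (z / 2) * exp (z / 2))" by (simp only: mult_ac)
    also have "exp (z / 2) * exp (z / 2) = exp z" unfolding exp_add[symmetric] by simp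
    also have "8 * \<rho>\<^sup>2 * exp z \<le> 8 * \<rho>\<^sup>2 * (exp (V y) + exp (- V y))"
      unfolding z_def by (intro mult_left_mono) (auto simp: abs_if)
    finally show ?thesis using exp_sub_le[of "\<rho> * X y"] by linarith
  qed
  have "?E (\<lambda>y. exp (\<rho> * X y)) \<le> ?E (\<lambda>y. 1 + \<rho> * X y + 8 * \<rho>\<^sup>2 * (exp (V y) + exp (- V y)))"
    by (rule expectation_mono_coins[OF E pt])
  also have "\<dots> = 1 + \<rho> * ?E X + 8 * \<rho>\<^sup>2 * (?E (\<lambda>y. exp (V y)) + ?E (\<lambda>y. exp (- V y)))"
    using E by simp
  also have "\<dots> \<le> 1 + \<rho> * ?E X + 8 * \<rho>\<^sup>2 * (3 + 3)"
    using V exp_le by (intro add_left_mono mult_left_mono add_mono) auto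
  also have "\<dots> \<le> exp (\<rho> * ?E X + 48 * \<rho>\<^sup>2)"
  proof -
    have "8 * \<rho>\<^sup>2 * (3 + 3) = 48 * \<rho>\<^sup>2" by simp
    thus ?thesis using exp_ge_add_one_self[of "\<rho> * ?E X + 48 * \<rho>\<^sup>2"] by linarith
  qed
  finally have *: "?E (\<lambda>y. exp (\<rho> * X y)) \<le> exp (\<rho> * ?E X + 48 * \<rho>\<^sup>2)" .
  have "?E (\<lambda>y. exp (\<rho> * (X y - ?E X))) = ?E (\<lambda>y. exp (- (\<rho> * ?E X)) * exp (\<rho> * X y))"
    unfolding exp_add[symmetric] by (simp add: right_diff_distrib)
  also have "\<dots> = exp (- (\<rho> * ?E X)) * ?E (\<lambda>y. exp (\<rho> * X y))" by simp
  also have "\<dots> \<le> exp (- (\<rho> * ?E X)) * exp (\<rho> * ?E X + 48 * \<rho>\<^sup>2)" by (intro mult_left_mono *) simp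
  also have "\<dots> = exp (48 * \<rho>\<^sup>2)" unfolding exp_add[symmetric] by simp
  finally show ?thesis .
qed

lemma clamp_half_gap:
  assumes "\<bar>r\<bar> < 1 / 4" "\<bar>a\<bar> \<le> 1 / 4" "\<bar>b\<bar> \<le> 1 / 4"
  shows "clamp_half (r + a) - clamp_half (r + b) = a - b"
  using assms by (auto simp: clamp_half_def)

lemma clamp_half_mono: "s \<le> t \<Longrightarrow> clamp_half s \<le> clamp_half t"
  by (auto simp: clamp_half_def)

text \<open>Only the two outcomes in which \<open>u\<close> is adjacent to exactly one of \<open>i\<close> and \<open>j\<close> count. They
  are equally likely, and exchanging them moves the weighted row sum by exactly
  \<open>w j - w i\<close>. So the two probabilities of keeping \<open>u\<close> differ by \<open>g u (w j - w i)\<close>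
  unless the truncation interferes, and they are in the right order in any case. The
  truncation interferes with probability at most \<open>1/4\<close>. Working with the difference of two
  vertices keeps the estimate exact up to a factor, which an approximation of the expected
  degree of each single vertex would not.\<close>
lemma expectation_swap_gap:
  fixes p \<theta> :: real
  assumes u: "k \<le> u" "u < n" and p: "0 \<le> p" "p \<le> 1 / 2" and ij: "i < k" "j < k" "i \<noteq> j"
    and w: "\<And>l. 0 \<le> w l \<and> w l \<le> 1" "w i \<le> w j" and \<theta>: "0 \<le> \<theta>" "\<theta> \<le> 1" "\<theta>\<^sup>2 * (real k * p) \<le> 1"
    and g: "g u = \<theta> / 16 \<or> g u = 0"
  shows "3 / 8 * p * g u * (w j - w i) \<le> measure_pmf.expectation (edge_coins n p)
    (\<lambda>y. (of_bool (y {u, j}) - of_bool (y {u, i})) * incl_prob k p g w y u)"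
proof -
  let ?E = "measure_pmf.expectation (edge_coins n p)"
  let ?J = "{{u, i}, {u, j}}"
  \<comment> \<open>\<open>R\<close> is the part of the row sum that is independent of the edges to \<open>i\<close> and \<open>j\<close>.\<close>
  define v where "v = w(i := 0, j := 0)"
  define R where "R = (\<lambda>y. row_sum k p v y u)"
  define ai aj where "ai = (\<lambda>y :: nat set \<Rightarrow> bool. y {u, i})" and "aj = (\<lambda>y :: nat set \<Rightarrow> bool. y {u, j})"
  define c1 c2 where "c1 = w j * (1 - p) - w i * p" and "c2 = w i * (1 - p) - w j * p"
  have g0: "0 \<le> g u" "g u \<le> 1 / 16" using g \<theta> by auto
  have ne: "{u, i} \<noteq> {u, j}" using ij by (auto simp: doubleton_eq_iff)
  have fin: "finite (all_edges {..<n})" by simp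
  have Jsub: "?J \<subseteq> all_edges {..<n}" using u ij by (auto simp: all_edges_iff)
  have row_sum_eq: "row_sum k p w y u = R y + w j * (of_bool (aj y) - p) + w i * (of_bool (ai y) - p)" for y
  proof -
    have "row_sum k p w y u = w i * (of_bool (ai y) - p) + (w j * (of_bool (aj y) - p)
       + (\<Sum>l\<in>{..<k} - {i} - {j}. w l * (of_bool (y {u, l}) - p)))"
      unfolding row_sum_def ai_def aj_def using ij
      by (subst sum.remove[of _ i], simp, simp, subst sum.remove[of _ j]) auto
    moreover have "R y = (\<Sum>l\<in>{..<k} - {i} - {j}. w l * (of_bool (y {u, l}) - p))"
      unfolding R_def row_sum_def v_def using ij
      by (subst sum.remove[of _ i], simp, simp, subst sum.remove[of _ j]) (auto intro!: sum.cong)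
    ultimately show ?thesis by simp
  qed
  have Rdep: "depends_on (all_edges {..<n} - ?J) R"
  proof (rule depends_onI)
    fix y y' :: "nat set \<Rightarrow> bool" assume e: "\<And>e. e \<in> all_edges {..<n} - ?J \<Longrightarrow> y e = y' e"
    show "R y = R y'" unfolding R_def row_sum_def
    proof (rule sum.cong[OF refl])
      fix l assume l: "l \<in> {..<k}"
      show "v l * (of_bool (y {u, l}) - p) = v l * (of_bool (y' {u, l}) - p)"
      proof (cases "l = i \<or> l = j")
        case False
        hence "{u, l} \<in> all_edges {..<n} - ?J" using u l by (auto simp: all_edges_iff doubleton_eq_iff)
        from e[OF this] show ?thesis by simp
      qed (auto simp: v_def)
    qed
  qed
  have Gdep: "depends_on (all_edges {..<n} - ?J) (\<lambda>y. clamp_half (g u * (R y + c)))" for c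
    using Rdep unfolding depends_on_def by metis
  have pat: "?E (\<lambda>y. of_bool (y {u, a} \<and> \<not> y {u, b})) = p * (1 - p)"
    if "{u, a} \<noteq> {u, b}" "{{u, a}, {u, b}} = ?J" for a b
  proof -
    have "?E (\<lambda>y. of_bool (y {u, a} \<and> \<not> y {u, b}))
      = graph_prob n p {y. \<forall>e\<in>{{u, a}, {u, b}}. y e = (e = {u, a})}"
      unfolding prob_eq_expectation using that(1) by (simp add: conj_commute)
    also have "\<dots> = (\<Prod>e\<in>{{u, a}, {u, b}}. if e = {u, a} then p else 1 - p)"
      by (rule prob_pattern) (use p Jsub that in auto)
    also have "\<dots> = p * (1 - p)" using that(1) by simp
    finally show ?thesis .
  qed
  have split: "(of_bool (aj y) - of_bool (ai y)) * incl_prob k p g w y u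
    = 1 / 2 * of_bool (aj y \<and> \<not> ai y) - 1 / 2 * of_bool (ai y \<and> \<not> aj y)
      + (of_bool (aj y \<and> \<not> ai y) * clamp_half (g u * (R y + c1))
      - of_bool (ai y \<and> \<not> aj y) * clamp_half (g u * (R y + c2)))" for y
    unfolding incl_prob_def row_sum_eq c1_def c2_def
    by (cases "ai y"; cases "aj y") (simp_all add: algebra_simps)
  have i1: "?E (\<lambda>y. of_bool (aj y \<and> \<not> ai y) * clamp_half (g u * (R y + c1)))
      = p * (1 - p) * ?E (\<lambda>y. clamp_half (g u * (R y + c1)))"
    using pat[of j i] ne unfolding ai_def aj_def
    by (subst coins_indep2[OF fin Jsub _ Gdep]) (auto intro!: depends_onI)
  have i2: "?E (\<lambda>y. of_bool (ai y \<and> \<not> aj y) * clamp_half (g u * (R y + c2)))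
      = p * (1 - p) * ?E (\<lambda>y. clamp_half (g u * (R y + c2)))"
    using pat[of i j] ne unfolding ai_def aj_def
    by (subst coins_indep2[OF fin Jsub _ Gdep]) (auto intro!: depends_onI)
  have "?E (\<lambda>y. (of_bool (aj y) - of_bool (ai y)) * incl_prob k p g w y u)
    = 1 / 2 * ?E (\<lambda>y. of_bool (aj y \<and> \<not> ai y)) - 1 / 2 * ?E (\<lambda>y. of_bool (ai y \<and> \<not> aj y))
      + (?E (\<lambda>y. of_bool (aj y \<and> \<not> ai y) * clamp_half (g u * (R y + c1)))
      - ?E (\<lambda>y. of_bool (ai y \<and> \<not> aj y) * clamp_half (g u * (R y + c2))))"
    unfolding split by (simp only: Bochner_Integration.integral_add Bochner_Integration.integral_diff
        integrable_coins[OF fin] Bochner_Integration.integral_mult_right_zero)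
  also have "\<dots> = p * (1 - p) * (?E (\<lambda>y. clamp_half (g u * (R y + c1))) - ?E (\<lambda>y. clamp_half (g u * (R y + c2))))"
    unfolding i1 i2 using pat[of i j] pat[of j i] ne unfolding ai_def aj_def
    by (simp add: right_diff_distrib insert_commute)
  also have "\<dots> = p * (1 - p) * ?E (\<lambda>y. clamp_half (g u * (R y + c1)) - clamp_half (g u * (R y + c2)))"
    by simp
  also have "\<dots> \<ge> p * (1 - p) * ?E (\<lambda>y. g u * (w j - w i) * (1 - of_bool (1 / 4 \<le> \<bar>g u * R y\<bar>)))"
  proof (intro mult_left_mono expectation_mono_coins[OF fin])
    fix y
    have cc: "c1 - c2 = w j - w i" by (simp add: c1_def c2_def algebra_simps)
    have b: "\<bar>c\<bar> \<le> 1" if "c = a * (1 - p) - b * p" "0 \<le> a \<and> a \<le> 1" "0 \<le> b \<and> b \<le> 1" for a b c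
    proof -
      have "0 \<le> a * (1 - p)" "a * (1 - p) \<le> 1" "0 \<le> b * p" "b * p \<le> 1"
        using that p by (simp_all add: mult_le_one)
      thus ?thesis using that(1) by linarith
    qed
    have "\<bar>c1\<bar> \<le> 1" "\<bar>c2\<bar> \<le> 1" using b[OF c1_def w(1) w(1)] b[OF c2_def w(1) w(1)] by auto
    hence gc: "\<bar>g u * c1\<bar> \<le> 1 / 4" "\<bar>g u * c2\<bar> \<le> 1 / 4"
      using g0 mult_mono[of "g u" "1/16" "\<bar>c1\<bar>" 1] mult_mono[of "g u" "1/16" "\<bar>c2\<bar>" 1]
      by (auto simp: abs_mult)
    show "g u * (w j - w i) * (1 - of_bool (1 / 4 \<le> \<bar>g u * R y\<bar>))
        \<le> clamp_half (g u * (R y + c1)) - clamp_half (g u * (R y + c2))"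
    proof (cases "1 / 4 \<le> \<bar>g u * R y\<bar>")
      case True
      have "g u * (R y + c2) \<le> g u * (R y + c1)" using cc w(2) g0 by (intro mult_left_mono) auto
      from clamp_half_mono[OF this] True show ?thesis by simp
    next
      case False
      hence "clamp_half (g u * R y + g u * c1) - clamp_half (g u * R y + g u * c2) = g u * c1 - g u * c2"
        using gc by (intro clamp_half_gap) auto
      thus ?thesis using False cc by (simp add: distrib_left flip: right_diff_distrib)
    qed
  qed (use p in auto)
  finally have low: "p * (1 - p) * ?E (\<lambda>y. g u * (w j - w i) * (1 - of_bool (1 / 4 \<le> \<bar>g u * R y\<bar>)))
    \<le> ?E (\<lambda>y. (of_bool (aj y) - of_bool (ai y)) * incl_prob k p g w y u)" .
  have tail: "graph_prob n p {y. 1 / 4 \<le> \<bar>g u * R y\<bar>} \<le> 1 / 4"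
  proof (cases "g u = 0")
    case False
    hence gu: "g u = \<theta> / 16" "0 < \<theta>" using g \<theta> by auto
    have vle: "\<bar>v l\<bar> \<le> 1" for l using w(1)[of l] by (auto simp: v_def)
    have eq: "(1 / 4 \<le> \<bar>g u * R y\<bar>) = (4 / \<theta> \<le> \<bar>R y\<bar>)" for y
    proof -
      have "\<bar>g u * R y\<bar> = \<theta> / 16 * \<bar>R y\<bar>" using gu by (simp add: abs_mult)
      show ?thesis unfolding \<open>\<bar>g u * R y\<bar> = \<theta> / 16 * \<bar>R y\<bar>\<close> using gu(2) by (simp add: field_simps)
    qed
    have "graph_prob n p {y. 1 / 4 \<le> \<bar>g u * R y\<bar>} \<le> 2 * exp (\<theta>\<^sup>2 * (real k * p) - \<theta> * (4 / \<theta>))"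
      unfolding eq unfolding R_def row_sum_edges
    proof (rule tail_linear_abs)
      have "(\<Sum>e\<in>spokes k u. p * (v (inv_into {..<k} (\<lambda>i. {u, i}) e))\<^sup>2) \<le> (\<Sum>e\<in>spokes k u. p)"
        using vle p by (intro sum_mono mult_left_le) (auto simp: abs_square_le_1)
      also have "\<dots> = real k * p" by (simp add: card_image[OF spokes_inj])
      finally show "(\<Sum>e\<in>spokes k u. p * (v (inv_into {..<k} (\<lambda>i. {u, i}) e))\<^sup>2) \<le> real k * p" .
      show "spokes k u \<subseteq> all_edges {..<n}" by (rule spokes_subset[OF u])
      show "\<theta> * \<bar>v (inv_into {..<k} (\<lambda>i. {u, i}) e)\<bar> \<le> 1" for e
        using mult_mono[OF \<theta>(2) vle] \<theta> by simp
    qed (use p \<theta> in auto)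
    also have "\<dots> \<le> 2 * exp (- 3)" using \<theta>(3) gu by simp
    also have "\<dots> \<le> 1 / 4"
    proof -
      have "8 \<le> exp (3::real)" using two_power_le_exp[of 3] by simp
      thus ?thesis by (simp add: exp_minus field_simps)
    qed
    finally show ?thesis .
  qed simp
  have "3 / 8 * p * g u * (w j - w i) \<le> (p * (1 - p)) * (g u * (w j - w i) * (3 / 4))"
  proof -
    define c where "c = p * (g u * (w j - w i) * (3 / 4))"
    have "0 \<le> c" unfolding c_def using p g0 w(2) by simp
    hence "1 / 2 * c \<le> (1 - p) * c" by (intro mult_right_mono) (use p in simp)
    moreover have "3 / 8 * p * g u * (w j - w i) = 1 / 2 * c" by (simp add: c_def)
    moreover have "(p * (1 - p)) * (g u * (w j - w i) * (3 / 4)) = (1 - p) * c" unfolding c_def by (simp only: mult_ac)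
    ultimately show ?thesis by (simp only:)
  qed
  also have "\<dots> \<le> p * (1 - p) * (g u * (w j - w i) * (1 - graph_prob n p {y. 1 / 4 \<le> \<bar>g u * R y\<bar>}))"
    using tail p g0 w(2) by (intro mult_left_mono) auto
  also have "\<dots> = p * (1 - p) * ?E (\<lambda>y. g u * (w j - w i) * (1 - of_bool (1 / 4 \<le> \<bar>g u * R y\<bar>)))"
    unfolding prob_eq_expectation using fin by simp
  also note low
  finally show ?thesis unfolding ai_def aj_def .
qed

section \<open>Lower bound for large edge probability\<close>

text \<open>The expected degree of \<open>i\<close> into the kept set, minus the part \<open>p \<Sum>\<^sub>u incl_prob u\<close> that is
  common to all \<open>i\<close>. The common part shifts all degrees alike, so that it does not matter for
  their differences, while its deviations would be too large for a union bound over \<open>2\<^sup>k\<close>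
  signs.\<close>
definition displacement :: "nat \<Rightarrow> nat \<Rightarrow> real \<Rightarrow> (nat \<Rightarrow> real) \<Rightarrow> (nat \<Rightarrow> real) \<Rightarrow> (nat set \<Rightarrow> bool) \<Rightarrow> nat \<Rightarrow> real" where
  "displacement n k p g w y i = (\<Sum>u\<in>{k..<n}. (of_bool (y {u, i}) - p) * incl_prob k p g w y u)"

text \<open>Exchanging the sums turns the signed sum of displacements into a sum over \<open>u\<close> of
  independent terms, the row sum of \<open>u\<close> with weights \<open>\<epsilon>\<close> times the probability of keeping \<open>u\<close>;
  the row sum dominates it in the sense of \<open>mgf_dominated\<close>.\<close>
lemma prob_displacement_signed:
  fixes p \<theta> \<rho> t :: real
  assumes p: "0 \<le> p" "p \<le> 1" and \<theta>: "0 \<le> \<theta>" "\<theta> \<le> 1" "\<theta>\<^sup>2 * (real k * p) \<le> 1"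
    and \<rho>: "0 \<le> \<rho>" "\<rho> \<le> 1 / 2" and \<epsilon>: "\<And>i. \<bar>\<epsilon> i\<bar> \<le> 1"
  shows "graph_prob n p {y. t \<le> (\<Sum>i<k. \<epsilon> i * (displacement n k p g w y i
      - measure_pmf.expectation (edge_coins n p) (\<lambda>y. displacement n k p g w y i)))}
    \<le> exp (48 * real n * \<rho>\<^sup>2 - \<rho> * \<theta> * t)"
proof -
  let ?E = "measure_pmf.expectation (edge_coins n p)"
  let ?B = "{k..<n}"
  have fin: "finite (all_edges {..<n})" by simp
  define W where "W = (\<lambda>u y. \<theta> * row_sum k p \<epsilon> y u * incl_prob k p g w y u)"
  have sum_eq: "\<theta> * (\<Sum>i<k. \<epsilon> i * displacement n k p g w y i) = (\<Sum>u\<in>?B. W u y)" for y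
  proof -
    have "(\<Sum>i<k. \<epsilon> i * displacement n k p g w y i)
       = (\<Sum>u\<in>?B. \<Sum>i<k. \<epsilon> i * ((of_bool (y {u, i}) - p) * incl_prob k p g w y u))"
      unfolding displacement_def sum_distrib_left by (rule sum.swap)
    also have "\<dots> = (\<Sum>u\<in>?B. row_sum k p \<epsilon> y u * incl_prob k p g w y u)"
      unfolding row_sum_def sum_distrib_right by (simp only: mult.assoc)
    finally show ?thesis unfolding W_def by (simp only: sum_distrib_left mult.assoc)
  qed
  have E_eq: "\<theta> * (\<Sum>i<k. \<epsilon> i * ?E (\<lambda>y. displacement n k p g w y i)) = (\<Sum>u\<in>?B. ?E (W u))"
  proof -
    have "(\<Sum>u\<in>?B. ?E (W u)) = ?E (\<lambda>y. \<Sum>u\<in>?B. W u y)"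
      using fin by (subst Bochner_Integration.integral_sum) auto
    also have "\<dots> = ?E (\<lambda>y. \<theta> * (\<Sum>i<k. \<epsilon> i * displacement n k p g w y i))" by (simp only: sum_eq)
    also have "\<dots> = \<theta> * (\<Sum>i<k. \<epsilon> i * ?E (\<lambda>y. displacement n k p g w y i))"
      using fin by (simp add: Bochner_Integration.integral_sum)
    finally show ?thesis by simp
  qed
  have X_eq: "\<rho> * \<theta> * (\<Sum>i<k. \<epsilon> i * (displacement n k p g w y i - ?E (\<lambda>y. displacement n k p g w y i)))
      = (\<Sum>u\<in>?B. \<rho> * (W u y - ?E (W u)))" for y
  proof -
    have "(\<Sum>u\<in>?B. \<rho> * (W u y - ?E (W u))) = \<rho> * ((\<Sum>u\<in>?B. W u y) - (\<Sum>u\<in>?B. ?E (W u)))"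
      by (simp only: sum_distrib_left[symmetric] sum_subtractf)
    also have "\<dots> = \<rho> * (\<theta> * ((\<Sum>i<k. \<epsilon> i * displacement n k p g w y i) - (\<Sum>i<k. \<epsilon> i * ?E (\<lambda>y. displacement n k p g w y i))))"
      unfolding sum_eq[symmetric] E_eq[symmetric] by (simp only: right_diff_distrib)
    also have "(\<Sum>i<k. \<epsilon> i * displacement n k p g w y i) - (\<Sum>i<k. \<epsilon> i * ?E (\<lambda>y. displacement n k p g w y i))
      = (\<Sum>i<k. \<epsilon> i * (displacement n k p g w y i - ?E (\<lambda>y. displacement n k p g w y i)))"
      by (simp only: sum_subtractf[symmetric] right_diff_distrib)
    finally show ?thesis by (simp only: mult.assoc)
  qed
  have mgf: "?E (\<lambda>y. exp (\<rho> * (W u y - ?E (W u)))) \<le> exp (48 * \<rho>\<^sup>2)" if u: "u \<in> ?B" for u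
  proof (rule mgf_dominated[OF fin _ \<rho>])
    show "\<bar>W u y\<bar> \<le> \<bar>\<theta> * row_sum k p \<epsilon> y u\<bar>" for y
      unfolding W_def abs_mult[of "\<theta> * row_sum k p \<epsilon> y u"]
      using incl_prob_bounds[of k p g w y u] by (intro mult_left_le) auto
    have le: "exp ((\<theta>\<^sup>2) * (real k * p)) \<le> exp 1" using \<theta>(3) by simp
    show "?E (\<lambda>y. exp (\<theta> * row_sum k p \<epsilon> y u)) \<le> exp 1"
      using u p \<theta> \<epsilon> by (intro order_trans[OF mgf_row_sum le]) auto
    have "?E (\<lambda>y. exp (- \<theta> * row_sum k p \<epsilon> y u)) \<le> exp ((- \<theta>)\<^sup>2 * (real k * p))"
      using u p \<theta> \<epsilon> by (intro mgf_row_sum) auto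
    hence "?E (\<lambda>y. exp (- (\<theta> * row_sum k p \<epsilon> y u))) \<le> exp (\<theta>\<^sup>2 * (real k * p))" by simp
    thus "?E (\<lambda>y. exp (- (\<theta> * row_sum k p \<epsilon> y u))) \<le> exp 1" using le by (rule order_trans)
  qed
  have dep: "depends_on (spokes k u) (\<lambda>y. exp (\<rho> * (W u y - ?E (W u))))" for u
    unfolding W_def by (rule depends_onI) (simp add: row_sum_def incl_prob_def)
  have "graph_prob n p {y. t \<le> (\<Sum>i<k. \<epsilon> i * (displacement n k p g w y i - ?E (\<lambda>y. displacement n k p g w y i)))}
     \<le> graph_prob n p {y. \<rho> * \<theta> * t \<le> (\<Sum>u\<in>?B. \<rho> * (W u y - ?E (W u)))}"
    unfolding X_eq[symmetric] using \<rho> \<theta>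
    by (intro measure_pmf.finite_measure_mono) (auto intro!: mult_left_mono)
  also have "\<dots> \<le> exp (- (\<rho> * \<theta> * t)) * ?E (\<lambda>y. exp (\<Sum>u\<in>?B. \<rho> * (W u y - ?E (W u))))"
    by (rule prob_markov_exp[OF fin])
  also have "?E (\<lambda>y. exp (\<Sum>u\<in>?B. \<rho> * (W u y - ?E (W u)))) = ?E (\<lambda>y. \<Prod>u\<in>?B. exp (\<rho> * (W u y - ?E (W u))))"
    by (simp only: exp_sum finite_atLeastLessThan)
  also have "\<dots> = (\<Prod>u\<in>?B. ?E (\<lambda>y. exp (\<rho> * (W u y - ?E (W u)))))"
  proof (rule coins_indep_prod[OF fin, where J = "spokes k"])
    show "disjoint_family_on (spokes k) ?B" by (rule disjoint_stars) auto
    show "spokes k u \<subseteq> all_edges {..<n}" if "u \<in> ?B" for u using that by (intro spokes_subset) auto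
  qed (auto intro: dep)
  also have "\<dots> \<le> (\<Prod>u\<in>?B. exp (48 * \<rho>\<^sup>2))" by (intro prod_mono conjI mgf) auto
  also have "\<dots> = exp (real (n - k) * (48 * \<rho>\<^sup>2))" by (simp add: exp_of_nat_mult)
  also have "\<dots> \<le> exp (real n * (48 * \<rho>\<^sup>2))" by (simp add: mult_right_mono)
  also have "exp (- (\<rho> * \<theta> * t)) * exp (real n * (48 * \<rho>\<^sup>2)) = exp (48 * real n * \<rho>\<^sup>2 - \<rho> * \<theta> * t)"
    unfolding exp_add[symmetric] by (rule arg_cong[where f=exp]) simp
  finally show ?thesis by simp
qed

text \<open>An \<open>\<ell>\<^sub>1\<close> norm is the maximum over the \<open>2\<^sup>k\<close> sign vectors. This is cheap, as the exponent
  available is a large multiple of \<open>k\<close>.\<close>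
lemma prob_displacement_l1:
  fixes p \<theta> \<rho> t :: real
  assumes p: "0 \<le> p" "p \<le> 1" and \<theta>: "0 \<le> \<theta>" "\<theta> \<le> 1" "\<theta>\<^sup>2 * (real k * p) \<le> 1"
    and \<rho>: "0 \<le> \<rho>" "\<rho> \<le> 1 / 2"
  shows "graph_prob n p {y. t \<le> (\<Sum>i<k. \<bar>displacement n k p g w y i
      - measure_pmf.expectation (edge_coins n p) (\<lambda>y. displacement n k p g w y i)\<bar>)}
    \<le> 2 ^ k * exp (48 * real n * \<rho>\<^sup>2 - \<rho> * \<theta> * t)"
proof -
  define Y where "Y = (\<lambda>y i. displacement n k p g w y i
      - measure_pmf.expectation (edge_coins n p) (\<lambda>y. displacement n k p g w y i))"
  define I :: "(nat \<Rightarrow> real) set" where "I = {..<k} \<rightarrow>\<^sub>E {- 1, 1}"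
  define ex where "ex = (\<lambda>(\<epsilon> :: nat \<Rightarrow> real) i. if i < k then \<epsilon> i else 0)"
  have ex1: "\<bar>ex \<epsilon> i\<bar> \<le> 1" if "\<epsilon> \<in> I" for \<epsilon> i
  proof (cases "i < k")
    case True
    hence "\<epsilon> i \<in> {- 1, 1}" using PiE_mem[of \<epsilon> "{..<k}" "\<lambda>_. {- 1, 1}" i] that unfolding I_def by simp
    thus ?thesis using True by (auto simp: ex_def)
  qed (simp add: ex_def)
  have fI: "finite I" unfolding I_def by (intro finite_PiE) auto
  have cI: "card I = 2 ^ k" unfolding I_def by (simp add: card_PiE numeral_2_eq_2)
  have "graph_prob n p {y. t \<le> (\<Sum>i<k. \<bar>Y y i\<bar>)}
    \<le> graph_prob n p {y. \<exists>\<epsilon>\<in>I. t \<le> (\<Sum>i<k. ex \<epsilon> i * Y y i)}"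
  proof (intro measure_pmf.finite_measure_mono subsetI CollectI)
    fix y assume y: "y \<in> {y. t \<le> (\<Sum>i<k. \<bar>Y y i\<bar>)}"
    define \<epsilon> where "\<epsilon> = (\<lambda>i\<in>{..<k}. if 0 \<le> Y y i then 1 else (- 1 :: real))"
    have "\<epsilon> \<in> I" unfolding I_def \<epsilon>_def by auto
    moreover have "(\<Sum>i<k. \<bar>Y y i\<bar>) = (\<Sum>i<k. ex \<epsilon> i * Y y i)"
      by (rule sum.cong) (auto simp: ex_def \<epsilon>_def)
    ultimately show "\<exists>\<epsilon>\<in>I. t \<le> (\<Sum>i<k. ex \<epsilon> i * Y y i)" using y by auto
  qed simp
  also have "\<dots> \<le> real (card I) * exp (48 * real n * \<rho>\<^sup>2 - \<rho> * \<theta> * t)"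
    unfolding Y_def using ex1 by (intro prob_union_bound_card[OF fI] prob_displacement_signed p \<theta> \<rho>) auto
  finally show ?thesis using cI by (simp add: Y_def)
qed

lemma displacement_drift:
  fixes p \<theta> :: real
  assumes p: "0 \<le> p" "p \<le> 1 / 2" and ij: "i < j" "j < k" and kM: "k + M \<le> n"
    and \<theta>: "0 \<le> \<theta>" "\<theta> \<le> 1" "\<theta>\<^sup>2 * (real k * p) \<le> 1"
    and w: "w = (\<lambda>i. min 1 (real i / real k))" and g: "g = (\<lambda>u. if u < k + M then \<theta> / 16 else 0)"
  shows "3 / 128 * real M * p * \<theta> * (real (j - i) / real k)
    \<le> measure_pmf.expectation (edge_coins n p) (\<lambda>y. displacement n k p g w y j)
      - measure_pmf.expectation (edge_coins n p) (\<lambda>y. displacement n k p g w y i)"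
proof -
  let ?E = "measure_pmf.expectation (edge_coins n p)"
  have fin: "finite (all_edges {..<n})" by simp
  have w01: "0 \<le> w l \<and> w l \<le> 1" for l by (simp add: w)
  have wd: "w j - w i = real (j - i) / real k"
    using ij by (simp add: w min_def of_nat_diff diff_divide_distrib)
  have "0 \<le> real (j - i) / real k" by simp
  hence wle: "w i \<le> w j" using wd by linarith
  have "3 / 128 * real M * p * \<theta> * (real (j - i) / real k) = (\<Sum>u\<in>{k..<k + M}. 3 / 8 * p * (\<theta> / 16) * (w j - w i))"
    by (simp add: wd)
  also have "\<dots> = (\<Sum>u\<in>{k..<k + M}. 3 / 8 * p * g u * (w j - w i))" by (rule sum.cong) (auto simp: g)
  also have "\<dots> = (\<Sum>u\<in>{k..<n}. 3 / 8 * p * g u * (w j - w i))"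
    using kM by (intro sum.mono_neutral_left) (auto simp: g)
  also have "\<dots> \<le> (\<Sum>u\<in>{k..<n}. ?E (\<lambda>y. (of_bool (y {u, j}) - of_bool (y {u, i})) * incl_prob k p g w y u))"
    using p ij w01 wle \<theta> by (intro sum_mono expectation_swap_gap) (auto simp: g)
  also have "\<dots> = ?E (\<lambda>y. \<Sum>u\<in>{k..<n}. (of_bool (y {u, j}) - of_bool (y {u, i})) * incl_prob k p g w y u)"
    using fin by (subst Bochner_Integration.integral_sum) auto
  also have "\<dots> = ?E (\<lambda>y. displacement n k p g w y j - displacement n k p g w y i)"
    unfolding displacement_def sum_subtractf[symmetric] by (simp add: algebra_simps)
  also have "\<dots> = ?E (\<lambda>y. displacement n k p g w y j) - ?E (\<lambda>y. displacement n k p g w y i)"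
    using fin by simp
  finally show ?thesis .
qed

lemma distinct_degrees_ge_separated:
  assumes k: "k \<le> n" and T: "T \<subseteq> {k..<n}"
  shows "card ((\<lambda>i. card {l\<in>{..<k}. {l, i} \<in> graph n y} + card ({u\<in>{k..<n}. y {u, i}} \<inter> T)) ` {..<k})
    \<le> graph_degrees n y"
proof -
  define S where "S = {..<k} \<union> T"
  have SV: "S \<subseteq> {..<n}" using k T unfolding S_def by auto
  have fT: "finite T" using T finite_subset by blast
  have deg: "degree (induced_edges (graph n y) S) i
      = card {l\<in>{..<k}. {l, i} \<in> graph n y} + card ({u\<in>{k..<n}. y {u, i}} \<inter> T)" if i: "i \<in> {..<k}" for i
  proof -
    have mem: "{u, i} \<in> graph n y \<longleftrightarrow> y {u, i}" if "u \<in> T" for u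
      using that i T k by (auto simp: graph_iff)
    have "{u\<in>S. {u, i} \<in> graph n y} = {l\<in>{..<k}. {l, i} \<in> graph n y} \<union> ({u\<in>{k..<n}. y {u, i}} \<inter> T)"
      using mem T unfolding S_def by blast
    moreover have "{l\<in>{..<k}. {l, i} \<in> graph n y} \<inter> ({u\<in>{k..<n}. y {u, i}} \<inter> T) = {}" by auto
    ultimately have "card {u\<in>S. {u, i} \<in> graph n y}
      = card {l\<in>{..<k}. {l, i} \<in> graph n y} + card ({u\<in>{k..<n}. y {u, i}} \<inter> T)"
      using fT by (simp add: card_Un_disjoint)
    thus ?thesis using degree_induced[OF graph_subset, of i S n y] i by (simp add: S_def)
  qed
  have "(\<lambda>i. card {l\<in>{..<k}. {l, i} \<in> graph n y} + card ({u\<in>{k..<n}. y {u, i}} \<inter> T)) ` {..<k}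
      = degree (induced_edges (graph n y) S) ` {..<k}"
    by (intro image_cong refl) (simp add: deg)
  also have "card \<dots> \<le> card (degree (induced_edges (graph n y) S) ` S)"
    using fT by (intro card_mono) (auto simp: S_def)
  also have "\<dots> \<le> graph_degrees n y" by (rule distinct_degrees_ge[OF _ SV]) simp
  finally show ?thesis by simp
qed

lemma prob_inner_degree:
  fixes p \<theta> t :: real
  assumes p: "0 \<le> p" "p \<le> 1" and \<theta>: "0 \<le> \<theta>" "\<theta> \<le> 1" "\<theta>\<^sup>2 * (real k * p) \<le> 1" and i: "i < k" "k \<le> n"
  shows "graph_prob n p {y. t \<le> \<bar>real (card {l\<in>{..<k}. {l, i} \<in> graph n y}) - p * real (k - 1)\<bar>}
    \<le> 2 * exp (1 - \<theta> * t)"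
proof -
  let ?L = "{..<k} - {i}"
  let ?F = "(\<lambda>l. {l, i}) ` ?L"
  have inj: "inj_on (\<lambda>l. {l, i}) ?L" by (rule inj_onI) (auto simp: doubleton_eq_iff)
  have cL: "card ?L = k - 1" using i by simp
  have eq: "real (card {l\<in>{..<k}. {l, i} \<in> graph n y}) - p * real (k - 1) = (\<Sum>e\<in>?F. 1 * (of_bool (y e) - p))" for y
  proof -
    have "{l\<in>{..<k}. {l, i} \<in> graph n y} = ?L \<inter> {l. y {l, i}}" using i by (auto simp: graph_iff)
    hence "real (card {l\<in>{..<k}. {l, i} \<in> graph n y}) = (\<Sum>l\<in>?L. of_bool (y {l, i}))" by simp
    thus ?thesis using cL by (simp add: sum.reindex[OF inj] card_image[OF inj] sum_subtractf mult.commute del: sum_of_bool_eq)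
  qed
  have "graph_prob n p {y. t \<le> \<bar>real (card {l\<in>{..<k}. {l, i} \<in> graph n y}) - p * real (k - 1)\<bar>}
     \<le> 2 * exp (\<theta>\<^sup>2 * (real k * p) - \<theta> * t)"
    unfolding eq
  proof (rule tail_linear_abs)
    show "?F \<subseteq> all_edges {..<n}" using i by (auto simp: all_edges_iff)
    have "(\<Sum>e\<in>?F. p * 1\<^sup>2) = real (k - 1) * p" using cL by (simp add: card_image[OF inj])
    also have "\<dots> \<le> real k * p" using p by (intro mult_right_mono) auto
    finally show "(\<Sum>e\<in>?F. p * 1\<^sup>2) \<le> real k * p" .
  qed (use p \<theta> in auto)
  also have "\<dots> \<le> 2 * exp (1 - \<theta> * t)" using \<theta> by simp
  finally show ?thesis .
qed

text \<open>With \<open>\<kappa> = (p n\<^sup>2)\<^bsup>1/3\<^esup>\<close> and \<open>s = \<surd>(np)\<close> the parameters satisfy \<open>n p \<theta> = \<kappa>\<close> and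
  \<open>\<rho> \<theta> s = 10\<^sup>-\<^sup>7\<close>. The first identity makes the slope
  \<open>\<kappa> / (128 k) \<ge> 10\<^bsup>14\<^esup> / 128\<close>, the second makes the average error about
  \<open>98 \<cdot> 10\<^sup>7 s\<close>. Shrinking \<open>k\<close> by a factor \<open>c\<close> thus raises the slope by \<open>1/c\<close> but the error
  only by \<open>1/\<surd>c\<close>, and \<open>c = 10\<^bsup>-14\<^esup>\<close> is small enough for \<open>random_rounding_separates\<close>.\<close>
lemma prob_few_degrees_cube_root:
  fixes p \<kappa> :: real
  assumes p: "0 < p" "p \<le> 1 / 2" and \<kappa>: "0 < \<kappa>" "\<kappa> ^ 3 = p * real n ^ 2" "1 \<le> p * \<kappa>" "\<kappa> \<le> real n / 4"
    and k: "0 < k" "real k \<le> \<kappa> / 10 ^ 14" "\<kappa> / 10 ^ 14 \<le> 2 * real k"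
  shows "graph_prob n p {y. real (graph_degrees n y) < real k / 2}
    \<le> exp (- real k) + 2 * real n * exp (1 - sqrt (real n / \<kappa>)) + real n * exp (- (real n * p))
      + real n ^ 2 * exp (- (real n * p) / 80)"
proof -
  define \<theta> where "\<theta> = 1 / sqrt (p * \<kappa>)"
  define s where "s = sqrt (real n * p)"
  define M where "M = n div 2"
  \<comment> \<open>The minimum only matters for \<open>i > k\<close>; it makes the weights bounded by \<open>1\<close> without a side condition.\<close>
  define w where "w = (\<lambda>i. min 1 (real i / real k))"
  define g where "g = (\<lambda>u. if u < k + M then \<theta> / 16 else 0)"
  define B B2 where "B = {k..<n}" and "B2 = {k + M..<n}"
  define \<mu> where "\<mu> = (\<lambda>i. measure_pmf.expectation (edge_coins n p) (\<lambda>y. displacement n k p g w y i))"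
  define N where "N = (\<lambda>y i. {u\<in>B. y {u, i :: nat}})"
  define d where "d = (\<lambda>y i. card {l\<in>{..<k}. {l, i} \<in> graph n y})"
  have "\<kappa> / 10 ^ 14 \<le> \<kappa> / 100" using \<kappa>(1) by (intro divide_left_mono) auto
  hence k100: "real k \<le> \<kappa> / 100" using k(2) by (rule order_trans[rotated])
  have k\<kappa>: "real k \<le> \<kappa>" using k100 \<kappa>(1) by linarith
  have k4: "real k \<le> real n / 400" using k100 \<kappa>(4) by linarith
  have n: "400 \<le> real n" using k4 k(1) by linarith
  have kM: "k + M \<le> n" using k4 unfolding M_def by linarith
  have cM: "real n / 3 \<le> real M" using n unfolding M_def by linarith
  have cB2: "real n / 4 \<le> real (card B2)" using k4 kM n unfolding B2_def M_def by simp
  have kn: "k \<le> n" using kM by simp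
  have p01: "0 \<le> p" "p \<le> 1" using p by auto
  have np: "1 \<le> real n * p"
  proof -
    have "1 \<le> p * \<kappa>" by (rule \<kappa>(3))
    also have "\<dots> \<le> p * real n" using \<kappa> p by (intro mult_left_mono) auto
    finally show ?thesis by (simp add: mult.commute)
  qed
  have s: "1 \<le> s" "s\<^sup>2 = real n * p" using np by (auto simp: s_def)
  have \<theta>pos: "0 < \<theta>" using p \<kappa> by (simp add: \<theta>_def)
  have \<theta>2: "\<theta>\<^sup>2 * (p * \<kappa>) = 1" using p \<kappa> by (simp add: \<theta>_def power_divide)
  have \<theta>: "0 \<le> \<theta>" "\<theta> \<le> 1" "\<theta>\<^sup>2 * (real k * p) \<le> 1"
  proof -
    show "0 \<le> \<theta>" using \<theta>pos by simp
    show "\<theta> \<le> 1" unfolding \<theta>_def using \<kappa>(3) by simp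
    have "\<theta>\<^sup>2 * (real k * p) \<le> \<theta>\<^sup>2 * (p * \<kappa>)" using k\<kappa> p by (intro mult_left_mono) (auto simp: mult.commute)
    thus "\<theta>\<^sup>2 * (real k * p) \<le> 1" using \<theta>2 by simp
  qed
  have \<theta>s: "\<theta> * s = sqrt (real n / \<kappa>)"
    using p unfolding \<theta>_def s_def by (simp add: real_sqrt_mult real_sqrt_divide)
  have \<theta>n: "real n * p * \<theta> = \<kappa>"
  proof (rule power2_eq_imp_eq)
    have "(real n * p * \<theta>)\<^sup>2 * (p * \<kappa>) = real n ^ 2 * p ^ 2 * (\<theta>\<^sup>2 * (p * \<kappa>))" by (simp add: power_mult_distrib)
    also have "\<dots> = p * (p * real n ^ 2)" unfolding \<theta>2 by (simp add: power2_eq_square)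
    also have "\<dots> = \<kappa>\<^sup>2 * (p * \<kappa>)" unfolding \<kappa>(2)[symmetric] by (simp add: power2_eq_square power3_eq_cube)
    finally show "(real n * p * \<theta>)\<^sup>2 = \<kappa>\<^sup>2" using p \<kappa> by simp
  qed (use p \<theta> \<kappa> in auto)
  define \<rho> where "\<rho> = sqrt (\<kappa> / real n) / 10 ^ 7"
  have \<rho>: "0 \<le> \<rho>" "\<rho> \<le> 1 / 2"
  proof -
    have "sqrt (\<kappa> / real n) \<le> sqrt 1" using \<kappa> n by (intro real_sqrt_le_mono) (simp add: field_simps)
    hence "sqrt (\<kappa> / real n) / 10 ^ 7 \<le> 1 / 10 ^ 7" unfolding real_sqrt_one by (rule divide_right_mono) simp
    also have "1 / 10 ^ 7 \<le> (1 / 2 :: real)" by simp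
    finally show "\<rho> \<le> 1 / 2" unfolding \<rho>_def .
  qed (use \<kappa> in \<open>simp add: \<rho>_def\<close>)
  have \<rho>2: "real n * \<rho>\<^sup>2 = \<kappa> / 10 ^ 14" using \<kappa> n by (simp add: \<rho>_def power_divide)
  have \<rho>\<theta>s: "\<rho> * \<theta> * s = 1 / 10 ^ 7"
  proof -
    have "\<rho> * \<theta> * s = \<rho> * sqrt (real n / \<kappa>)" using \<theta>s by (simp add: mult.assoc)
    also have "\<dots> = (sqrt (\<kappa> / real n) * sqrt (real n / \<kappa>)) / 10 ^ 7" by (simp add: \<rho>_def)
    also have "sqrt (\<kappa> / real n) * sqrt (real n / \<kappa>) = 1" using \<kappa> n by (simp add: real_sqrt_divide)
    finally show ?thesis .
  qed
  define t where "t = 98 * 10 ^ 7 * real k * s"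
  define C where "C = 98 * 10 ^ 7 + (1 :: real)"
  define K where "K = (10 ^ 14 / 128 :: real)"
  \<comment> \<open>Exceptional graphs: bad average displacement; a bad degree inside \<open>{..<k}\<close>; too large a degree;
    a pair of vertices whose neighbourhoods differ too little in \<open>B2\<close>.\<close>
  define E1 where "E1 = {y. t \<le> (\<Sum>i<k. \<bar>displacement n k p g w y i - \<mu> i\<bar>)}"
  define E2 where "E2 = {y. \<exists>i\<in>{..<k}. s \<le> \<bar>real (d y i) - p * real (k - 1)\<bar>}"
  define E3 where "E3 = {y. 3 * (real n * p) \<le> real (max_degree {..<n} (graph n y))}"
  define E4 where "E4 = {y. \<exists>x\<in>{(i, j). i < k \<and> j < k \<and> i \<noteq> j}.
      real (card {u\<in>B2. y {u, fst x} \<and> (\<forall>l\<in>{fst x, snd x} - {fst x}. \<not> y {u, l})}) \<le> card B2 * (p * (1 - p) ^ (card {fst x, snd x} - 1)) / 2}"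
  have e1: "graph_prob n p E1 \<le> exp (- real k)"
  proof -
    have "graph_prob n p E1 \<le> 2 ^ k * exp (48 * real n * \<rho>\<^sup>2 - \<rho> * \<theta> * t)"
      unfolding E1_def \<mu>_def by (rule prob_displacement_l1[OF p01 \<theta> \<rho>])
    also have "\<dots> \<le> exp (real k) * exp (- 2 * real k)"
    proof (intro mult_mono)
      show "2 ^ k \<le> exp (real k)" by (rule two_power_le_exp)
      have "48 * real n * \<rho>\<^sup>2 = 48 * (\<kappa> / 10 ^ 14)" using \<rho>2 by (simp add: mult.assoc)
      moreover have "\<rho> * \<theta> * t = 98 * real k" 
      proof -
        have "\<rho> * \<theta> * t = (\<rho> * \<theta> * s) * (98 * 10 ^ 7 * real k)" unfolding t_def by (simp only: mult_ac)
        thus ?thesis unfolding \<rho>\<theta>s by simp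
      qed
      ultimately have "48 * real n * \<rho>\<^sup>2 - \<rho> * \<theta> * t \<le> - 2 * real k" using k(3) by linarith
      thus "exp (48 * real n * \<rho>\<^sup>2 - \<rho> * \<theta> * t) \<le> exp (- 2 * real k)" by (simp only: exp_le_cancel_iff)
    qed auto
    also have "\<dots> = exp (- real k)" unfolding exp_add[symmetric] by simp
    finally show ?thesis .
  qed
  have e2: "graph_prob n p E2 \<le> 2 * real n * exp (1 - sqrt (real n / \<kappa>))"
  proof -
    have "graph_prob n p E2 \<le> real (card {..<k}) * (2 * exp (1 - \<theta> * s))"
      unfolding E2_def d_def using kn by (intro prob_union_bound_card prob_inner_degree p01 \<theta>) auto
    also have "\<dots> \<le> real n * (2 * exp (1 - \<theta> * s))" using kn by (intro mult_right_mono) auto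
    finally show ?thesis unfolding \<theta>s by simp
  qed
  have e3: "graph_prob n p E3 \<le> real n * exp (- (real n * p))"
    using prob_max_degree_large[OF p01, of n "3 * (real n * p)"] n unfolding E3_def by (simp add: mult.commute)
  have e4: "graph_prob n p E4 \<le> real n ^ 2 * exp (- (real n * p) / 80)"
  proof -
    let ?I = "{(i, j). i < k \<and> j < k \<and> i \<noteq> j}"
    have sub: "?I \<subseteq> {..<k} \<times> {..<k}" by auto
    have fI: "finite ?I" by (rule finite_subset[OF sub]) simp
    have "graph_prob n p E4 \<le> real (card ?I) * exp (- (real n * p) / 80)"
      unfolding E4_def
    proof (rule prob_union_bound_card[OF fI])
      fix x assume "x \<in> ?I"
      then obtain i j where x: "x = (i, j)" "i < k" "j < k" "i \<noteq> j" by blast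
      let ?q = "p * (1 - p) ^ (card {fst x, snd x} - 1)"
      have "graph_prob n p
        {y. real (card {u\<in>B2. y {u, fst x} \<and> (\<forall>l\<in>{fst x, snd x} - {fst x}. \<not> y {u, l})}) \<le> card B2 * ?q / 2}
        \<le> exp (- (card B2 * ?q) / 10)"
        by (rule prob_private_few[OF p01]) (use x kn in \<open>auto simp: B2_def\<close>)
      also have "\<dots> \<le> exp (- (real n * p) / 80)"
      proof -
        have q: "?q = p * (1 - p)" using x by simp
        have "real n / 4 * (p * (1 / 2)) \<le> card B2 * (p * (1 - p))"
          using cB2 p by (intro mult_mono mult_left_mono) auto
        hence "- (real (card B2) * (p * (1 - p))) / 10 \<le> - (real n * p) / 80" by (simp add: mult.commute)
        thus ?thesis unfolding q by (simp only: exp_le_cancel_iff)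
      qed
      finally show "graph_prob n p
        {y. real (card {u\<in>B2. y {u, fst x} \<and> (\<forall>l\<in>{fst x, snd x} - {fst x}. \<not> y {u, l})}) \<le> card B2 * ?q / 2}
        \<le> exp (- (real n * p) / 80)" .
    qed
    also have "\<dots> \<le> real n ^ 2 * exp (- (real n * p) / 80)"
    proof (intro mult_right_mono)
      have "card ?I \<le> card ({..<k} \<times> {..<k})" by (rule card_mono[OF _ sub]) simp
      also have "\<dots> \<le> n * n" using kn by (simp add: card_cartesian_product mult_le_mono)
      finally have "real (card ?I) \<le> real (n * n)" by (rule of_nat_mono)
      thus "real (card ?I) \<le> real n ^ 2" by (simp add: power2_eq_square)
    qed simp
    finally show ?thesis .
  qed
  have good: "real k / 2 \<le> real (graph_degrees n y)"
    if y: "y \<notin> E1" "y \<notin> E2" "y \<notin> E3" "y \<notin> E4" for y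
  proof -
    define \<pi> where "\<pi> = incl_prob k p g w y"
    define m where "m = p * (\<Sum>u\<in>B. \<pi> u) + p * real (k - 1)"
    have fB: "finite B" by (simp add: B_def)
    have NB: "N y i \<subseteq> B" for i unfolding N_def by blast
    have Ndeg: "real (card (N y i)) \<le> 3 * s\<^sup>2" if i: "i < k" for i
    proof -
      have "card (N y i) = card {e\<in>(\<lambda>u. {u, i}) ` B. y e}"
        unfolding N_def by (rule card_star_image) (use i in \<open>simp add: B_def\<close>)
      also have "\<dots> \<le> degree (graph n y) i"
        unfolding degree_graph using i kn by (intro card_mono) (auto simp: B_def all_edges_iff)
      also have "\<dots> \<le> max_degree {..<n} (graph n y)" using i kn by (intro degree_le_max_degree) auto
      finally have "real (card (N y i)) \<le> real (max_degree {..<n} (graph n y))" by (rule of_nat_mono)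
      thus ?thesis using y(3) unfolding E3_def s(2) by simp
    qed
    have codiff: "s\<^sup>2 / 16 \<le> real (card (N y i \<inter> B2 - N y j))" if ij: "i < k" "j < k" "i \<noteq> j" for i j
    proof -
      have "(i, j) \<in> {(i, j). i < k \<and> j < k \<and> i \<noteq> j}" using ij by simp
      hence "\<not> real (card {u\<in>B2. y {u, i} \<and> (\<forall>l\<in>{i, j} - {i}. \<not> y {u, l})}) \<le> card B2 * (p * (1 - p) ^ (card {i, j} - 1)) / 2"
        using y(4) unfolding E4_def by fastforce
      moreover have "{i, j} - {i} = {j}" "card {i, j} - 1 = 1" using ij by auto
      moreover have "{u\<in>B2. y {u, i} \<and> (\<forall>l\<in>{j}. \<not> y {u, l})} = N y i \<inter> B2 - N y j"
        unfolding N_def B_def B2_def by auto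
      ultimately have "card B2 * (p * (1 - p)) / 2 < real (card (N y i \<inter> B2 - N y j))" by simp
      moreover have "real n / 4 * (p * (1 / 2)) \<le> card B2 * (p * (1 - p))"
        using cB2 p by (intro mult_mono mult_left_mono) auto
      ultimately show ?thesis unfolding s(2) by simp
    qed
    have spread: "K * real (j - i) \<le> \<mu> j - \<mu> i" if ij: "i < j" "j < k" for i j
    proof -
      have "K * real (j - i) * real k = real (j - i) * (10 ^ 14 * real k) / 128" by (simp add: K_def)
      also have "\<dots> \<le> real (j - i) * \<kappa> / 128" using k(2) by (intro divide_right_mono mult_left_mono) auto
      also have "\<dots> = 3 / 128 * (real n / 3) * p * \<theta> * real (j - i)"
        using \<theta>n[symmetric] by simp
      also have "\<dots> \<le> 3 / 128 * real M * p * \<theta> * real (j - i)"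
        using cM p \<theta> by (intro mult_right_mono mult_left_mono) auto
      finally have "K * real (j - i) \<le> 3 / 128 * real M * p * \<theta> * (real (j - i) / real k)"
        using k(1) by (simp add: field_simps)
      also have "\<dots> \<le> \<mu> j - \<mu> i"
        unfolding \<mu>_def using p ij kM \<theta> by (intro displacement_drift) (auto simp: w_def g_def)
      finally show ?thesis .
    qed
    have l1: "(\<Sum>i<k. \<bar>(\<Sum>u\<in>N y i. \<pi> u) + real (d y i) - m - \<mu> i\<bar>) \<le> C * real k * s"
    proof -
      have eq: "(\<Sum>u\<in>N y i. \<pi> u) + real (d y i) - m - \<mu> i
          = (displacement n k p g w y i - \<mu> i) + (real (d y i) - p * real (k - 1))" for i
      proof -
        have "(\<Sum>u\<in>N y i. \<pi> u) = (\<Sum>u\<in>B. of_bool (y {u, i}) * \<pi> u)"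
          unfolding N_def using fB by (simp only: sum.inter_filter) (intro sum.cong, auto)
        moreover have "displacement n k p g w y i = (\<Sum>u\<in>B. of_bool (y {u, i}) * \<pi> u) - p * (\<Sum>u\<in>B. \<pi> u)"
          unfolding displacement_def B_def \<pi>_def
          by (simp only: left_diff_distrib sum_subtractf sum_distrib_left)
        ultimately show ?thesis unfolding m_def by linarith
      qed
      have "(\<Sum>i<k. \<bar>(\<Sum>u\<in>N y i. \<pi> u) + real (d y i) - m - \<mu> i\<bar>)
        \<le> (\<Sum>i<k. \<bar>displacement n k p g w y i - \<mu> i\<bar> + s)"
      proof (rule sum_mono)
        fix i assume "i \<in> {..<k}"
        hence "\<not> s \<le> \<bar>real (d y i) - p * real (k - 1)\<bar>" using y(2) unfolding E2_def by blast
        thus "\<bar>(\<Sum>u\<in>N y i. \<pi> u) + real (d y i) - m - \<mu> i\<bar> \<le> \<bar>displacement n k p g w y i - \<mu> i\<bar> + s"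
          unfolding eq by linarith
      qed
      also have "\<dots> = (\<Sum>i<k. \<bar>displacement n k p g w y i - \<mu> i\<bar>) + real k * s" by (simp add: sum.distrib)
      also have "\<dots> \<le> t + real k * s" using y(1) unfolding E1_def by simp
      also have "\<dots> = C * real k * s" unfolding t_def C_def by (simp add: algebra_simps)
      finally show ?thesis .
    qed
    obtain T where T: "T \<subseteq> B" "real k / 2 \<le> real (card ((\<lambda>i. d y i + card (N y i \<inter> T)) ` {..<k}))"
    proof (rule random_rounding_separates[where B = B and ?B2.0 = B2 and k = k and s = s and C = C and K = K
          and \<pi> = \<pi> and N = "N y" and \<mu> = \<mu> and d = "d y" and m = m])
      show "B2 \<subseteq> B" by (auto simp: B_def B2_def)
      show "512 * (C + 1) \<le> K" "0 \<le> C" by (simp_all add: C_def K_def)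
      show "0 \<le> \<pi> u \<and> \<pi> u \<le> 1" for u unfolding \<pi>_def using incl_prob_bounds by blast
      show "\<pi> u = 1 / 2" if "u \<in> B2" for u
        using that unfolding \<pi>_def incl_prob_def g_def B2_def by (simp add: clamp_half_def)
    qed (use fB k s NB Ndeg codiff spread l1 in auto)
    have "card ((\<lambda>i. d y i + card (N y i \<inter> T)) ` {..<k}) \<le> graph_degrees n y"
      using distinct_degrees_ge_separated[OF kn, of T y] T(1) unfolding d_def N_def B_def by simp
    thus ?thesis using T(2) by linarith
  qed
  have "graph_prob n p {y. real (graph_degrees n y) < real k / 2}
    \<le> graph_prob n p (((E1 \<union> E2) \<union> E3) \<union> E4)"
    using good by (intro measure_pmf.finite_measure_mono) (auto simp: not_le[symmetric])
  also have "\<dots> \<le> graph_prob n p E1 + graph_prob n p E2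
      + graph_prob n p E3 + graph_prob n p E4"
    by (intro order_trans[OF measure_Un_le] add_mono measure_Un_le order_refl) auto
  finally show ?thesis using e1 e2 e3 e4 by linarith
qed

section \<open>The two regimes together\<close>

definition good_graph :: "real \<Rightarrow> nat \<Rightarrow> real \<Rightarrow> nat set set \<Rightarrow> bool" where
  "good_graph c n p E \<longleftrightarrow>
    (real n powr (- 1 / 2) \<le> p \<longrightarrow>
      c * root 3 (p * real n ^ 2) \<le> real (distinct_degrees {..<n} E) \<and>
      real (distinct_degrees {..<n} E) \<le> 16 * root 3 (p * real n ^ 2)) \<and>
    (p \<le> real n powr (- 1 / 2) \<longrightarrow>
      c * real (max_degree {..<n} E) \<le> real (distinct_degrees {..<n} E) \<and>
      real (distinct_degrees {..<n} E) \<le> 16 * real (max 1 (max_degree {..<n} E)))"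

text \<open>Cubing shows \<open>\<surd>n \<le> \<kappa> \<le> n\<^bsup>2/3\<^esup>\<close>, hence \<open>1 \<le> p \<kappa>\<close>: from the threshold \<open>n\<^bsup>-1/2\<^esup>\<close> on, a
  vertex has on average at least one neighbour among \<open>\<kappa>\<close> others, which is what gives tilting
  by neighbourhoods its effect.\<close>
lemma prob_bad_above_threshold:
  fixes p :: real
  assumes n: "10 ^ 28 \<le> real n" and p: "real n powr (- 1 / 2) \<le> p" "p \<le> 1 / 2"
  defines "\<kappa> \<equiv> root 3 (p * real n ^ 2)"
  shows "graph_prob n p {y. \<not> (1 / (4 * 10 ^ 14) * \<kappa> \<le> real (graph_degrees n y) \<and>
      real (graph_degrees n y) \<le> 16 * \<kappa>)}
    \<le> exp (- 3 * real n) + exp (- sqrt (real n) / (2 * 10 ^ 14)) + 2 * real n * exp (1 - real n powr (1 / 6))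
      + real n * exp (- sqrt (real n)) + real n ^ 2 * exp (- sqrt (real n) / 80)"
proof -
  have "(0 :: real) < 10 ^ 28" by simp
  hence n0: "0 < real n" using n by (rule less_le_trans)
  have ps: "1 / sqrt (real n) \<le> p"
    using p(1) n0 by (simp add: powr_minus powr_half_sqrt inverse_eq_divide)
  have p0: "0 < p" using ps n0 by (intro less_le_trans[OF _ ps]) simp
  have \<kappa>3: "\<kappa> ^ 3 = p * real n ^ 2" unfolding \<kappa>_def using p0 by (simp add: odd_real_root_pow)
  have \<kappa>0: "0 < \<kappa>" unfolding \<kappa>_def using p0 n0 by simp
  have np: "sqrt (real n) \<le> real n * p"
  proof -
    have "sqrt (real n) = real n * (1 / sqrt (real n))" using n0 by (simp add: real_div_sqrt)
    also have "\<dots> \<le> real n * p" using ps n0 by (intro mult_left_mono) auto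
    finally show ?thesis .
  qed
  have \<kappa>s: "sqrt (real n) \<le> \<kappa>"
  proof (rule power_le_imp_le_base[of _ 2])
    have "sqrt (real n) ^ Suc 2 = sqrt (real n) * real n" unfolding power_Suc[of _ 2] by simp
    also have "\<dots> \<le> (real n * p) * real n" using np n0 by (intro mult_right_mono) auto
    also have "\<dots> = \<kappa> ^ Suc 2" using \<kappa>3 by (simp add: power2_eq_square power3_eq_cube)
    finally show "sqrt (real n) ^ Suc 2 \<le> \<kappa> ^ Suc 2" .
  qed (use \<kappa>0 in simp)
  have n\<kappa>2: "real n \<le> \<kappa>\<^sup>2" using power_mono[OF \<kappa>s, of 2] n0 by simp
  have \<kappa>upper: "\<kappa> \<le> real n powr (2 / 3)"
  proof (rule power_le_imp_le_base[of _ 2])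
    have "\<kappa> ^ Suc 2 \<le> 1 * real n ^ 2" using \<kappa>3 p n0 by (simp add: numeral_3_eq_3[symmetric] mult_right_mono)
    also have "\<dots> = (real n powr (2 / 3)) ^ Suc 2" using n0 by (simp add: powr_power)
    finally show "\<kappa> ^ Suc 2 \<le> (real n powr (2 / 3)) ^ Suc 2" .
  qed simp
  have \<kappa>4: "\<kappa> \<le> real n / 4"
  proof (rule power_le_imp_le_base[of _ 2])
    have "\<kappa> ^ Suc 2 \<le> 1 * real n ^ 2" using \<kappa>3 p n0 by (simp add: numeral_3_eq_3[symmetric] mult_right_mono)
    also have "\<dots> \<le> (real n / 64) * real n ^ 2" using n by (intro mult_right_mono) auto
    also have "\<dots> = (real n / 4) ^ Suc 2" by (simp add: power2_eq_square power3_eq_cube)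
    finally show "\<kappa> ^ Suc 2 \<le> (real n / 4) ^ Suc 2" .
  qed (use n0 in simp)
  have p\<kappa>: "1 \<le> p * \<kappa>"
  proof -
    have "1 = 1 / sqrt (real n) * sqrt (real n)" using n0 by simp
    also have "\<dots> \<le> p * \<kappa>" using ps \<kappa>s n0 p0 by (intro mult_mono) auto
    finally show ?thesis .
  qed
  have \<kappa>14: "10 ^ 14 \<le> \<kappa>"
  proof -
    have "10 ^ 14 = sqrt ((10 ^ 14) ^ 2)" by simp
    also have "\<dots> \<le> sqrt (real n)" using n by (intro real_sqrt_le_mono) simp
    finally show ?thesis using \<kappa>s by linarith
  qed
  define k where "k = nat \<lfloor>\<kappa> / 10 ^ 14\<rfloor>"
  have k: "0 < k" "real k \<le> \<kappa> / 10 ^ 14" "\<kappa> / 10 ^ 14 \<le> 2 * real k"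
  proof -
    have 1: "1 \<le> \<kappa> / 10 ^ 14" using \<kappa>14 by simp
    hence "1 \<le> \<lfloor>\<kappa> / 10 ^ 14\<rfloor>" by simp
    thus "0 < k" "real k \<le> \<kappa> / 10 ^ 14" "\<kappa> / 10 ^ 14 \<le> 2 * real k" unfolding k_def by linarith+
  qed
  define m where "m = nat \<lceil>3 * \<kappa>\<rceil>"
  have m: "3 * \<kappa> \<le> real m" "real m \<le> 3 * \<kappa> + 1" using \<kappa>0 unfolding m_def by linarith+
  define Up Low where "Up = {y. 4 * m \<le> graph_degrees n y}"
    and "Low = {y. real (graph_degrees n y) < real k / 2}"
  have up: "graph_prob n p Up \<le> exp (- 3 * real n)"
    unfolding Up_def using n0 p0 p \<kappa>0 \<kappa>3 n\<kappa>2 m(1) by (intro prob_many_degrees) auto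
  have "graph_prob n p Low \<le> exp (- real k) + 2 * real n * exp (1 - sqrt (real n / \<kappa>))
      + real n * exp (- (real n * p)) + real n ^ 2 * exp (- (real n * p) / 80)"
    unfolding Low_def by (rule prob_few_degrees_cube_root[OF p0 p(2) \<kappa>0 \<kappa>3 p\<kappa> \<kappa>4 k])
  also have "\<dots> \<le> exp (- sqrt (real n) / (2 * 10 ^ 14)) + 2 * real n * exp (1 - real n powr (1 / 6))
      + real n * exp (- sqrt (real n)) + real n ^ 2 * exp (- sqrt (real n) / 80)"
  proof (intro add_mono mult_left_mono)
    have "sqrt (real n) / 10 ^ 14 \<le> \<kappa> / 10 ^ 14" using \<kappa>s by (intro divide_right_mono) auto
    thus "exp (- real k) \<le> exp (- sqrt (real n) / (2 * 10 ^ 14))" using k(3) by simp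
    have "real n powr (1 / 6) = sqrt (real n powr (1 / 3))" using n0 by (simp add: powr_half_sqrt[symmetric] powr_powr)
    also have "real n powr (1 / 3) = real n / real n powr (2 / 3)"
      using n0 powr_diff[of "real n" 1 "2 / 3"] by simp
    also have "\<dots> \<le> real n / \<kappa>" using \<kappa>upper \<kappa>0 n0 by (intro divide_left_mono) auto
    finally show "exp (1 - sqrt (real n / \<kappa>)) \<le> exp (1 - real n powr (1 / 6))" by simp
    show "exp (- (real n * p)) \<le> exp (- sqrt (real n))" using np by simp
    show "exp (- (real n * p) / 80) \<le> exp (- sqrt (real n) / 80)" using np by simp
  qed auto
  finally have low: "graph_prob n p Low \<le> exp (- sqrt (real n) / (2 * 10 ^ 14))
      + 2 * real n * exp (1 - real n powr (1 / 6))
      + real n * exp (- sqrt (real n)) + real n ^ 2 * exp (- sqrt (real n) / 80)" .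
  have "graph_prob n p {y. \<not> (1 / (4 * 10 ^ 14) * \<kappa> \<le> real (graph_degrees n y) \<and>
      real (graph_degrees n y) \<le> 16 * \<kappa>)} \<le> graph_prob n p (Up \<union> Low)"
  proof (intro measure_pmf.finite_measure_mono subsetI)
    fix y assume bad: "y \<in> {y. \<not> (1 / (4 * 10 ^ 14) * \<kappa> \<le> real (graph_degrees n y) \<and>
      real (graph_degrees n y) \<le> 16 * \<kappa>)}"
    show "y \<in> Up \<union> Low"
    proof (rule ccontr)
      assume "y \<notin> Up \<union> Low"
      hence y: "graph_degrees n y < 4 * m" "real k / 2 \<le> real (graph_degrees n y)"
        by (auto simp: Up_def Low_def)
      have "real (graph_degrees n y) \<le> real (4 * m)" using y(1) by (intro of_nat_mono) simp
      also have "\<dots> \<le> 16 * \<kappa>" using m(2) \<kappa>14 by simp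
      finally have "real (graph_degrees n y) \<le> 16 * \<kappa>" .
      moreover have "1 / (4 * 10 ^ 14) * \<kappa> \<le> real k / 2" using k(3) by simp
      ultimately show False using bad y(2) by simp
    qed
  qed simp
  also have "\<dots> \<le> graph_prob n p Up + graph_prob n p Low"
    by (rule measure_Un_le) auto
  finally show ?thesis using up low by linarith
qed

lemma prob_bad_below_threshold:
  fixes p L :: real
  assumes n: "1 < n" and L: "L = ln (real n)" "160 \<le> L" and p: "0 \<le> p" "p \<le> 1 / 2" "p \<le> real n powr (- 1 / 2)"
    and large: "2 * L + 1 \<le> real n / 2" "2 * L + 1 \<le> exp (3/5 * L) / 6"
  shows "graph_prob n p
      {y. \<not> 1 / (4 * 10 ^ 14) * real (max_degree {..<n} (graph n y)) \<le> real (graph_degrees n y)}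
    \<le> (80 * exp (- L / 800) + exp (- L / 10)) + (1 / real n + (L / 10) ^ 6 / real n + exp (- exp (3/5 * L) / 30))"
    (is "?P \<le> ?e1 + ?e2")
proof -
  have n0: "0 < real n" using n by simp
  have e1: "0 \<le> ?e1" and e2: "0 \<le> ?e2" using n0 L by (auto intro!: add_nonneg_nonneg)
  show ?thesis
  proof (cases "real n * p \<le> L / 10")
    case True
    have "?P \<le> graph_prob n p {y. \<not> max_degree {..<n} (graph n y) \<le> 120 * graph_degrees n y}"
    proof (intro measure_pmf.finite_measure_mono subsetI CollectI notI)
      fix y assume y: "y \<in> {y. \<not> 1 / (4 * 10 ^ 14) * real (max_degree {..<n} (graph n y)) \<le> real (graph_degrees n y)}"
        and "max_degree {..<n} (graph n y) \<le> 120 * graph_degrees n y"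
      hence "real (max_degree {..<n} (graph n y)) \<le> real (120 * graph_degrees n y)" by (intro of_nat_mono)
      thus False using y by simp
    qed simp
    also have "\<dots> \<le> 1 / real n + real n ^ 5 * p ^ 6 + exp (- exp (3/5 * L) / 30)"
      by (rule prob_few_degrees_sparse[OF n L(1) p(1,2) True large])
    also have "real n ^ 5 * p ^ 6 = (real n * p) ^ 6 / real n"
      using n0 by (simp add: power_mult_distrib eval_nat_numeral)
    also have "1 / real n + (real n * p) ^ 6 / real n + exp (- exp (3/5 * L) / 30) \<le> ?e2"
      using True p n0 by (intro add_mono divide_right_mono power_mono) auto
    finally show ?thesis using e1 by linarith
  next
    case False
    define x where "x = real n * p"
    have x: "L / 10 < x" "16 \<le> x" using False L unfolding x_def by linarith+
    have sq: "real n * p\<^sup>2 \<le> 1"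
    proof -
      have "p \<le> 1 / sqrt (real n)" using p(3) n0 by (simp add: powr_minus powr_half_sqrt inverse_eq_divide)
      hence "p\<^sup>2 \<le> (1 / sqrt (real n))\<^sup>2" using p by (intro power_mono) auto
      thus ?thesis using n0 by (simp add: power_divide field_simps)
    qed
    define Few Big where "Few = {y. graph_degrees n y < nat \<lfloor>real n * p / 16\<rfloor>}"
      and "Big = {y. 13 * x \<le> real (max_degree {..<n} (graph n y))}"
    have "graph_prob n p Few \<le> x * exp (- x / 40)"
      unfolding Few_def x_def by (rule prob_few_degrees_dense) (use n p sq in auto)
    also have "\<dots> \<le> (80 * exp (x / 80)) * exp (- x / 40)"
    proof (intro mult_right_mono)
      show "x \<le> 80 * exp (x / 80)" using exp_ge_add_one_self[of "x / 80"] by linarith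
    qed simp
    also have "\<dots> = 80 * exp (- x / 80)" by (simp add: mult.assoc flip: exp_add)
    also have "\<dots> \<le> 80 * exp (- L / 800)" using x by simp
    finally have few: "graph_prob n p Few \<le> 80 * exp (- L / 800)" .
    have "graph_prob n p Big \<le> real n * exp (2 * (real n * p) - 13 * x)"
      unfolding Big_def by (rule prob_max_degree_large) (use p n in auto)
    also have "\<dots> = exp L * exp (- 11 * x)" using n0 by (simp add: L x_def)
    also have "\<dots> = exp (L - 11 * x)" unfolding exp_add[symmetric] by simp
    also have "\<dots> \<le> exp (- L / 10)" using x by simp
    finally have big: "graph_prob n p Big \<le> exp (- L / 10)" .
    have "?P \<le> graph_prob n p (Few \<union> Big)"
    proof (intro measure_pmf.finite_measure_mono subsetI)
      fix y assume bad: "y \<in> {y. \<not> 1 / (4 * 10 ^ 14) * real (max_degree {..<n} (graph n y)) \<le> real (graph_degrees n y)}"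
      show "y \<in> Few \<union> Big"
      proof (rule ccontr)
        assume "y \<notin> Few \<union> Big"
        hence y: "nat \<lfloor>x / 16\<rfloor> \<le> graph_degrees n y" "real (max_degree {..<n} (graph n y)) < 13 * x"
          by (auto simp: Few_def Big_def x_def)
        have "1 \<le> \<lfloor>x / 16\<rfloor>" using x(2) by simp
        hence "x / 32 \<le> real (nat \<lfloor>x / 16\<rfloor>)" by linarith
        also have "\<dots> \<le> real (graph_degrees n y)" using y(1) by (rule of_nat_mono)
        finally show False using bad y(2) by simp
      qed
    qed simp
    also have "\<dots> \<le> graph_prob n p Few + graph_prob n p Big"
      by (rule measure_Un_le) auto
    finally show ?thesis using few big e2 by linarith
  qed
qed

text \<open>The bounds of the two preceding lemmas added up.\<close>
definition failure_bound :: "nat \<Rightarrow> real" where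
  "failure_bound n = (exp (- 3 * real n) + exp (- sqrt (real n) / (2 * 10 ^ 14)) + 2 * real n * exp (1 - real n powr (1 / 6))
      + real n * exp (- sqrt (real n)) + real n ^ 2 * exp (- sqrt (real n) / 80))
    + ((80 * exp (- ln (real n) / 800) + exp (- ln (real n) / 10))
      + (1 / real n + (ln (real n) / 10) ^ 6 / real n + exp (- exp (3/5 * ln (real n)) / 30)))"

lemma failure_bound_tendsto: "failure_bound \<longlonglongrightarrow> 0"
proof -
  have "(\<lambda>n. failure_bound n) \<longlonglongrightarrow> 0 + (0 + 0)"
    unfolding failure_bound_def by (intro tendsto_add) real_asymp+
  thus ?thesis by simp
qed

lemma prob_good_graph:
  "\<forall>\<^sub>F n in sequentially. \<forall>p. 0 \<le> p \<and> p \<le> 1 / 2 \<longrightarrow>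
     1 - failure_bound n \<le> measure_pmf.prob (gnp n p) {E. good_graph (1 / (4 * 10 ^ 14)) n p E}"
proof -
  have "\<forall>\<^sub>F n::nat in sequentially. 160 \<le> ln (real n)" by real_asymp
  moreover have "\<forall>\<^sub>F n::nat in sequentially. 2 * ln (real n) + 1 \<le> real n / 2" by real_asymp
  moreover have "\<forall>\<^sub>F n::nat in sequentially. 2 * ln (real n) + 1 \<le> exp (3/5 * ln (real n)) / 6" by real_asymp
  moreover have "\<forall>\<^sub>F n::nat in sequentially. 10 ^ 28 \<le> real n" by real_asymp
  ultimately show ?thesis
  proof eventually_elim
    case (elim n)
    have n: "1 < n" using elim(4) by simp
    show ?case
    proof (intro allI impI)
      fix p :: real assume p: "0 \<le> p \<and> p \<le> 1 / 2"
      let ?c = "1 / (4 * 10 ^ 14) :: real"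
      define D where "D = (\<lambda>y. real (graph_degrees n y))"
      define X where "X = (\<lambda>y. real (max_degree {..<n} (graph n y)))"
      define \<kappa> where "\<kappa> = root 3 (p * real n ^ 2)"
      define Bad1 where "Bad1 = {y. real n powr (- 1 / 2) \<le> p \<and> \<not> (?c * \<kappa> \<le> D y \<and> D y \<le> 16 * \<kappa>)}"
      define Bad2 where "Bad2 = {y. p \<le> real n powr (- 1 / 2) \<and> \<not> ?c * X y \<le> D y}"
      define e1 where "e1 = exp (- 3 * real n) + exp (- sqrt (real n) / (2 * 10 ^ 14)) + 2 * real n * exp (1 - real n powr (1 / 6))
        + real n * exp (- sqrt (real n)) + real n ^ 2 * exp (- sqrt (real n) / 80)"
      define e2 where "e2 = (80 * exp (- ln (real n) / 800) + exp (- ln (real n) / 10))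
        + (1 / real n + (ln (real n) / 10) ^ 6 / real n + exp (- exp (3/5 * ln (real n)) / 30))"
      have nn: "0 \<le> e1" "0 \<le> e2" using elim(1) unfolding e1_def e2_def by (auto intro!: add_nonneg_nonneg)
      have b1: "graph_prob n p Bad1 \<le> e1"
      proof (cases "real n powr (- 1 / 2) \<le> p")
        case True
        thus ?thesis using prob_bad_above_threshold[OF elim(4) True] p
          unfolding Bad1_def D_def \<kappa>_def e1_def by simp
      qed (simp add: Bad1_def nn)
      have b2: "graph_prob n p Bad2 \<le> e2"
      proof (cases "p \<le> real n powr (- 1 / 2)")
        case True
        thus ?thesis using prob_bad_below_threshold[OF n refl elim(1) _ _ True elim(2,3)] p
          unfolding Bad2_def D_def X_def e2_def by simp
      qed (simp add: Bad2_def nn)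
      have "graph_prob n p {y. \<not> good_graph ?c n p (graph n y)}
         \<le> graph_prob n p (Bad1 \<union> Bad2)"
      proof (intro measure_pmf.finite_measure_mono subsetI)
        fix y assume y: "y \<in> {y. \<not> good_graph ?c n p (graph n y)}"
        have "D y \<le> real (Suc (max_degree {..<n} (graph n y)))"
          unfolding D_def by (intro of_nat_mono distinct_degrees_le_max_degree) auto
        also have "\<dots> \<le> real (16 * max 1 (max_degree {..<n} (graph n y)))" by (intro of_nat_mono) auto
        finally have "D y \<le> 16 * real (max 1 (max_degree {..<n} (graph n y)))" by simp
        thus "y \<in> Bad1 \<union> Bad2"
          using y unfolding good_graph_def Bad1_def Bad2_def D_def X_def \<kappa>_def by blast
      qed simp
      also have "\<dots> \<le> graph_prob n p Bad1 + graph_prob n p Bad2"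
        by (rule measure_Un_le) auto
      also have "\<dots> \<le> failure_bound n" using b1 b2 unfolding failure_bound_def e1_def e2_def by linarith
      finally have "graph_prob n p {y. \<not> good_graph ?c n p (graph n y)} \<le> failure_bound n" .
      moreover have "graph_prob n p {y. \<not> good_graph ?c n p (graph n y)}
         = 1 - graph_prob n p {y. good_graph ?c n p (graph n y)}"
        by (subst measure_pmf.prob_compl[symmetric]) (auto intro!: arg_cong[where f="measure_pmf.prob _"])
      ultimately show "1 - failure_bound n \<le> measure_pmf.prob (gnp n p) {E. good_graph ?c n p E}"
        unfolding prob_gnp by linarith
    qed
  qed
qed

theorem theorem1p3:
  "\<exists>c C :: real. 0 < c \<and> 0 < C \<and>
    (\<forall>p :: nat \<Rightarrow> real. (\<forall>n. 0 \<le> p n \<and> p n \<le> 1 / 2) \<longrightarrow>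
      (\<lambda>n. measure_pmf.prob (gnp n (p n))
        {E. (real n powr (- 1 / 2) \<le> p n \<longrightarrow>
               c * root 3 (p n * real n ^ 2) \<le> real (distinct_degrees {..<n} E) \<and>
               real (distinct_degrees {..<n} E) \<le> C * root 3 (p n * real n ^ 2)) \<and>
            (p n \<le> real n powr (- 1 / 2) \<longrightarrow>
               c * real (max_degree {..<n} E) \<le> real (distinct_degrees {..<n} E) \<and>
               real (distinct_degrees {..<n} E) \<le> C * real (max 1 (max_degree {..<n} E)))})
      \<longlonglongrightarrow> 1)"
proof (intro exI conjI allI impI)
  \<comment> \<open>For large \<open>p\<close> there are \<open>k / 2\<close> distinct degrees with \<open>k \<ge> \<kappa> / (2 \<cdot> 10\<^bsup>14\<^esup>)\<close>, and fewer than
    \<open>4 \<lceil>3 \<kappa>\<rceil> \<le> 16 \<kappa>\<close>.\<close>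
  show "0 < (1 / (4 * 10 ^ 14) :: real)" "0 < (16 :: real)" by simp_all
  fix p :: "nat \<Rightarrow> real" assume p: "\<forall>n. 0 \<le> p n \<and> p n \<le> 1 / 2"
  have "(\<lambda>n. measure_pmf.prob (gnp n (p n)) {E. good_graph (1 / (4 * 10 ^ 14)) n (p n) E}) \<longlonglongrightarrow> 1"
  proof (rule tendsto_sandwich[where f = "\<lambda>n. 1 - failure_bound n" and h = "\<lambda>_. 1"])
    show "\<forall>\<^sub>F n in sequentially. 1 - failure_bound n
        \<le> measure_pmf.prob (gnp n (p n)) {E. good_graph (1 / (4 * 10 ^ 14)) n (p n) E}"
      using prob_good_graph by eventually_elim (use p in blast)
    show "(\<lambda>n. 1 - failure_bound n) \<longlonglongrightarrow> 1"
      using tendsto_diff[OF tendsto_const failure_bound_tendsto, of 1] by simp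
  qed (auto intro!: always_eventually)
  thus "(\<lambda>n. measure_pmf.prob (gnp n (p n))
        {E. (real n powr (- 1 / 2) \<le> p n \<longrightarrow>
               1 / (4 * 10 ^ 14) * root 3 (p n * real n ^ 2) \<le> real (distinct_degrees {..<n} E) \<and>
               real (distinct_degrees {..<n} E) \<le> 16 * root 3 (p n * real n ^ 2)) \<and>
            (p n \<le> real n powr (- 1 / 2) \<longrightarrow>
               1 / (4 * 10 ^ 14) * real (max_degree {..<n} E) \<le> real (distinct_degrees {..<n} E) \<and>
               real (distinct_degrees {..<n} E) \<le> 16 * real (max 1 (max_degree {..<n} E)))})
      \<longlonglongrightarrow> 1"
    unfolding good_graph_def .
qed

end
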